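(* Let $\mu$ be a positive, $\sigma$-finite, locally finite Borel measure on the unit disk $\mathbb{D}$ with $\mu(\mathbb{D})=+\infty$, let $\Lambda_\mu$ be the Poisson point process on $\mathbb{D}$ with intensity $\mu$, and let $\mu_{n,k}=\mu(T_{n,k})$ for $n\ge 0$, $0\le k\le 2^n-1$. Then, for any $0<p\le\infty$, \[ \mathbb{P}\bigl(\Lambda_\mu\text{ is } H^p\text{-interpolating}\bigr)= \begin{cases} 1 & \text{if } \sum_{n,k}\mu_{n,k}^{2}<\infty,\\ 0 & \text{if } \sum_{n,k}\mu_{n,k}^{2}=\infty. \end{cases} \]
   Context: $\mathbb{D}=\{z\in\mathbb{C}:|z|<1\}$; $H(\mathbb{D})$ is the space of holomorphic functions in $\mathbb{D}$. The Poisson point process $\Lambda_\mu$ with intensity $\mu$ is the random sequence of points of $\mathbb{D}$ (unique in law) such that, writing $N_A=\#(A\cap\Lambda_\mu)$: (a) for each Borel set $A\subset\mathbb{D}$, $N_A$ is a Poisson random variable of parameter $\mu(A)$; (b) $N_A$ and $N_B$ are independent for disjoint Borel sets $A,B\subset\mathbb{D}$. Locally finite means finite on compact subsets of $\mathbb{D}$. Dyadic boxes: for $n\ge 0$ and $k=0,1,\dots,2^n-1$, \[ T_{n,k}=\Bigl\{z=re^{it}\in\mathbb{D}: 2^{-(n+1)}<1-r\le 2^{-n},\ \tfrac{k}{2^n}\le\tfrac{t}{2\pi}<\tfrac{k+1}{2^n}\Bigr\}. \] Sums $\sum_{n,k}$ run over all $n\ge 0$ and $0\le k\le 2^n-1$.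 Hardy spaces: $H^\infty=\{f\in H(\mathbb{D}):\sup_{\mathbb{D}}|f|<\infty\}$ and, for $0<p<\infty$, $H^p=\{f\in H(\mathbb{D}):\sup_{r<1}\bigl(\int_0^{2\pi}|f(re^{it})|^p\frac{dt}{2\pi}\bigr)^{1/p}<\infty\}$. A sequence $\{\lambda_n\}_n\subset\mathbb{D}$ is $H^\infty$-interpolating if for every bounded sequence $\{w_n\}_n\subset\mathbb{C}$ there is $f\in H^\infty$ with $f(\lambda_n)=w_n$ for all $n$; for $0<p<\infty$ it is $H^p$-interpolating if for every $\{w_n\}_n\subset\mathbb{C}$ with $\sum_n(1-|\lambda_n|^2)|w_n|^p<\infty$ there is $f\in H^p$ with $f(\lambda_n)=w_n$ for all $n$.
   Formalization: The points of Λ_μ are taken to be distinct, with N_A the cardinality of the set A∩Λ_μ, which forces μ to have no atoms; with an atom and a convergent sum, a point repeats with positive probability and the claim of probability 1 fails. *)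

theory Defs
  imports "HOL-Probability.Probability"
begin

abbreviation unit_disk :: "complex set"
  where "unit_disk \<equiv> ball 0 1"

section \<open>Poisson point processes\<close>

definition count_points :: "'a set \<Rightarrow> enat"
  where "count_points S = (if finite S then enat (card S) else \<infinity>)"

text \<open>The parameter ranges over \<open>[0, \<infinity>]\<close>. The parameter \<open>0\<close> gives the constant \<open>0\<close>
  (with \<open>0 ^ 0 = 1\<close>; the library's \<open>poisson_pmf\<close> only covers positive finite rates), and by the
  usual convention a Poisson variable of parameter \<open>\<infinity>\<close> is almost surely infinite.\<close>

definition poisson_variable :: "'w measure \<Rightarrow> ('w \<Rightarrow> enat) \<Rightarrow> ennreal \<Rightarrow> bool"
  where "poisson_variable M X m \<longleftrightarrow>
    X \<in> measurable M (count_space UNIV) \<and>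
    (if m = \<infinity> then (AE \<omega> in M. X \<omega> = \<infinity>)
     else \<forall>k::nat. measure M {\<omega> \<in> space M. X \<omega> = enat k} =
            exp (- enn2real m) * enn2real m ^ k / fact k)"

text \<open>The process is a random countable set of points and \<open>N\<^sub>A = #(A \<inter> \<Lambda>)\<close> is the literal
  cardinality of \<open>A \<inter> \<Lambda>\<close>; that is, the points of the random sequence are distinct. As usual
  for point processes realised as random sets, the Poisson law of \<open>N\<^sub>A\<close> for singletons \<open>A\<close> then
  forces the intensity to have no atoms (a sequence with repeated points could never be
  interpolating).\<close>

definition poisson_point_process ::
    "'w measure \<Rightarrow> 'a measure \<Rightarrow> ('w \<Rightarrow> 'a set) \<Rightarrow> bool"
  where "poisson_point_process M \<mu> \<Lambda> \<longleftrightarrow>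
    prob_space M \<and>
    (\<forall>\<omega>\<in>space M. countable (\<Lambda> \<omega>) \<and> \<Lambda> \<omega> \<subseteq> space \<mu>) \<and>
    (\<forall>A\<in>sets \<mu>. poisson_variable M (\<lambda>\<omega>. count_points (A \<inter> \<Lambda> \<omega>)) (emeasure \<mu> A)) \<and>
    (\<forall>A\<in>sets \<mu>. \<forall>B\<in>sets \<mu>. A \<inter> B = {} \<longrightarrow>
       prob_space.indep_var M
         (count_space UNIV) (\<lambda>\<omega>. count_points (A \<inter> \<Lambda> \<omega>))
         (count_space UNIV) (\<lambda>\<omega>. count_points (B \<inter> \<Lambda> \<omega>)))"

section \<open>Dyadic boxes\<close>

definition dyadic_box :: "nat \<Rightarrow> nat \<Rightarrow> complex set"
  where "dyadic_box n k = {z \<in> unit_disk. \<exists>r t :: real.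
    z = of_real r * cis t \<and> 1 / 2 ^ (n + 1) < 1 - r \<and> 1 - r \<le> 1 / 2 ^ n \<and>
    real k / 2 ^ n \<le> t / (2 * pi) \<and> t / (2 * pi) < (real k + 1) / 2 ^ n}"

section \<open>Hardy spaces and interpolating sequences\<close>

definition hardy_infinity :: "(complex \<Rightarrow> complex) set"
  where "hardy_infinity = {f. f holomorphic_on unit_disk \<and> bounded (f ` unit_disk)}"

definition hardy :: "real \<Rightarrow> (complex \<Rightarrow> complex) set"
  where "hardy p = {f. f holomorphic_on unit_disk \<and>
    bdd_above ((\<lambda>r. (integral {0..2 * pi}
        (\<lambda>t. cmod (f (of_real r * cis t)) powr p / (2 * pi))) powr (1 / p)) ` {0..<1})}"

text \<open>A sequence of distinct points is given by its set \<open>S\<close> of points and is indexed by the points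
  themselves, so data \<open>(w\<^sub>n)\<close> are a function on \<open>S\<close> (its values off \<open>S\<close> are irrelevant).
  Exponents \<open>p\<close> are meant to satisfy \<open>0 < p \<le> \<infinity>\<close>.\<close>

definition interpolating :: "ennreal \<Rightarrow> complex set \<Rightarrow> bool"
  where "interpolating p S \<longleftrightarrow>
    S \<subseteq> unit_disk \<and>
    (if p = \<infinity> then
       \<forall>w :: complex \<Rightarrow> complex. bounded (w ` S) \<longrightarrow>
         (\<exists>f\<in>hardy_infinity. \<forall>z\<in>S. f z = w z)
     else
       \<forall>w :: complex \<Rightarrow> complex.
         (\<lambda>z. (1 - (cmod z)\<^sup>2) * cmod (w z) powr enn2real p) summable_on S \<longrightarrow>
         (\<exists>f\<in>hardy (enn2real p). \<forall>z\<in>S. f z = w z))"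

end

theory Submission
  imports Defs "HOL-Complex_Analysis.Complex_Analysis"
begin

text \<open>Write \<open>szego_overlap z w\<close> for one minus the square of the pseudohyperbolic distance of \<open>z\<close> and \<open>w\<close>.

If the series of squared box masses converges, then Schur's test on the dyadic boxes bounds the
expectation of the sum of \<open>szego_overlap z w\<close> over all pairs of distinct points of the process. Hence this sum
is almost surely finite, which is a strong form of Carleson's condition: P. Jones' explicit
interpolation formula solves the problem on finite subsets with uniform bounds, for all exponents
at once, and Montel's theorem yields the interpolating function.

If the series diverges, cut every box into boundedly many pieces of small pseudohyperbolic diameter
and keep the heaviest. The events that such a piece contains two points are pairwise independent
with divergent probability sum, so almost surely there are pairs of points, arbitrarily far out and
arbitrarily close to each other. A function in a Hardy class grows at most like
\<open>(1 - |z|) powr (- 1 / p)\<close>, so it cannot separate such pairs, although suitable admissible data do.\<close>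

section \<open>The Poisson kernel and growth in Hardy spaces\<close>

text \<open>Independence is assumed for two disjoint sets at a time, so both halves work with pairs
  alone: a first moment of a sum over pairs, and Chebyshev's inequality in place of the second
  Borel-Cantelli lemma. Pairs of distinct points are the right quantity because a Poisson count N of
  parameter m has E N(N - 1) = m^2: a box contributes the square of its mass and no linear term,
  while the masses themselves sum to mu(D), which is infinite. Summability over all pairs also
  yields separation, since only finitely many pairs can have overlap above 1/2. The case p < 1 is
  also the obstacle in the growth estimate: Jensen's inequality points the wrong way there, and an
  absorption argument replaces it. After Schur weighting, boxes of generations n and m interact with
  strength 2^(-|n - m| / 2), so square summability of the masses suffices.\<close>

lemma poisson_formula:
  fixes f :: "complex \<Rightarrow> complex"
  assumes hol: "f holomorphic_on cball 0 R" and z: "cmod z < R"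
  shows "((\<lambda>t. f (of_real R * cis t) * of_real ((R\<^sup>2 - (cmod z)\<^sup>2) / (cmod (of_real R * cis t - z))\<^sup>2))
           has_integral 2 * pi * f z) {0..2 * pi}"
proof -
  \<comment> \<open>The extra factor equals 1 at \<open>z\<close>, and on the circle |u| = R, where
    R^2 = u * cnj u, it turns the Cauchy kernel into the Poisson kernel. It has no pole in the disk
    since |cnj z * u| < R^2.\<close>
  define g where "g u = f u * of_real (R\<^sup>2 - (cmod z)\<^sup>2) / (of_real (R\<^sup>2) - cnj z * u)" for u
  have R: "0 < R"
    using z le_less_trans norm_ge_zero by blast
  have nz: "of_real (R\<^sup>2) - cnj z * u \<noteq> 0" if "cmod u \<le> R" for u
  proof
    assume "of_real (R\<^sup>2) - cnj z * u = 0"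
    then have "cmod (of_real (R\<^sup>2)) = cmod z * cmod u"
      by (metis complex_mod_cnj eq_iff_diff_eq_0 norm_mult)
    then have "R * R = cmod z * cmod u"
      by (simp only: norm_of_real) (simp add: power2_eq_square)
    moreover have "cmod z * cmod u < R * R"
      using z that R by (metis norm_ge_zero mult_left_mono le_less_trans mult_strict_right_mono)
    ultimately show False
      by simp
  qed
  have "g holomorphic_on cball 0 R"
    unfolding g_def using nz by (intro holomorphic_intros hol) auto
  then have "((\<lambda>u. g u / (u - z)) has_contour_integral 2 * of_real pi * \<i> * g z) (circlepath 0 R)"
    using z by (intro Cauchy_integral_circlepath_simple) auto
  then have "((\<lambda>t. g (0 + R * cis t) / (0 + R * cis t - z) * R * \<i> * cis t) has_integral
      2 * of_real pi * \<i> * g z) {0..2 * pi}"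
    unfolding circlepath_def by (subst (asm) has_contour_integral_part_circlepath_iff) auto
  then have "((\<lambda>t. (- \<i>) * (g (0 + R * cis t) / (0 + R * cis t - z) * R * \<i> * cis t)) has_integral
      (- \<i>) * (2 * of_real pi * \<i> * g z)) {0..2 * pi}"
    by (rule has_integral_mult_right)
  moreover have "g z = f z"
  proof -
    have "of_real (R\<^sup>2) - cnj z * z = of_real (R\<^sup>2 - (cmod z)\<^sup>2)"
      using complex_norm_square[of z] by (simp add: mult.commute del: complex_mult_cnj)
    then show ?thesis
      unfolding g_def using nz[of z] z by simp
  qed
  moreover have "(- \<i>) * (g (0 + R * cis t) / (0 + R * cis t - z) * R * \<i> * cis t) =
      f (of_real R * cis t) * of_real ((R\<^sup>2 - (cmod z)\<^sup>2) / (cmod (of_real R * cis t - z))\<^sup>2)" for t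
  proof -
    define u where "u = of_real R * cis t"
    have u: "cmod u = R"
      using R by (simp add: u_def norm_mult)
    have un: "u - z \<noteq> 0" "u \<noteq> 0"
      using u z R by auto
    have cu: "of_real (R\<^sup>2) = u * cnj u"
      using u complex_norm_square[of u] by simp
    have "of_real (R\<^sup>2) - cnj z * u = u * cnj (u - z)"
      using cu by (simp add: algebra_simps)
    moreover have "(- \<i>) * (X * R * \<i> * cis t) = X * u" for X :: complex
    proof -
      have "(- \<i>) * (X * R * \<i> * cis t) = (- (\<i> * \<i>)) * (X * u)"
        unfolding u_def by (simp only: mult_ac mult_minus_left mult_minus_right)
      then show ?thesis by simp
    qed
    ultimately have "(- \<i>) * (g u / (u - z) * R * \<i> * cis t) =
        f u * of_real (R\<^sup>2 - (cmod z)\<^sup>2) / (u * cnj (u - z)) / (u - z) * u"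
      by (simp add: g_def)
    also have "a / (u * c) / d * u = a / (d * c)" for a c d :: complex
      using un by (simp add: field_simps)
    also have "(u - z) * cnj (u - z) = of_real ((cmod (u - z))\<^sup>2)"
      by (simp only: complex_norm_square)
    finally show ?thesis
      by (simp add: u_def)
  qed
  ultimately show ?thesis
    by (simp add: algebra_simps)
qed

text \<open>Poisson's formula for the constant 1 on the unit circle, with pole \<open>cnj x\<close>.
  The closed form gives the circle means of the bumps and the sums over a generation of
  boxes.\<close>

lemma poisson_kernel_integral:
  assumes "cmod x < 1"
  shows "((\<lambda>t. 1 / (cmod (1 - x * cis t))\<^sup>2) has_integral 2 * pi / (1 - (cmod x)\<^sup>2)) {0..2 * pi}"
proof -
  have eq: "cmod (1 - x * cis t) = cmod (cis t - cnj x)" for t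
  proof -
    have "cmod (cis t - cnj x) = cmod (cnj (cis t - cnj x))"
      by (simp only: complex_mod_cnj)
    also have "cnj (cis t - cnj x) = cis (- t) * (1 - x * cis t)"
      by (simp add: algebra_simps cis_cnj cis_mult)
    finally show ?thesis
      by (simp add: norm_mult)
  qed
  have pos: "1 - (cmod x)\<^sup>2 > 0"
    using assms by (simp add: abs_square_less_1)
  have "((\<lambda>t. Re (1 * of_real ((1\<^sup>2 - (cmod (cnj x))\<^sup>2) / (cmod (of_real 1 * cis t - cnj x))\<^sup>2)))
      has_integral Re (of_real (2 * pi) * 1)) {0..2 * pi}"
    using assms poisson_formula[of "\<lambda>_. 1" 1 "cnj x"]
    by (intro has_integral_Re) auto
  then have "((\<lambda>t. (1 - (cmod x)\<^sup>2) / (cmod (1 - x * cis t))\<^sup>2) has_integral 2 * pi) {0..2 * pi}"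
    by (simp only: eq mult_1 mult_1_right Re_complex_of_real power_one of_real_1 complex_mod_cnj)
  from has_integral_divide[OF this, of "1 - (cmod x)\<^sup>2"] show ?thesis
    using pos by simp
qed

lemma poisson_bound:
  assumes hol: "f holomorphic_on cball 0 R" and z: "cmod z < R"
  shows "2 * pi * cmod (f z) \<le> integral {0..2 * pi}
    (\<lambda>t. cmod (f (of_real R * cis t)) * ((R\<^sup>2 - (cmod z)\<^sup>2) / (cmod (of_real R * cis t - z))\<^sup>2))"
proof -
  have R: "0 < R"
    using z le_less_trans norm_ge_zero by blast
  have ne: "cmod (of_real R * cis t - z) \<noteq> 0" for t
    using z R by (auto simp: norm_mult)
  have sq: "0 \<le> R\<^sup>2 - (cmod z)\<^sup>2"
    using z by (simp add: power_mono)
  have contf: "continuous_on {0..2 * pi} (\<lambda>t. f (of_real R * cis t))"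
    using R by (intro continuous_on_compose2[OF holomorphic_on_imp_continuous_on[OF hol]]
        continuous_intros) (auto simp: norm_mult)
  note P = poisson_formula[OF hol z]
  have "cmod (2 * pi * f z) \<le> integral {0..2 * pi}
    (\<lambda>t. cmod (f (of_real R * cis t)) * ((R\<^sup>2 - (cmod z)\<^sup>2) / (cmod (of_real R * cis t - z))\<^sup>2))"
    unfolding integral_unique[OF P, symmetric]
  proof (rule integral_norm_bound_integral)
    show "(\<lambda>t. f (of_real R * cis t) * of_real ((R\<^sup>2 - (cmod z)\<^sup>2) / (cmod (of_real R * cis t - z))\<^sup>2))
        integrable_on {0..2 * pi}"
      using P by blast
    show "(\<lambda>t. cmod (f (of_real R * cis t)) * ((R\<^sup>2 - (cmod z)\<^sup>2) / (cmod (of_real R * cis t - z))\<^sup>2))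
        integrable_on {0..2 * pi}"
      using ne by (intro integrable_continuous_interval continuous_intros contf) auto
  qed (use sq in \<open>simp add: norm_mult norm_divide norm_power abs_mult flip: of_real_power of_real_diff\<close>)
  then show ?thesis
    by (simp add: norm_mult)
qed

lemma poisson_kernel_le:
  assumes "cmod z < R"
  shows "(R\<^sup>2 - (cmod z)\<^sup>2) / (cmod (of_real R * cis t - z))\<^sup>2 \<le> 2 * R / (R - cmod z)"
proof -
  have R: "0 < R"
    using assms le_less_trans norm_ge_zero by blast
  have "R - cmod z \<le> cmod (of_real R * cis t - z)"
    using norm_triangle_ineq2[of "of_real R * cis t" z] R by (simp add: norm_mult)
  then have "(R - cmod z)\<^sup>2 \<le> (cmod (of_real R * cis t - z))\<^sup>2"
    using assms by (intro power_mono) auto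
  moreover have "0 \<le> R\<^sup>2 - (cmod z)\<^sup>2"
    using assms by (simp add: power_mono)
  ultimately have "(R\<^sup>2 - (cmod z)\<^sup>2) / (cmod (of_real R * cis t - z))\<^sup>2 \<le> (R\<^sup>2 - (cmod z)\<^sup>2) / (R - cmod z)\<^sup>2"
    using assms by (intro divide_left_mono mult_pos_pos) auto
  also have "\<dots> = (R + cmod z) / (R - cmod z)"
    using assms by (simp add: power2_eq_square divide_simps) (simp add: algebra_simps)
  also have "\<dots> \<le> 2 * R / (R - cmod z)"
    using assms by (intro divide_right_mono) auto
  finally show ?thesis .
qed

text \<open>The tangent at \<open>t\<close> lies below the convex function x powr p; here this is
  Young's inequality. It takes the place of Jensen's inequality, once for integrals and once for
  weighted finite sums.\<close>

lemma powr_above_tangent: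
  fixes x t p :: real
  assumes "1 \<le> p" "0 \<le> x" "0 < t"
  shows "p * t powr (p - 1) * x - (p - 1) * t powr p \<le> x powr p"
proof (cases "p = 1")
  case False
  then have p: "1 < p"
    using assms by simp
  have young: "x * t powr (p - 1) \<le> x powr p / p + (t powr (p - 1)) powr (p / (p - 1)) / (p / (p - 1))"
    using p assms by (intro Youngs_inequality) (auto simp: field_simps)
  have "(t powr (p - 1)) powr (p / (p - 1)) = t powr p"
    using p by (simp add: powr_powr)
  with young have "p * (x * t powr (p - 1)) \<le> p * (x powr p / p + t powr p / (p / (p - 1)))"
    using p by (intro mult_left_mono) auto
  also have "\<dots> = x powr p + (p - 1) * t powr p"
    using p by (simp add: distrib_left)
  finally show ?thesis
    by (simp add: algebra_simps)
qed (use assms in simp)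

text \<open>The default value 0 of the integral covers functions that are not integrable.\<close>

lemma integral_nonneg_gen:
  fixes f :: "real \<Rightarrow> real"
  assumes "\<And>x. x \<in> S \<Longrightarrow> 0 \<le> f x"
  shows "0 \<le> integral S f"
  using assms by (cases "f integrable_on S") (auto simp: not_integrable_integral intro: integral_nonneg)

section \<open>Pointwise growth of functions in Hardy spaces\<close>

lemma hardy_means_bounded:
  assumes "f \<in> hardy p" "0 < p"
  obtains K where "0 \<le> K"
    and "\<And>r. 0 \<le> r \<Longrightarrow> r < 1 \<Longrightarrow> integral {0..2 * pi} (\<lambda>t. cmod (f (of_real r * cis t)) powr p) \<le> K"
proof -
  let ?I = "\<lambda>r. integral {0..2 * pi} (\<lambda>t. cmod (f (of_real r * cis t)) powr p / (2 * pi))"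
  obtain B where B: "\<And>r. r \<in> {0..<1} \<Longrightarrow> ?I r powr (1 / p) \<le> B"
    using assms(1) unfolding hardy_def bdd_above_def by blast
  show ?thesis
  proof (rule that[of "2 * pi * B powr p"])
    fix r :: real
    assume r: "0 \<le> r" "r < 1"
    have nn: "0 \<le> integral {0..2 * pi} (\<lambda>t. cmod (f (of_real r * cis t)) powr p)"
      by (intro integral_nonneg_gen) auto
    have "?I r = (?I r powr (1 / p)) powr p"
      using nn assms(2) by (simp add: powr_powr)
    also have "\<dots> \<le> B powr p"
      using B[of r] r assms(2) by (intro powr_mono2) auto
    finally show "integral {0..2 * pi} (\<lambda>t. cmod (f (of_real r * cis t)) powr p) \<le> 2 * pi * B powr p"
      by (simp add: field_simps)
  qed simp
qed

text \<open>Jensen's inequality for the probability density \<open>P t / (2 * pi)\<close>: the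
  tangent at \<open>T\<close> = |f z| is integrated against the kernel, and
  \<open>poisson_bound\<close> says that the mean of |f| for this density is at least
  \<open>T\<close>.\<close>

lemma hardy_growth_ge_1:
  assumes hol: "f holomorphic_on cball 0 R" and z: "cmod z < R" and R: "R < 1" and p: "1 \<le> p"
    and K: "integral {0..2 * pi} (\<lambda>t. cmod (f (of_real R * cis t)) powr p) \<le> K"
  shows "cmod (f z) powr p \<le> K / (pi * (R - cmod z))"
proof (cases "f z = 0")
  case True
  have "0 \<le> integral {0..2 * pi} (\<lambda>t. cmod (f (of_real R * cis t)) powr p)"
    by (intro integral_nonneg_gen) auto
  then show ?thesis
    using True K z by simp
next
  case False
  define T where "T = cmod (f z)"
  have T: "0 < T"
    using False by (simp add: T_def)
  have R0: "0 < R"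
    using z le_less_trans norm_ge_zero by blast
  define P where "P t = (R\<^sup>2 - (cmod z)\<^sup>2) / (cmod (of_real R * cis t - z))\<^sup>2" for t
  have ne: "cmod (of_real R * cis t - z) \<noteq> 0" for t
    using z R0 by (auto simp: norm_mult)
  have sq: "0 \<le> R\<^sup>2 - (cmod z)\<^sup>2"
    using z by (simp add: power_mono)
  have P0: "0 \<le> P t" for t
    using sq by (simp add: P_def)
  have contP: "continuous_on {0..2 * pi} P"
    unfolding P_def using ne by (intro continuous_intros) auto
  have contf: "continuous_on {0..2 * pi} (\<lambda>t. f (of_real R * cis t))"
    using R0 by (intro continuous_on_compose2[OF holomorphic_on_imp_continuous_on[OF hol]]
        continuous_intros) (auto simp: norm_mult)
  have intP: "integral {0..2 * pi} P = 2 * pi"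
  proof -
    have "((\<lambda>t. 1 * complex_of_real (P t)) has_integral complex_of_real (2 * pi) * 1) {0..2 * pi}"
      unfolding P_def using z poisson_formula[of "\<lambda>_. 1" R z] by simp
    then have "((\<lambda>t. Re (complex_of_real (P t))) has_integral Re (complex_of_real (2 * pi))) {0..2 * pi}"
      by (intro has_integral_Re) simp
    then have "(P has_integral 2 * pi) {0..2 * pi}"
      by (simp only: Re_complex_of_real)
    then show ?thesis
      by (rule integral_unique)
  qed
  let ?F = "\<lambda>t. cmod (f (of_real R * cis t))"
  have cp: "continuous_on {0..2 * pi} (\<lambda>t. ?F t powr p)"
    using p by (intro continuous_on_powr' continuous_intros contf) auto
  have "(p * T powr (p - 1)) * (2 * pi * T) - (p - 1) * T powr p * (2 * pi) \<le>
      (p * T powr (p - 1)) * integral {0..2 * pi} (\<lambda>t. ?F t * P t) - (p - 1) * T powr p * integral {0..2 * pi} P"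
    using poisson_bound[OF hol z] p unfolding intP T_def P_def by (intro diff_right_mono mult_left_mono) auto
  also have "\<dots> = integral {0..2 * pi} (\<lambda>t. (p * T powr (p - 1)) * (?F t * P t) - (p - 1) * T powr p * P t)"
    using contP contf
    by (subst Henstock_Kurzweil_Integration.integral_diff) (auto intro!: integrable_continuous_interval continuous_intros)
  also have "\<dots> \<le> integral {0..2 * pi} (\<lambda>t. 2 * R / (R - cmod z) * ?F t powr p)"
  proof (rule integral_le)
    fix t :: real
    have "(p * T powr (p - 1)) * (?F t * P t) - (p - 1) * T powr p * P t =
        (p * T powr (p - 1) * ?F t - (p - 1) * T powr p) * P t"
      by (simp add: algebra_simps)
    also have "\<dots> \<le> ?F t powr p * P t"
      using p T P0 by (intro mult_right_mono powr_above_tangent) auto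
    also have "\<dots> \<le> ?F t powr p * (2 * R / (R - cmod z))"
      unfolding P_def by (intro mult_left_mono poisson_kernel_le z) auto
    finally show "(p * T powr (p - 1)) * (?F t * P t) - (p - 1) * T powr p * P t \<le>
        2 * R / (R - cmod z) * ?F t powr p"
      by (simp add: mult.commute)
  qed (use z contP contf cp in \<open>auto intro!: integrable_continuous_interval continuous_intros\<close>)
  also have "\<dots> = 2 * R / (R - cmod z) * integral {0..2 * pi} (\<lambda>t. ?F t powr p)"
    by simp
  also have "\<dots> \<le> 2 * 1 / (R - cmod z) * K"
    using R R0 z K integral_nonneg_gen[of "{0..2 * pi}" "\<lambda>t. ?F t powr p"]
    by (intro mult_mono divide_right_mono) (auto intro!: integral_nonneg_gen)
  also have "(p * T powr (p - 1)) * (2 * pi * T) - (p - 1) * T powr p * (2 * pi) = 2 * pi * T powr p"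
    using T by (simp add: powr_diff algebra_simps)
  finally show ?thesis
    using z by (simp add: T_def field_simps)
qed

text \<open>For p < 1 convexity is lost. Instead |f| is split as |f|^(1 - p) * |f|^p on an
  intermediate circle, and the first factor is bounded through a weighted supremum \<open>A\<close>
  of |f| itself. The result A \<le> A^(1 - p) * const bounds A^p. The closed disk of radius
  \<open>R0\<close> < 1 guarantees that \<open>A\<close> is finite; the bound obtained for A^p
  depends only on p and \<open>K\<close>.\<close>

lemma hardy_growth_less_1:
  assumes hol: "f holomorphic_on cball 0 R0" and R0: "0 < R0" "R0 < 1" and p: "0 < p" "p < 1"
    and K: "\<And>r. 0 \<le> r \<Longrightarrow> r < 1 \<Longrightarrow> integral {0..2 * pi} (\<lambda>t. cmod (f (of_real r * cis t)) powr p) \<le> K"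
    and z0: "cmod z0 < R0"
  shows "cmod (f z0) powr p \<le> (2 powr (1 / p) * (K / pi)) / (R0 - cmod z0)"
proof -
  have K0: "0 \<le> K"
    using order_trans[OF integral_nonneg_gen K[of 0]] by simp
  define g where "g z = (R0 - cmod z) powr (1 / p) * cmod (f z)" for z
  define A where "A = (SUP z\<in>ball 0 R0. g z)"
  have "continuous_on (cball 0 R0) g"
    unfolding g_def using p
    by (intro continuous_on_powr' continuous_intros holomorphic_on_imp_continuous_on[OF hol]) auto
  then have "compact (g ` cball 0 R0)"
    by (intro compact_continuous_image) auto
  then have "bdd_above (g ` cball 0 R0)"
    by (intro bounded_imp_bdd_above compact_imp_bounded)
  then have bdd: "bdd_above (g ` ball 0 R0)"
    by (rule bdd_above_mono) auto
  have gA: "g z \<le> A" if "cmod z < R0" for z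
    unfolding A_def using that by (intro cSUP_upper bdd) auto
  have A0: "0 \<le> A"
    using gA[of 0] R0 by (auto simp: g_def intro: order_trans[rotated])
  have step: "g z \<le> A powr (1 - p) * (2 powr (1 / p) * (K / pi))" if z: "cmod z < R0" for z
  proof -
    define d where "d = R0 - cmod z"
    \<comment> \<open>Halfway between |z| and \<open>R0\<close>, so that the kernel bound and the
      weight on the circle both see the distance d / 2.\<close>
    define R where "R = cmod z + d / 2"
    have d: "0 < d"
      using z by (simp add: d_def)
    have R: "cmod z < R" "R < R0" "0 < R" "R0 - R = d / 2" "R - cmod z = d / 2"
      using d norm_ge_zero[of z] unfolding R_def d_def by (auto simp: field_simps simp del: norm_ge_zero)
    have holR: "f holomorphic_on cball 0 R"
      using R by (intro holomorphic_on_subset[OF hol]) auto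
    define P where "P t = (R\<^sup>2 - (cmod z)\<^sup>2) / (cmod (of_real R * cis t - z))\<^sup>2" for t
    let ?F = "\<lambda>t. cmod (f (of_real R * cis t))"
    have ne: "cmod (of_real R * cis t - z) \<noteq> 0" for t
      using R by (auto simp: norm_mult)
    have contf: "continuous_on {0..2 * pi} (\<lambda>t. f (of_real R * cis t))"
      using R by (intro continuous_on_compose2[OF holomorphic_on_imp_continuous_on[OF holR]]
          continuous_intros) (auto simp: norm_mult)
    have cp: "continuous_on {0..2 * pi} (\<lambda>t. ?F t powr p)"
      using p by (intro continuous_on_powr' continuous_intros contf) auto
    have P0: "0 \<le> P t" for t
      using R unfolding P_def by (intro divide_nonneg_nonneg) (auto simp: power_mono)
    have contP: "continuous_on {0..2 * pi} P"
      unfolding P_def using ne by (intro continuous_intros) auto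
    define m where "m = (A * (d / 2) powr (- (1 / p))) powr (1 - p)"
    have F: "?F t \<le> m * ?F t powr p" for t
    proof -
      have "(d / 2) powr (1 / p) * ?F t \<le> A"
        using gA[of "of_real R * cis t"] R by (simp add: g_def norm_mult)
      then have "?F t \<le> A * (d / 2) powr (- (1 / p))"
        using d by (simp add: powr_minus field_simps)
      then have "?F t powr (1 - p) \<le> m"
        unfolding m_def using p by (intro powr_mono2) auto
      then have "?F t powr (1 - p) * ?F t powr p \<le> m * ?F t powr p"
        by (rule mult_right_mono) auto
      then show ?thesis
        by (simp flip: powr_add)
    qed
    have "2 * pi * cmod (f z) \<le> integral {0..2 * pi} (\<lambda>t. ?F t * P t)"
      unfolding P_def by (rule poisson_bound[OF holR R(1)])
    also have "\<dots> \<le> integral {0..2 * pi} (\<lambda>t. (m * (2 * R / (R - cmod z))) * ?F t powr p)"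
    proof (rule integral_le)
      fix t :: real
      have "?F t * P t \<le> (m * ?F t powr p) * (2 * R / (R - cmod z))"
        using P0[of t] F[of t] poisson_kernel_le[OF R(1), of t] R(1-3) unfolding P_def[symmetric]
        by (intro mult_mono) (auto simp: m_def)
      then show "?F t * P t \<le> (m * (2 * R / (R - cmod z))) * ?F t powr p"
        by (simp add: mult_ac)
    qed (use R(1-3) contP contf cp in \<open>auto intro!: integrable_continuous_interval continuous_intros\<close>)
    also have "\<dots> = (m * (2 * R / (R - cmod z))) * integral {0..2 * pi} (\<lambda>t. ?F t powr p)"
      by simp
    also have "\<dots> \<le> (m * (2 * 1 / (R - cmod z))) * K"
      using R R0 K[of R] by (intro mult_mono divide_right_mono)
        (auto simp: m_def intro!: integral_nonneg_gen)
    finally have "cmod (f z) \<le> m * (1 / (d / 2)) * (K / pi)"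
      using d by (simp add: R field_simps)
    also have "m = A powr (1 - p) * (d / 2) powr (- (1 / p) * (1 - p))"
      using A0 d unfolding m_def by (simp add: powr_mult powr_powr)
    \<comment> \<open>The exponent leaves one factor d / 2 over, which cancels the 1 / (d / 2) of
      the kernel bound.\<close>
    also have "(d / 2) powr (- (1 / p) * (1 - p)) = (d / 2) powr (- (1 / p)) * (d / 2)"
    proof -
      have "- (1 / p) * (1 - p) = - (1 / p) + 1"
        using p by (simp add: field_simps)
      then show ?thesis
        using d by (simp only: powr_add) simp
    qed
    finally have "cmod (f z) \<le> A powr (1 - p) * (d / 2) powr (- (1 / p)) * (K / pi)"
      using d by (simp add: mult_ac)
    then have "d powr (1 / p) * cmod (f z) \<le> d powr (1 / p) * (A powr (1 - p) * (d / 2) powr (- (1 / p)) * (K / pi))"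
      by (intro mult_left_mono) auto
    also have "d powr (1 / p) * (A powr (1 - p) * (d / 2) powr (- (1 / p)) * (K / pi)) =
        A powr (1 - p) * (2 powr (1 / p) * (K / pi))"
      using d by (simp add: powr_minus powr_divide)
    finally show ?thesis
      by (simp add: g_def d_def)
  qed
  have "A \<le> A powr (1 - p) * (2 powr (1 / p) * (K / pi))"
    unfolding A_def using R0 step[folded A_def]
    by (intro cSUP_least) (auto simp: A_def)
  have Ap: "A powr p \<le> 2 powr (1 / p) * (K / pi)"
  proof (cases "A = 0")
    case False
    with A0 have A1: "0 < A" by simp
    have "A = A powr (1 - p) * A powr p"
      using A1 by (simp flip: powr_add)
    with \<open>A \<le> _\<close> have "A powr (1 - p) * A powr p \<le> A powr (1 - p) * (2 powr (1 / p) * (K / pi))"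
      by simp
    then show ?thesis
      using A1 by (simp only: mult_le_cancel_left) auto
  qed (use K0 p in simp)
  have "(R0 - cmod z0) * cmod (f z0) powr p = g z0 powr p"
    using z0 p unfolding g_def by (simp add: powr_mult powr_powr)
  also have "\<dots> \<le> A powr p"
    using gA[OF z0] p z0 by (intro powr_mono2) (auto simp: g_def)
  also note Ap
  finally show ?thesis
    using z0 by (simp add: field_simps)
qed

lemma hardy_growth:
  assumes f: "f \<in> hardy p" and p: "0 < p"
  obtains C where "0 \<le> C" and "\<And>z. cmod z < 1 \<Longrightarrow> cmod (f z) \<le> C * (1 - cmod z) powr (- (1 / p))"
proof -
  obtain K where K0: "0 \<le> K" and K: "\<And>r. 0 \<le> r \<Longrightarrow> r < 1 \<Longrightarrow>
      integral {0..2 * pi} (\<lambda>t. cmod (f (of_real r * cis t)) powr p) \<le> K"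
    using hardy_means_bounded[OF f p] by blast
  have hol: "f holomorphic_on cball 0 r" if "r < 1" for r
    using f that by (auto simp: hardy_def intro: holomorphic_on_subset)
  define D where "D = 2 * (2 powr (1 / p) * (K / pi))"
  have D0: "0 \<le> D"
    using K0 by (simp add: D_def)
  have *: "cmod (f z) powr p \<le> D / (1 - cmod z)" if z: "cmod z < 1" for z
  proof -
    \<comment> \<open>Here R - |z| = (1 - |z|) / 2, which costs the factor 2 in \<open>D\<close>.
      The factor 2 powr (1 / p) stems from the case p < 1 and is at least 1 in the other
      case.\<close>
    define R where "R = (1 + cmod z) / 2"
    have R: "cmod z < R" "R < 1" "0 < R" "R - cmod z = (1 - cmod z) / 2"
      using z norm_ge_zero[of z] by (auto simp: R_def field_simps simp del: norm_ge_zero)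
    have "cmod (f z) powr p \<le> (2 powr (1 / p) * (K / pi)) / (R - cmod z)"
    proof (cases "p < 1")
      case True
      then show ?thesis
        using hardy_growth_less_1[OF hol, of R p K z] R K p by blast
    next
      case False
      then have "cmod (f z) powr p \<le> K / (pi * (R - cmod z))"
        using p K[of R] R(1-3) by (intro hardy_growth_ge_1[OF hol]) auto
      also have "\<dots> = 1 * (K / pi) / (R - cmod z)"
        by simp
      also have "\<dots> \<le> (2 powr (1 / p) * (K / pi)) / (R - cmod z)"
        using R p K0 by (intro divide_right_mono mult_right_mono) (auto intro: ge_one_powr_ge_zero)
      finally show ?thesis .
    qed
    then show ?thesis
      unfolding R(4) D_def by (simp add: mult_ac)
  qed
  show ?thesis
  proof (rule that[of "D powr (1 / p)"])
    fix z assume z: "cmod z < 1"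
    have "cmod (f z) = (cmod (f z) powr p) powr (1 / p)"
      using p by (simp add: powr_powr)
    also have "\<dots> \<le> (D / (1 - cmod z)) powr (1 / p)"
      using p *[OF z] by (intro powr_mono2) auto
    also have "\<dots> = D powr (1 / p) * (1 - cmod z) powr (- (1 / p))"
      using z D0 by (simp add: powr_divide powr_minus_divide)
    finally show "cmod (f z) \<le> D powr (1 / p) * (1 - cmod z) powr (- (1 / p))" .
  qed simp
qed

section \<open>Close pairs obstruct interpolation\<close>

text \<open>With d = 1 - |x|, disks of radius d / 4 about points of \<open>cball x (d / 4)\<close>
  stay where 1 - |v| \<ge> d / 2. Cauchy's estimate there bounds the derivative, and the mean value
  inequality does the rest.\<close>

lemma growth_imp_close_values:
  assumes hol: "f holomorphic_on ball 0 1" and s: "0 \<le> s"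
    and growth: "\<And>z. cmod z < 1 \<Longrightarrow> cmod (f z) \<le> C * (1 - cmod z) powr (- s)"
    and x: "cmod x < 1" and xy: "cmod (x - y) \<le> (1 - cmod x) / 4"
  shows "cmod (f x - f y) \<le> 4 * (C * 2 powr s) * (1 - cmod x) powr (- s) * (cmod (x - y) / (1 - cmod x))"
proof -
  define d where "d = 1 - cmod x"
  define B where "B = C * (d / 2) powr (- s)"
  have d: "0 < d" "d \<le> 1"
    using x by (simp_all add: d_def)
  have C0: "0 \<le> C"
    using growth[of 0] norm_ge_zero[of "f 0"] by (simp del: norm_ge_zero)
  have bound: "cmod v \<le> 1 - d / 2" if "cmod (v - x) \<le> d / 2" for v
    using norm_triangle_ineq2[of v x] that by (simp add: d_def field_simps)
  have fB: "cmod (f v) \<le> B" if v: "cmod (v - x) \<le> d / 2" for v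
  proof -
    have "cmod (f v) \<le> C * (1 - cmod v) powr (- s)"
      using bound[OF v] d by (intro growth) auto
    also have "\<dots> \<le> C * (d / 2) powr (- s)"
      using bound[OF v] d s C0 by (intro mult_left_mono powr_mono2') auto
    finally show ?thesis by (simp add: B_def)
  qed
  have der: "cmod (deriv f u) \<le> B / (d / 4)" if u: "u \<in> cball x (d / 4)" for u
  proof -
    have near: "cmod (v - x) \<le> d / 2" if "cmod (u - v) \<le> d / 4" for v
    proof -
      have "cmod (v - x) \<le> cmod (v - u) + cmod (u - x)"
        using norm_triangle_ineq[of "v - u" "u - x"] by simp
      then show ?thesis
        using that u by (simp add: dist_norm norm_minus_commute)
    qed
    have sub: "cball u (d / 4) \<subseteq> ball 0 1"
    proof
      fix v assume "v \<in> cball u (d / 4)"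
      then show "v \<in> ball 0 1"
        using bound[OF near[of v]] d by (simp add: dist_norm)
    qed
    have "cmod ((deriv ^^ 1) f u) \<le> fact 1 * B / (d / 4) ^ 1"
    proof (rule Cauchy_inequality)
      show "f holomorphic_on ball u (d / 4)"
        using sub ball_subset_cball by (blast intro: holomorphic_on_subset[OF hol])
      show "continuous_on (cball u (d / 4)) f"
        using sub by (blast intro: holomorphic_on_imp_continuous_on holomorphic_on_subset[OF hol])
      show "cmod (f v) \<le> B" if "cmod (u - v) = d / 4" for v
        using that by (intro fB near) simp
    qed (use d in auto)
    then show ?thesis by simp
  qed
  have "cmod (f x - f y) \<le> B / (d / 4) * cmod (x - y)"
  proof (rule field_differentiable_bound[of "cball x (d / 4)"])
    fix u assume u: "u \<in> cball x (d / 4)"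
    have "cmod (u - x) \<le> d / 2"
      using u d by (simp add: dist_norm norm_minus_commute)
    from bound[OF this] have "u \<in> ball 0 1"
      using d by simp
    then have "(f has_field_derivative deriv f u) (at u)"
      using hol holomorphic_derivI open_ball by blast
    then show "(f has_field_derivative deriv f u) (at u within cball x (d / 4))"
      by (rule has_field_derivative_at_within)
  qed (use der d xy in \<open>auto simp: dist_norm d_def norm_minus_commute\<close>)
  also have "\<dots> = 4 * (C * 2 powr s) * d powr (- s) * (cmod (x - y) / d)"
    using d by (simp add: B_def powr_divide powr_minus_divide)
  finally show ?thesis
    by (simp add: d_def)
qed

text \<open>A growth exponent s = 1 / p, with s = 0 for bounded functions, is all that the
  obstruction has to know about the space; this merges the two kinds of exponents.\<close>

lemma interpolating_growth:
  assumes "0 < p" "interpolating p S"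
  defines "s \<equiv> (if p = \<infinity> then 0 else 1 / enn2real p)"
  assumes w: "if p = \<infinity> then bounded (w ` S)
    else (\<lambda>z. (1 - (cmod z)\<^sup>2) * cmod (w z) powr enn2real p) summable_on S"
  obtains f C where "f holomorphic_on ball 0 1"
    and "\<And>z. cmod z < 1 \<Longrightarrow> cmod (f z) \<le> C * (1 - cmod z) powr (- s)"
    and "\<And>z. z \<in> S \<Longrightarrow> f z = w z"
proof (cases "p = \<infinity>")
  case True
  then obtain f where f: "f \<in> hardy_infinity" "\<And>z. z \<in> S \<Longrightarrow> f z = w z"
    using assms(2) w unfolding interpolating_def by auto
  then have "bounded (f ` unit_disk)"
    by (simp add: hardy_infinity_def)
  then obtain C where "\<forall>z\<in>unit_disk. cmod (f z) \<le> C"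
    by (auto simp: bounded_iff)
  then have C: "\<And>z. cmod z < 1 \<Longrightarrow> cmod (f z) \<le> C"
    by auto
  show ?thesis
    by (rule that[of f C]) (use f C True in \<open>auto simp: hardy_infinity_def s_def\<close>)
next
  case False
  then obtain f where f: "f \<in> hardy (enn2real p)" "\<And>z. z \<in> S \<Longrightarrow> f z = w z"
    using assms(2) w unfolding interpolating_def by auto
  have "0 < enn2real p"
    using assms(1) False by (simp add: enn2real_positive_iff less_top)
  then obtain C where "\<And>z. cmod z < 1 \<Longrightarrow> cmod (f z) \<le> C * (1 - cmod z) powr (- (1 / enn2real p))"
    using hardy_growth[OF f(1)] by blast
  then show ?thesis
    using False f by (intro that[of f C]) (auto simp: hardy_def s_def)
qed

text \<open>Along pairs that march outwards, the data have critical size up to the factor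
  \<open>c n\<close> at one point and vanish at its partner. The pairs are so close that an
  interpolating function would force 2 ^ (n + 2) \<le> D for every n.\<close>

lemma close_pairs_not_interpolating:
  assumes p: "0 < p" and S: "S \<subseteq> ball 0 1"
    and close: "\<And>e. 0 < e \<Longrightarrow> \<exists>x\<in>S. \<exists>y\<in>S. x \<noteq> y \<and> 1 - e \<le> cmod x \<and> 1 - e \<le> cmod y \<and>
        cmod (x - y) \<le> e * (1 - cmod x)"
  shows "\<not> interpolating p S"
proof
  assume int: "interpolating p S"
  define s where "s = (if p = \<infinity> then 0 else 1 / enn2real p)"
  \<comment> \<open>For s = 1 / p this gives \<open>c n powr p = 1 / 2 ^ n\<close>, so a geometric
    series dominates the weighted data; for s = 0 it is constantly 1.\<close>
  define c :: "nat \<Rightarrow> real" where "c n = (1 / 2 ^ n) powr s" for n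
  have s: "0 \<le> s"
    by (simp add: s_def)
  have c: "0 < c n" "c n \<le> 1" for n
    using s powr_mono2[of s "1 / 2 ^ n" 1] by (auto simp: c_def)
  \<comment> \<open>The factor \<open>c n\<close> cancels the one in the data, and 2 ^ (n + 2) is
    left for the contradiction. It is at least 4, as the comparison of values at close points
    demands.\<close>
  define P where "P n q \<longleftrightarrow> fst q \<in> S \<and> snd q \<in> S \<and> fst q \<noteq> snd q \<and>
      cmod (fst q - snd q) \<le> c n / 2 ^ (n + 2) * (1 - cmod (fst q))" for n and q :: "complex \<times> complex"
  \<comment> \<open>Both moduli of a later pair exceed both of an earlier one, so no point occurs in
    two pairs and the data are well defined.\<close>
  define Q where "Q q q' \<longleftrightarrow> max (cmod (fst q)) (cmod (snd q)) < min (cmod (fst q')) (cmod (snd q'))"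
    for q q' :: "complex \<times> complex"
  have ex: "\<exists>q'. P n q' \<and> b < min (cmod (fst q')) (cmod (snd q'))" if b: "b < 1" for n b
  proof -
    define e where "e = min (c n / 2 ^ (n + 2)) ((1 - b) / 2)"
    have "0 < e"
      using b c by (simp add: e_def)
    then obtain x y where xy: "x \<in> S" "y \<in> S" "x \<noteq> y" "1 - e \<le> cmod x" "1 - e \<le> cmod y"
      "cmod (x - y) \<le> e * (1 - cmod x)"
      using close by blast
    have "e * (1 - cmod x) \<le> c n / 2 ^ (n + 2) * (1 - cmod x)"
      using xy S by (intro mult_right_mono) (auto simp: e_def less_imp_le subset_iff)
    moreover have "b < 1 - e"
    proof -
      have "e \<le> (1 - b) / 2"
        unfolding e_def by (rule min.cobounded2)
      then show ?thesis
        using b by (simp add: field_simps)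
    qed
    ultimately show ?thesis
      using xy by (intro exI[of _ "(x, y)"]) (auto simp: P_def)
  qed
  have "\<exists>q. \<forall>n. P n (q n) \<and> Q (q n) (q (Suc n))"
  proof (rule dependent_nat_choice)
    show "\<exists>q. P 0 q"
      using ex[of 0 0] by auto
    show "\<exists>q'. P (Suc n) q' \<and> Q q q'" if "P n q" for q n
      using ex[of "max (cmod (fst q)) (cmod (snd q))" "Suc n"] that S
      by (auto simp: P_def Q_def subset_iff)
  qed
  then obtain q where q: "\<And>n. P n (q n)" "\<And>n. Q (q n) (q (Suc n))"
    by blast
  define X where "X n = fst (q n)" for n
  define Y where "Y n = snd (q n)" for n
  have XY: "X n \<in> S" "Y n \<in> S" "X n \<noteq> Y n" "cmod (X n - Y n) \<le> c n / 2 ^ (n + 2) * (1 - cmod (X n))" for n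
    using q(1)[of n] by (auto simp: P_def X_def Y_def)
  define lo where "lo n = min (cmod (X n)) (cmod (Y n))" for n
  have lo: "max (cmod (X m)) (cmod (Y m)) < lo n" if "m < n" for m n
    using that
  proof (induction n rule: less_Suc_induct)
    case (1 i)
    then show ?case
      using q(2)[of i] by (simp add: Q_def X_def Y_def lo_def)
  next
    case (2 i j k)
    then show ?case
      by (auto simp: lo_def)
  qed
  have XYne: "X m \<noteq> Y n" for m n
    using lo[of m n] lo[of n m] XY(3)[of n] by (cases m n rule: linorder_cases) (auto simp: lo_def)
  have "inj X"
  proof (rule linorder_injI)
    show "X m \<noteq> X n" if "m < n" for m n
      using lo[OF that] by (auto simp: lo_def)
  qed
  define w :: "complex \<Rightarrow> complex"
    where "w z = (if z \<in> range X then of_real ((1 - cmod z) powr (- s) * c (inv X z)) else 0)" for z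
  have wX: "w (X n) = of_real ((1 - cmod (X n)) powr (- s) * c n)" for n
    using \<open>inj X\<close> by (simp add: w_def)
  have wY: "w (Y n) = 0" for n
  proof -
    have "Y n \<notin> range X"
      using XYne by (metis imageE)
    then show ?thesis
      by (simp add: w_def)
  qed
  have X1: "cmod (X n) < 1" for n
    using XY(1)[of n] S by auto
  have data: "if p = \<infinity> then bounded (w ` S)
    else (\<lambda>z. (1 - (cmod z)\<^sup>2) * cmod (w z) powr enn2real p) summable_on S"
  proof (cases "p = \<infinity>")
    case True
    then have "cmod (w z) \<le> 1" for z
      by (simp add: w_def s_def c_def)
    then show ?thesis
      using True by (auto simp: bounded_iff)
  next
    case False
    have r: "0 < enn2real p"
      using p False by (simp add: enn2real_positive_iff less_top)
    let ?g = "\<lambda>z. (1 - (cmod z)\<^sup>2) * cmod (w z) powr enn2real p"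
    have gX: "?g (X n) \<le> 2 * (1 / 2) ^ n" "0 \<le> ?g (X n)" for n
    proof -
      have "cmod (w (X n)) powr enn2real p = (1 - cmod (X n)) powr (- 1) * (1 / 2) ^ n"
        using X1[of n] r False c(1)[of n]
        by (simp add: wX norm_mult abs_mult powr_mult powr_powr c_def s_def power_one_over)
      then have "?g (X n) = (1 + cmod (X n)) * (1 / 2) ^ n"
      proof -
        have "1 - (cmod (X n))\<^sup>2 = (1 + cmod (X n)) * (1 - cmod (X n))"
          by (simp add: power2_eq_square algebra_simps)
        then show ?thesis
          using X1[of n] \<open>cmod (w (X n)) powr enn2real p = _\<close> by (simp add: powr_minus)
      qed
      then show "?g (X n) \<le> 2 * (1 / 2) ^ n" "0 \<le> ?g (X n)"
        using X1[of n] by auto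
    qed
    have "summable (\<lambda>n. ?g (X n))"
      by (rule summable_comparison_test'[of "\<lambda>n. 2 * (1 / 2) ^ n" 0])
        (use gX in \<open>auto intro!: summable_mult summable_geometric\<close>)
    then have "(\<lambda>n. ?g (X n)) summable_on UNIV"
      using gX by (simp add: summable_nonneg_imp_summable_on)
    then have "?g summable_on range X"
      using summable_on_reindex[OF \<open>inj X\<close>, of ?g] by (simp add: o_def)
    also have "?g summable_on range X \<longleftrightarrow> ?g summable_on S"
      using XY(1) by (intro summable_on_cong_neutral) (auto simp: w_def)
    finally show ?thesis
      using False by simp
  qed
  obtain f C where hol: "f holomorphic_on ball 0 1"
    and growth: "\<And>z. cmod z < 1 \<Longrightarrow> cmod (f z) \<le> C * (1 - cmod z) powr (- s)"
    and fw: "\<And>z. z \<in> S \<Longrightarrow> f z = w z"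
    using interpolating_growth[OF p int data] unfolding s_def by metis
  define D where "D = 4 * (C * 2 powr s)"
  have "2 ^ (n + 2) \<le> D" for n
  proof -
    have e: "c n / 2 ^ (n + 2) \<le> 1 / 4"
    proof -
      have "c n / 2 ^ (n + 2) \<le> 1 / 2 ^ (n + 2)"
        using c by (intro divide_right_mono) auto
      also have "\<dots> \<le> 1 / 4"
        by (simp add: divide_simps)
      finally show ?thesis .
    qed
    have d: "cmod (X n - Y n) \<le> (1 - cmod (X n)) / 4"
      using order_trans[OF XY(4)[of n] mult_right_mono[OF e, of "1 - cmod (X n)"]] X1[of n] by simp
    have C0: "0 \<le> D"
      using growth[of 0] norm_ge_zero[of "f 0"] by (simp add: D_def del: norm_ge_zero)
    have "(1 - cmod (X n)) powr (- s) * c n = cmod (f (X n) - f (Y n))"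
      using c(1)[of n] by (simp add: fw XY wX wY norm_mult abs_mult)
    also have "\<dots> \<le> D * (1 - cmod (X n)) powr (- s) * (cmod (X n - Y n) / (1 - cmod (X n)))"
      unfolding D_def by (rule growth_imp_close_values[OF hol s growth X1 d])
    also have "\<dots> \<le> D * (1 - cmod (X n)) powr (- s) * (c n / 2 ^ (n + 2))"
      using XY(4)[of n] X1[of n] C0 by (intro mult_left_mono) (auto simp: divide_le_eq)
    finally have "((1 - cmod (X n)) powr (- s) * c n) * 1 \<le> ((1 - cmod (X n)) powr (- s) * c n) * (D / 2 ^ (n + 2))"
      by (simp add: mult_ac)
    moreover have "0 < (1 - cmod (X n)) powr (- s) * c n"
      using X1[of n] c(1)[of n] by auto
    ultimately have "1 \<le> D / 2 ^ (n + 2)"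
      by (simp only: mult_le_cancel_left_pos)
    then show ?thesis
      by (simp add: le_divide_eq)
  qed
  moreover obtain n where "D < 2 ^ n"
    using real_arch_pow[of 2 D] by auto
  moreover have "(2::real) ^ n \<le> 2 ^ (n + 2)"
    by (rule power_increasing) auto
  ultimately show False
    by (metis leD less_le_trans)
qed

section \<open>Interpolation by the formula of P. Jones\<close>

text \<open>The squared modulus of the inner product, in the Hardy space of exponent 2, of the
  normalised Szego kernels at \<open>z\<close> and \<open>w\<close>.\<close>

definition szego_overlap :: "complex \<Rightarrow> complex \<Rightarrow> real"
  where "szego_overlap z w = (1 - (cmod z)\<^sup>2) * (1 - (cmod w)\<^sup>2) / (cmod (1 - cnj z * w))\<^sup>2"

lemma norm_cnj_mult_less_1:
  assumes "cmod z < 1" "cmod w < 1"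
  shows "cmod (cnj z * w) < 1"
  using assms mult_strict_mono[of "cmod z" 1 "cmod w" 1] by (simp add: norm_mult)

lemma one_minus_cnj_mult_nonzero:
  assumes "cmod z < 1" "cmod w < 1"
  shows "1 - cnj z * w \<noteq> 0"
  using norm_cnj_mult_less_1[OF assms] by (metis eq_iff_diff_eq_0 norm_one less_irrefl)

lemma norm_one_minus_cnj_mult_ge:
  assumes "cmod z < 1" "cmod w < 1"
  shows "1 - cmod z \<le> cmod (1 - cnj z * w)" "1 - cmod w \<le> cmod (1 - cnj z * w)"
proof -
  have "1 - cmod z * cmod w \<le> cmod (1 - cnj z * w)"
    using norm_triangle_ineq2[of 1 "cnj z * w"] by (simp add: norm_mult)
  moreover have "cmod z * cmod w \<le> cmod z * 1" "cmod z * cmod w \<le> 1 * cmod w"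
    using assms by (intro mult_left_mono mult_right_mono; simp)+
  ultimately show "1 - cmod z \<le> cmod (1 - cnj z * w)" "1 - cmod w \<le> cmod (1 - cnj z * w)"
    by linarith+
qed

lemma one_minus_norm_square_pos:
  "cmod z < 1 \<Longrightarrow> 0 < 1 - (cmod z)\<^sup>2"
  by (simp add: abs_square_less_1)

lemma szego_overlap_nonneg: "cmod z < 1 \<Longrightarrow> cmod w < 1 \<Longrightarrow> 0 \<le> szego_overlap z w"
  unfolding szego_overlap_def using one_minus_norm_square_pos less_imp_le
  by (intro divide_nonneg_nonneg mult_nonneg_nonneg) auto

lemma szego_overlap_self:
  assumes "cmod z < 1"
  shows "szego_overlap z z = 1"
proof -
  have "1 - cnj z * z = of_real (1 - (cmod z)\<^sup>2)"
    using complex_norm_square[of z] by (simp add: mult.commute del: complex_mult_cnj)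
  then show ?thesis
    using one_minus_norm_square_pos[OF assms]
    unfolding szego_overlap_def by (simp only: norm_of_real) (simp add: power2_eq_square)
qed

lemma norm_moebius_square:
  assumes "cmod z < 1" "cmod w < 1"
  shows "(cmod ((w - z) / (1 - cnj z * w)))\<^sup>2 = 1 - szego_overlap z w"
proof -
  have "(cmod (1 - cnj z * w))\<^sup>2 - (cmod (w - z))\<^sup>2 = (1 - (cmod z)\<^sup>2) * (1 - (cmod w)\<^sup>2)"
    unfolding cmod_power2 by simp algebra
  moreover have "(cmod (1 - cnj z * w))\<^sup>2 > 0"
    using one_minus_cnj_mult_nonzero[OF assms] by simp
  ultimately show ?thesis
    unfolding szego_overlap_def norm_divide power_divide by (simp add: field_simps)
qed

lemma norm_moebius_le_1:
  assumes "cmod z < 1" "cmod w < 1"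
  shows "cmod ((w - z) / (1 - cnj z * w)) \<le> 1"
proof -
  have "(cmod ((w - z) / (1 - cnj z * w)))\<^sup>2 \<le> 1\<^sup>2"
    unfolding norm_moebius_square[OF assms] using szego_overlap_nonneg[OF assms] by simp
  then show ?thesis
    by (rule power2_le_imp_le) simp
qed

lemma szego_overlap_less_1:
  assumes "cmod z < 1" "cmod w < 1" "z \<noteq> w"
  shows "szego_overlap z w < 1"
proof -
  have "0 < (cmod ((w - z) / (1 - cnj z * w)))\<^sup>2"
    using one_minus_cnj_mult_nonzero[OF assms(1,2)] assms(3) by simp
  then show ?thesis
    unfolding norm_moebius_square[OF assms(1,2)] by simp
qed

text \<open>From (1 + t / d) * (1 - t) \<ge> 1. It turns a bound for a sum of overlaps into a lower
  bound for a Blaschke product.\<close>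

lemma exp_le_one_minus:
  fixes t d :: real
  assumes "0 \<le> t" "t \<le> 1 - d" "0 < d"
  shows "exp (- (t / d)) \<le> 1 - t"
proof -
  have "(1 + t / d) * (1 - t) = 1 + t / d * (1 - d - t)"
    using assms by (simp add: field_simps)
  also have "\<dots> \<ge> 1"
    using assms by simp
  finally have "1 \<le> (1 + t / d) * (1 - t)" .
  also have "\<dots> \<le> exp (t / d) * (1 - t)"
    using assms by (intro mult_right_mono exp_ge_add_one_self) auto
  finally show ?thesis
    by (simp add: exp_minus divide_simps mult.commute)
qed

text \<open>The sum is a lower Riemann sum of the integral of \<open>exp (- t)\<close> over \<open>[0, sum a F]\<close>.\<close>

lemma sum_exp_tail_le:
  fixes a r :: "'a \<Rightarrow> real"
  assumes "finite F" "\<And>x. x \<in> F \<Longrightarrow> 0 \<le> a x"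
  shows "(\<Sum>x\<in>F. a x * exp (- (\<Sum>y | y \<in> F \<and> r x \<le> r y. a y))) \<le> 1 - exp (- sum a F)"
  using assms
proof (induction F rule: finite_ranking_induct[where f = "\<lambda>x. - r x"])
  case empty
  then show ?case by simp
next
  case (insert x F)
  show ?case
  proof (cases "x \<in> F")
    case True
    then show ?thesis
      using insert by (simp add: insert_absorb)
  next
    case False
    define G where "G u = {y \<in> insert x F. r u \<le> r y}" for u
    \<comment> \<open>The inserted \<open>x\<close> has the least value of \<open>r\<close>, so its
      tail is everything. It enters the tail of another \<open>u\<close> only if
      \<open>r u = r x\<close>, and then it decreases that term.\<close>
    have Gx: "G x = insert x F"
      using insert by (auto simp: G_def)
    have le: "a u * exp (- sum a (G u)) \<le> a u * exp (- sum a {y \<in> F. r u \<le> r y})" if "u \<in> F" for u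
    proof -
      have "sum a {y \<in> F. r u \<le> r y} \<le> sum a (G u)"
        using insert by (intro sum_mono2) (auto simp: G_def)
      then show ?thesis
        using insert that by (intro mult_left_mono) auto
    qed
    have "(\<Sum>u\<in>insert x F. a u * exp (- sum a (G u))) =
        a x * exp (- sum a (insert x F)) + (\<Sum>u\<in>F. a u * exp (- sum a (G u)))"
      using False insert by (simp add: Gx)
    also have "\<dots> \<le> a x * exp (- sum a (insert x F)) + (1 - exp (- sum a F))"
      using insert by (intro add_left_mono order_trans[OF sum_mono[OF le] insert.IH]) auto
    also have "exp (- sum a F) = exp (- sum a (insert x F)) * exp (a x)"
      using False insert by (simp flip: exp_add)
    also have "a x * exp (- sum a (insert x F)) + (1 - exp (- sum a (insert x F)) * exp (a x)) =
        1 - exp (- sum a (insert x F)) * (exp (a x) - a x)"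
      by (simp only: algebra_simps)
    also have "\<dots> \<le> 1 - exp (- sum a (insert x F)) * 1"
    proof (intro diff_left_mono mult_left_mono)
      show "1 \<le> exp (a x) - a x"
        using exp_ge_add_one_self[of "a x"] by linarith
    qed auto
    finally show ?thesis
      by (simp add: G_def)
  qed
qed

text \<open>The Szego kernel at \<open>x\<close> scaled to the value 1 at \<open>x\<close>. The
  circle means of its squared modulus are at most 1 - |x|^2, the weight of \<open>x\<close> in the
  condition on the data.\<close>

abbreviation bump :: "complex \<Rightarrow> complex \<Rightarrow> complex"
  where "bump x z \<equiv> of_real (1 - (cmod x)\<^sup>2) / (1 - cnj x * z)"

lemma norm_bump_le_2:
  assumes "cmod x < 1" "cmod z < 1"
  shows "cmod (bump x z) \<le> 2"
proof -
  have "1 - (cmod x)\<^sup>2 = (1 - cmod x) * (1 + cmod x)"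
    by (simp add: power2_eq_square algebra_simps)
  also have "\<dots> \<le> cmod (1 - cnj x * z) * 2"
    using assms norm_one_minus_cnj_mult_ge[OF assms] by (intro mult_mono) auto
  finally show ?thesis
    using one_minus_cnj_mult_nonzero[OF assms] one_minus_norm_square_pos[OF assms(1)]
    by (simp only: norm_divide norm_of_real) (simp add: divide_le_eq mult.commute)
qed

lemma norm_bump_square:
  "(cmod (bump x z))\<^sup>2 = (1 - (cmod x)\<^sup>2)\<^sup>2 * (1 / (cmod (1 - cnj x * z))\<^sup>2)"
  by (simp only: norm_divide norm_of_real power_divide power2_abs) simp

text \<open>The factor 1 - |x|^2 is kept so that, on each circle |z| = r, sums over \<open>x\<close>
  are controlled by the weighted data.\<close>

lemma norm_bump_square_le:
  assumes "cmod x < 1" "cmod z < 1"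
  shows "(cmod (bump x z))\<^sup>2 \<le> (1 - (cmod x)\<^sup>2) * (1 - cmod z) powr (- 2)"
proof -
  have "(1 - (cmod x)\<^sup>2)\<^sup>2 \<le> (1 - (cmod x)\<^sup>2) * 1"
    using one_minus_norm_square_pos[OF assms(1)]
    unfolding power2_eq_square[of "1 - (cmod x)\<^sup>2"] by (intro mult_left_mono) auto
  moreover have "1 / (cmod (1 - cnj x * z))\<^sup>2 \<le> 1 / (1 - cmod z)\<^sup>2"
    using norm_one_minus_cnj_mult_ge[OF assms] one_minus_cnj_mult_nonzero[OF assms] assms
    by (intro divide_left_mono power_mono mult_pos_pos) auto
  moreover have "1 / (1 - cmod z)\<^sup>2 = (1 - cmod z) powr (- 2)"
    using assms by (simp add: powr_minus_divide)
  ultimately show ?thesis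
    unfolding norm_bump_square by (metis mult.right_neutral mult_mono zero_le_power2 zero_le_divide_1_iff
        one_minus_norm_square_pos[OF assms(1)] less_imp_le)
qed

lemma Re_cayley:
  assumes "u \<noteq> 1"
  shows "Re ((1 + u) / (1 - u)) = (1 - (cmod u)\<^sup>2) / (cmod (1 - u))\<^sup>2"
proof -
  have "Re ((1 + u) * cnj (1 - u)) = 1 - (cmod u)\<^sup>2"
    unfolding cmod_power2 by (simp add: algebra_simps power2_eq_square)
  then show ?thesis
    by (simp add: complex_div_cnj[of "1 + u"])
qed

text \<open>The quotient of Blaschke products and the normalised bump make each term equal to its
  datum at its own node and 0 at the others. The exponential keeps the sum bounded independently of
  the number of nodes: |exp (- g x z)| supplies the factor required by
  \<open>sum_exp_tail_le\<close>, while Re (g x x) is bounded by a row sum of overlaps. The power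
  \<open>n\<close> is left free, to be adapted to the exponent of the space.\<close>

lemma finite_jones_interpolation:
  fixes w :: "complex \<Rightarrow> complex"
  assumes fin: "finite F" and F: "F \<subseteq> ball 0 1" and C0: "0 \<le> C"
    and C: "\<And>x. x \<in> F \<Longrightarrow> (\<Sum>y\<in>F - {x}. szego_overlap y x) \<le> C"
    and d: "0 < d" "\<And>x y. x \<in> F \<Longrightarrow> y \<in> F \<Longrightarrow> x \<noteq> y \<Longrightarrow> szego_overlap y x \<le> 1 - d"
  obtains f where "f holomorphic_on ball 0 1" "\<And>x. x \<in> F \<Longrightarrow> f x = w x"
    and "\<And>z. cmod z < 1 \<Longrightarrow> cmod (f z) \<le> exp (C / d + 2 * (1 + C)) *
      (\<Sum>x\<in>F. cmod (w x) * (cmod (bump x z) ^ n * exp (- (\<Sum>y | y \<in> F \<and> cmod x \<le> cmod y. (cmod (bump y z))\<^sup>2))))"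
proof -
  have F1: "cmod x < 1" if "x \<in> F" for x
    using F that by auto
  define B where "B x z = (\<Prod>y\<in>F - {x}. (z - y) / (1 - cnj y * z))" for x z
  \<comment> \<open>Only nodes at least as far out as \<open>x\<close> enter. For these 1 - |y|^2
    |x|^2 \<le> 2 (1 - |x|^2), the inequality that bounds \<open>Re (g x x)\<close> by
    overlaps.\<close>
  define G where "G x = {y \<in> F. cmod x \<le> cmod y}" for x
  \<comment> \<open>The real part of each summand is at least |bump y z|^2 throughout the disk, by
    \<open>Re_cayley\<close>.\<close>
  define g where "g x z = (\<Sum>y\<in>G x. of_real (1 - (cmod y)\<^sup>2) * ((1 + cnj y * z) / (1 - cnj y * z)))" for x z
  define f where "f z = (\<Sum>x\<in>F. w x * (B x z / B x x) * bump x z ^ n * exp (g x x - g x z))" for z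
  have nz: "1 - cnj y * z \<noteq> 0" if "y \<in> F" "cmod z < 1" for y z
    using one_minus_cnj_mult_nonzero[OF F1[OF that(1)] that(2)] .
  have finG: "finite (G x)" for x
    using fin by (simp add: G_def)
  have Bxx_sq: "exp (- (C / d)) \<le> (cmod (B x x))\<^sup>2" if x: "x \<in> F" for x
  proof -
    have "exp (- (C / d)) \<le> exp (- ((\<Sum>y\<in>F - {x}. szego_overlap y x) / d))"
      using C[OF x] d by (simp add: divide_right_mono)
    also have "\<dots> = (\<Prod>y\<in>F - {x}. exp (- (szego_overlap y x / d)))"
      using fin by (simp add: exp_sum sum_divide_distrib flip: sum_negf)
    also have "\<dots> \<le> (\<Prod>y\<in>F - {x}. 1 - szego_overlap y x)"
      using d x F1 by (intro prod_mono conjI exp_le_one_minus szego_overlap_nonneg) auto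
    also have "\<dots> = (\<Prod>y\<in>F - {x}. (cmod ((x - y) / (1 - cnj y * x)))\<^sup>2)"
      using x F1 by (intro prod.cong refl norm_moebius_square[symmetric]) auto
    also have "\<dots> = (cmod (B x x))\<^sup>2"
      by (simp add: B_def prod_norm flip: prod_power_distrib)
    finally show ?thesis .
  qed
  have B1: "cmod (B x z) \<le> 1" if "cmod z < 1" for x z
    unfolding B_def prod_norm[symmetric] using F1 that
    by (intro prod_le_1) (auto simp del: norm_divide intro!: norm_moebius_le_1)
  \<comment> \<open>Since |B x x| \<le> 1, a lower bound for its square is also one for |B x x|; no
    root is taken.\<close>
  have Bxx: "exp (- (C / d)) \<le> cmod (B x x)" if x: "x \<in> F" for x
  proof -
    have "cmod (B x x) * cmod (B x x) \<le> cmod (B x x) * 1"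
      using B1[OF F1[OF x], of x] by (intro mult_left_mono) auto
    then show ?thesis
      using Bxx_sq[OF x] by (simp add: power2_eq_square)
  qed
  have Re_term: "Re (of_real (1 - (cmod y)\<^sup>2) * ((1 + cnj y * z) / (1 - cnj y * z))) =
      (1 - (cmod y)\<^sup>2) * ((1 - (cmod y)\<^sup>2 * (cmod z)\<^sup>2) / (cmod (1 - cnj y * z))\<^sup>2)"
    if "y \<in> F" "cmod z < 1" for y z
    using Re_cayley[of "cnj y * z"] nz[OF that]
    by (simp only: Re_complex_of_real times_complex.sel Im_complex_of_real norm_mult complex_mod_cnj
        power_mult_distrib) simp
  have g_ge: "(\<Sum>y\<in>G x. (cmod (bump y z))\<^sup>2) \<le> Re (g x z)" if z: "cmod z < 1" for x z
    unfolding g_def Re_sum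
  proof (rule sum_mono)
    fix y assume "y \<in> G x"
    then have y: "y \<in> F" by (simp add: G_def)
    have "(cmod y)\<^sup>2 * (cmod z)\<^sup>2 \<le> (cmod y)\<^sup>2 * 1"
      using z by (intro mult_left_mono) (auto simp: abs_square_le_1)
    then have "(1 - (cmod y)\<^sup>2) * ((1 - (cmod y)\<^sup>2) / (cmod (1 - cnj y * z))\<^sup>2) \<le>
        (1 - (cmod y)\<^sup>2) * ((1 - (cmod y)\<^sup>2 * (cmod z)\<^sup>2) / (cmod (1 - cnj y * z))\<^sup>2)"
      using one_minus_norm_square_pos[OF F1[OF y]] by (intro mult_left_mono divide_right_mono) auto
    then show "(cmod (bump y z))\<^sup>2 \<le> Re (of_real (1 - (cmod y)\<^sup>2) * ((1 + cnj y * z) / (1 - cnj y * z)))"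
      unfolding Re_term[OF y z] norm_bump_square by (simp add: power2_eq_square)
  qed
  have g_le: "Re (g x x) \<le> 2 * (1 + C)" if x: "x \<in> F" for x
  proof -
    have "Re (g x x) \<le> (\<Sum>y\<in>G x. 2 * szego_overlap y x)"
      unfolding g_def Re_sum
    proof (rule sum_mono)
      fix y assume "y \<in> G x"
      then have y: "y \<in> F" "cmod x \<le> cmod y" by (auto simp: G_def)
      have "(cmod x)\<^sup>2 * (cmod x)\<^sup>2 \<le> (cmod y)\<^sup>2 * (cmod x)\<^sup>2"
        using y by (intro mult_right_mono power_mono) auto
      moreover have "(cmod x)\<^sup>2 * (1 - (cmod x)\<^sup>2) \<le> 1 * (1 - (cmod x)\<^sup>2)"
        using one_minus_norm_square_pos[OF F1[OF x]] by (intro mult_right_mono) auto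
      ultimately have "1 - (cmod y)\<^sup>2 * (cmod x)\<^sup>2 \<le> 2 * (1 - (cmod x)\<^sup>2)"
        by (simp add: algebra_simps)
      then have "(1 - (cmod y)\<^sup>2) * ((1 - (cmod y)\<^sup>2 * (cmod x)\<^sup>2) / (cmod (1 - cnj y * x))\<^sup>2) \<le>
          (1 - (cmod y)\<^sup>2) * (2 * (1 - (cmod x)\<^sup>2) / (cmod (1 - cnj y * x))\<^sup>2)"
        using one_minus_norm_square_pos[OF F1[OF y(1)]] by (intro mult_left_mono divide_right_mono) auto
      then show "Re (of_real (1 - (cmod y)\<^sup>2) * ((1 + cnj y * x) / (1 - cnj y * x))) \<le> 2 * szego_overlap y x"
        unfolding Re_term[OF y(1) F1[OF x]] szego_overlap_def
        by (simp only: times_divide_eq_right mult.left_commute[of 2])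
    qed
    also have "\<dots> \<le> (\<Sum>y\<in>F. 2 * szego_overlap y x)"
      using fin F1 x by (intro sum_mono2) (auto simp: G_def szego_overlap_nonneg)
    also have "\<dots> = 2 * (szego_overlap x x + (\<Sum>y\<in>F - {x}. szego_overlap y x))"
      using fin x by (simp add: sum.remove[of F x] sum_distrib_left)
    also have "\<dots> \<le> 2 * (1 + C)"
      using C[OF x] szego_overlap_self[OF F1[OF x]] by simp
    finally show ?thesis .
  qed
  show ?thesis
  proof (rule that[of f])
    show "f holomorphic_on ball 0 1"
      unfolding f_def g_def B_def using nz Bxx
      by (intro holomorphic_intros) (auto simp: G_def B_def[symmetric])
    show "f x = w x" if x: "x \<in> F" for x
    proof -
      have "B u x = 0" if "u \<in> F" "u \<noteq> x" for u
        unfolding B_def using that x fin by (intro prod_zero) auto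
      then have "f x = w x * (B x x / B x x) * bump x x ^ n * exp (g x x - g x x)"
        unfolding f_def using fin x by (subst sum.remove[of F x]) auto
      moreover have "B x x \<noteq> 0"
        using Bxx[OF x] by (metis exp_gt_zero leD norm_zero)
      moreover have "bump x x = 1"
      proof -
        have "1 - cnj x * x = of_real (1 - (cmod x)\<^sup>2)"
          using complex_norm_square[of x] by (simp add: mult.commute del: complex_mult_cnj)
        then show ?thesis
          using nz[OF x F1[OF x]] by (metis divide_self)
      qed
      ultimately show ?thesis
        by (simp only: divide_self power_one mult_1_right diff_self exp_zero not_False_eq_True)
    qed
    fix z assume z: "cmod z < 1"
    have "cmod (f z) \<le> (\<Sum>x\<in>F. exp (C / d + 2 * (1 + C)) *
        (cmod (w x) * (cmod (bump x z) ^ n * exp (- (\<Sum>y\<in>G x. (cmod (bump y z))\<^sup>2)))))"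
      unfolding f_def
    proof (rule sum_norm_le)
      fix x assume x: "x \<in> F"
      have "cmod (B x z / B x x) \<le> 1 / exp (- (C / d))"
        unfolding norm_divide using B1[OF z, of x] Bxx[OF x] by (intro frac_le) auto
      then have 1: "cmod (B x z / B x x) \<le> exp (C / d)"
        by (simp add: exp_minus divide_inverse)
      have "cmod (exp (g x x - g x z)) = exp (Re (g x x) - Re (g x z))"
        by (simp add: norm_exp_eq_Re)
      also have "\<dots> \<le> exp (2 * (1 + C) - (\<Sum>y\<in>G x. (cmod (bump y z))\<^sup>2))"
        using g_ge[OF z, of x] g_le[OF x] by (simp only: exp_le_cancel_iff)
      also have "\<dots> = exp (2 * (1 + C)) * exp (- (\<Sum>y\<in>G x. (cmod (bump y z))\<^sup>2))"
        by (simp only: diff_conv_add_uminus exp_add)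
      finally have 2: "cmod (exp (g x x - g x z)) \<le>
        exp (2 * (1 + C)) * exp (- (\<Sum>y\<in>G x. (cmod (bump y z))\<^sup>2))" .
      have "cmod (w x * (B x z / B x x) * bump x z ^ n * exp (g x x - g x z)) =
          cmod (w x) * cmod (B x z / B x x) * cmod (bump x z) ^ n * cmod (exp (g x x - g x z))"
        by (simp only: norm_mult norm_power)
      also have "\<dots> \<le> cmod (w x) * exp (C / d) * cmod (bump x z) ^ n *
          (exp (2 * (1 + C)) * exp (- (\<Sum>y\<in>G x. (cmod (bump y z))\<^sup>2)))"
        by (intro mult_mono 1 2 order_refl mult_nonneg_nonneg) auto
      finally show "cmod (w x * (B x z / B x x) * bump x z ^ n * exp (g x x - g x z)) \<le>
          exp (C / d + 2 * (1 + C)) * (cmod (w x) * (cmod (bump x z) ^ n * exp (- (\<Sum>y\<in>G x. (cmod (bump y z))\<^sup>2))))"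
        by (simp only: exp_add mult_ac)
    qed
    then show "cmod (f z) \<le> exp (C / d + 2 * (1 + C)) *
      (\<Sum>x\<in>F. cmod (w x) * (cmod (bump x z) ^ n * exp (- (\<Sum>y | y \<in> F \<and> cmod x \<le> cmod y. (cmod (bump y z))\<^sup>2))))"
      by (simp only: G_def sum_distrib_left)
  qed
qed

section \<open>Finite interpolation with bounds for every exponent\<close>

lemma powr_sum_le:
  fixes x :: "'a \<Rightarrow> real"
  assumes "finite F" "\<And>i. i \<in> F \<Longrightarrow> 0 \<le> x i" "0 < p" "p \<le> 1"
  shows "(\<Sum>i\<in>F. x i) powr p \<le> (\<Sum>i\<in>F. x i powr p)"
proof (cases "sum x F = 0")
  case True
  then show ?thesis
    using assms by (simp add: sum_nonneg)
next
  case False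
  define s where "s = sum x F"
  have s: "0 < s"
    using False assms by (simp add: s_def sum_nonneg less_le)
  have "s powr p = s * s powr (p - 1)"
    using s by (simp add: powr_diff)
  also have "\<dots> = (\<Sum>i\<in>F. x i * s powr (p - 1))"
    by (simp add: s_def sum_distrib_right)
  also have "\<dots> \<le> (\<Sum>i\<in>F. x i powr p)"
  proof (rule sum_mono)
    fix i assume i: "i \<in> F"
    show "x i * s powr (p - 1) \<le> x i powr p"
    proof (cases "x i = 0")
      case False
      then have xi: "0 < x i"
        using assms(2)[OF i] by simp
      have "x i \<le> s"
        unfolding s_def using assms i by (intro member_le_sum) auto
      then have "s powr (p - 1) \<le> x i powr (p - 1)"
        using xi assms by (intro powr_mono2') auto
      then have "x i * s powr (p - 1) \<le> x i * x i powr (p - 1)"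
        using xi by (intro mult_left_mono) auto
      also have "\<dots> = x i powr p"
        using xi by (simp add: powr_diff)
      finally show ?thesis .
    qed simp
  qed
  finally show ?thesis
    by (simp add: s_def)
qed

text \<open>Jensen's inequality by the tangent at \<open>T\<close>. Total weight at most 1 is enough
  because the constant term of the tangent is nonpositive.\<close>

lemma powr_weighted_sum_le:
  fixes x b :: "'a \<Rightarrow> real"
  assumes fin: "finite F" and x: "\<And>i. i \<in> F \<Longrightarrow> 0 \<le> x i" and b: "\<And>i. i \<in> F \<Longrightarrow> 0 \<le> b i" "sum b F \<le> 1"
    and p: "1 \<le> p"
  shows "(\<Sum>i\<in>F. x i * b i) powr p \<le> (\<Sum>i\<in>F. x i powr p * b i)"
proof (cases "(\<Sum>i\<in>F. x i * b i) = 0")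
  case True
  then show ?thesis
    using assms by (simp add: sum_nonneg)
next
  case False
  define T where "T = (\<Sum>i\<in>F. x i * b i)"
  have T: "0 < T"
    using False x b by (simp add: T_def sum_nonneg less_le)
  have "T powr p = p * T powr (p - 1) * T - (p - 1) * T powr p * 1"
    using T by (simp add: powr_diff algebra_simps)
  also have "\<dots> \<le> p * T powr (p - 1) * T - (p - 1) * T powr p * sum b F"
    using b p by (intro diff_left_mono mult_left_mono) auto
  also have "\<dots> = (\<Sum>i\<in>F. (p * T powr (p - 1) * x i - (p - 1) * T powr p) * b i)"
    unfolding left_diff_distrib sum_subtractf
    by (subst T_def) (simp add: sum_distrib_left mult.assoc)
  also have "\<dots> \<le> (\<Sum>i\<in>F. x i powr p * b i)"
    using x b T p by (intro sum_mono mult_right_mono powr_above_tangent) auto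
  finally show ?thesis
    by (simp add: T_def)
qed

text \<open>The right-hand side consists of squared bumps because their circle means are known:
  integration will give a bound by the weighted data that does not depend on \<open>F\<close>. For p
  \<ge> 1 the squared bumps times the exponentials act as weights of total mass at most 1; for p < 1
  subadditivity of x powr p is used and the exponential is estimated by 1.\<close>

lemma finite_hardy_interpolation:
  fixes w :: "complex \<Rightarrow> complex"
  assumes fin: "finite F" and F: "F \<subseteq> ball 0 1" and C0: "0 \<le> C"
    and C: "\<And>x. x \<in> F \<Longrightarrow> (\<Sum>y\<in>F - {x}. szego_overlap y x) \<le> C"
    and d: "0 < d" "\<And>x y. x \<in> F \<Longrightarrow> y \<in> F \<Longrightarrow> x \<noteq> y \<Longrightarrow> szego_overlap y x \<le> 1 - d"
    and p: "0 < p"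
  shows "\<exists>f. f holomorphic_on ball 0 1 \<and> (\<forall>x\<in>F. f x = w x) \<and>
    (\<forall>z. cmod z < 1 \<longrightarrow> cmod (f z) powr p \<le> exp (C / d + 2 * (1 + C)) powr p * 2 powr (2 + 2 * p) *
      (\<Sum>x\<in>F. cmod (w x) powr p * (cmod (bump x z))\<^sup>2))"
proof -
  define D where "D = exp (C / d + 2 * (1 + C))"
  have D: "0 < D" by (simp add: D_def)
  have F1: "cmod x < 1" if "x \<in> F" for x
    using F that by auto
  have big: "1 \<le> (2::real) powr (2 + 2 * p)"
    using p by (intro ge_one_powr_ge_zero) auto
  \<comment> \<open>For p < 1 the power must satisfy n * p \<ge> 2, so that |bump|^(n * p) is
    comparable with |bump|^2. The ceiling keeps n * p \<le> 2 + 2 * p, and with |bump| \<le> 2 this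
    is the source of the constant 2 powr (2 + 2 * p).\<close>
  define n where "n = (if 1 \<le> p then 2 else nat \<lceil>2 / p\<rceil>)"
  let ?e = "\<lambda>x z. exp (- (\<Sum>y | y \<in> F \<and> cmod x \<le> cmod y. (cmod (bump y z))\<^sup>2))"
  have e1: "?e x z \<le> 1" for x z
    by (simp add: sum_nonneg)
  obtain f where f: "f holomorphic_on ball 0 1" "\<And>x. x \<in> F \<Longrightarrow> f x = w x"
    and fb: "\<And>z. cmod z < 1 \<Longrightarrow> cmod (f z) \<le> D *
      (\<Sum>x\<in>F. cmod (w x) * (cmod (bump x z) ^ n * ?e x z))"
    using finite_jones_interpolation[OF fin F C0 C d] unfolding D_def by blast
  have "cmod (f z) powr p \<le> D powr p * 2 powr (2 + 2 * p) * (\<Sum>x\<in>F. cmod (w x) powr p * (cmod (bump x z))\<^sup>2)"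
    if z: "cmod z < 1" for z
  proof -
    have "(\<Sum>x\<in>F. cmod (w x) * (cmod (bump x z) ^ n * ?e x z)) powr p \<le>
        (\<Sum>x\<in>F. cmod (w x) powr p * (2 powr (2 + 2 * p) * (cmod (bump x z))\<^sup>2))"
    proof (cases "1 \<le> p")
      case True
      have "(\<Sum>x\<in>F. (cmod (bump x z))\<^sup>2 * ?e x z) \<le> 1"
        using sum_exp_tail_le[OF fin, of "\<lambda>x. (cmod (bump x z))\<^sup>2" cmod]
        by (rule order_trans) auto
      then have "(\<Sum>x\<in>F. cmod (w x) * ((cmod (bump x z))\<^sup>2 * ?e x z)) powr p \<le>
          (\<Sum>x\<in>F. cmod (w x) powr p * ((cmod (bump x z))\<^sup>2 * ?e x z))"
        using fin True by (intro powr_weighted_sum_le) auto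
      also have "\<dots> \<le> (\<Sum>x\<in>F. cmod (w x) powr p * (2 powr (2 + 2 * p) * (cmod (bump x z))\<^sup>2))"
      proof (intro sum_mono mult_left_mono)
        fix x
        have "(cmod (bump x z))\<^sup>2 * ?e x z \<le> (cmod (bump x z))\<^sup>2 * 1"
          by (intro mult_left_mono e1) auto
        also have "\<dots> \<le> (cmod (bump x z))\<^sup>2 * 2 powr (2 + 2 * p)"
          by (intro mult_left_mono big) auto
        finally show "(cmod (bump x z))\<^sup>2 * ?e x z \<le> 2 powr (2 + 2 * p) * (cmod (bump x z))\<^sup>2"
          by (simp only: mult.commute)
      qed auto
      finally show ?thesis
        using True by (simp only: n_def if_True)
    next
      case False
      have n: "2 \<le> real n * p" "real n * p \<le> 2 + 2 * p"
      proof -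
        have "n = nat \<lceil>2 / p\<rceil>"
          using False by (simp add: n_def)
        then have "real n = of_int \<lceil>2 / p\<rceil>"
          using p by simp
        then have "2 / p \<le> real n" "real n \<le> 2 / p + 2"
          by linarith+
        then show "2 \<le> real n * p" "real n * p \<le> 2 + 2 * p"
          using p by (simp_all add: field_simps)
      qed
      have "(\<Sum>x\<in>F. cmod (w x) * (cmod (bump x z) ^ n * ?e x z)) powr p \<le>
          (\<Sum>x\<in>F. (cmod (w x) * (cmod (bump x z) ^ n * ?e x z)) powr p)"
        using fin False p by (intro powr_sum_le) auto
      also have "\<dots> \<le> (\<Sum>x\<in>F. cmod (w x) powr p * (2 powr (2 + 2 * p) * (cmod (bump x z))\<^sup>2))"
      proof (rule sum_mono)
        fix x assume x: "x \<in> F"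
        define u where "u = cmod (bump x z)"
        have u: "0 \<le> u" "u \<le> 2"
          unfolding u_def using norm_bump_le_2[OF F1[OF x] z] by (auto simp only: norm_ge_zero)
        have "(u ^ n) powr p \<le> 2 powr (2 + 2 * p) * u\<^sup>2"
        proof (cases "u = 0")
          case False
          with u have u0: "0 < u" by simp
          have "(u ^ n) powr p = u powr (real n * p)"
            using u0 by (simp add: powr_powr flip: powr_realpow)
          \<comment> \<open>Since u / 2 \<le> 1, lowering its exponent to 2 can only increase the
            power.\<close>
          also have "\<dots> = (2 * (u / 2)) powr (real n * p)"
            by simp
          also have "\<dots> = 2 powr (real n * p) * (u / 2) powr (real n * p)"
            by (rule powr_mult)
          also have "\<dots> \<le> 2 powr (2 + 2 * p) * (u / 2) powr 2"
            using u0 u n by (intro mult_mono powr_mono powr_mono') auto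
          also have "(u / 2) powr 2 \<le> u\<^sup>2"
            using u0 by (simp add: power_divide)
          finally show ?thesis
            by simp
        qed (use p n in \<open>auto simp: power_0_left n_def split: if_splits\<close>)
        have "(cmod (w x) * (u ^ n * ?e x z)) powr p \<le> (cmod (w x) * (u ^ n * 1)) powr p"
          using u p by (intro powr_mono2 mult_left_mono e1) auto
        also have "\<dots> = cmod (w x) powr p * (u ^ n) powr p"
          using u by (simp add: powr_mult)
        also have "\<dots> \<le> cmod (w x) powr p * (2 powr (2 + 2 * p) * u\<^sup>2)"
          by (intro mult_left_mono) (auto intro: \<open>(u ^ n) powr p \<le> 2 powr (2 + 2 * p) * u\<^sup>2\<close>)
        finally show "(cmod (w x) * (cmod (bump x z) ^ n * ?e x z)) powr p \<le>
            cmod (w x) powr p * (2 powr (2 + 2 * p) * (cmod (bump x z))\<^sup>2)"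
          by (simp only: u_def)
      qed
      finally show ?thesis .
    qed
    also have "\<dots> = 2 powr (2 + 2 * p) * (\<Sum>x\<in>F. cmod (w x) powr p * (cmod (bump x z))\<^sup>2)"
      by (simp only: sum_distrib_left mult.left_commute)
    finally have le: "(\<Sum>x\<in>F. cmod (w x) * (cmod (bump x z) ^ n * ?e x z)) powr p \<le>
        2 powr (2 + 2 * p) * (\<Sum>x\<in>F. cmod (w x) powr p * (cmod (bump x z))\<^sup>2)" .
    have "cmod (f z) powr p \<le> (D * (\<Sum>x\<in>F. cmod (w x) * (cmod (bump x z) ^ n * ?e x z))) powr p"
      using fb[OF z] p by (intro powr_mono2) auto
    also have "\<dots> = D powr p * (\<Sum>x\<in>F. cmod (w x) * (cmod (bump x z) ^ n * ?e x z)) powr p"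
      by (rule powr_mult)
    also have "\<dots> \<le> D powr p * (2 powr (2 + 2 * p) * (\<Sum>x\<in>F. cmod (w x) powr p * (cmod (bump x z))\<^sup>2))"
      using le by (intro mult_left_mono) auto
    finally show ?thesis
      by (simp only: mult.assoc)
  qed
  then show ?thesis
    using f unfolding D_def by blast
qed

text \<open>For n = 2 the weights in Jones' sum have total mass at most 1, so the supremum of the
  data factors out.\<close>

lemma finite_bounded_interpolation:
  fixes w :: "complex \<Rightarrow> complex"
  assumes fin: "finite F" and F: "F \<subseteq> ball 0 1" and C0: "0 \<le> C"
    and C: "\<And>x. x \<in> F \<Longrightarrow> (\<Sum>y\<in>F - {x}. szego_overlap y x) \<le> C"
    and d: "0 < d" "\<And>x y. x \<in> F \<Longrightarrow> y \<in> F \<Longrightarrow> x \<noteq> y \<Longrightarrow> szego_overlap y x \<le> 1 - d"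
    and W: "\<And>x. x \<in> F \<Longrightarrow> cmod (w x) \<le> W" "0 \<le> W"
  shows "\<exists>f. f holomorphic_on ball 0 1 \<and> (\<forall>x\<in>F. f x = w x) \<and>
    (\<forall>z. cmod z < 1 \<longrightarrow> cmod (f z) \<le> exp (C / d + 2 * (1 + C)) * W)"
proof -
  define D where "D = exp (C / d + 2 * (1 + C))"
  let ?e = "\<lambda>x z. exp (- (\<Sum>y | y \<in> F \<and> cmod x \<le> cmod y. (cmod (bump y z))\<^sup>2))"
  obtain f where f: "f holomorphic_on ball 0 1" "\<And>x. x \<in> F \<Longrightarrow> f x = w x"
    and fb: "\<And>z. cmod z < 1 \<Longrightarrow> cmod (f z) \<le> D *
      (\<Sum>x\<in>F. cmod (w x) * (cmod (bump x z) ^ 2 * ?e x z))"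
    using finite_jones_interpolation[OF fin F C0 C d] unfolding D_def by blast
  have "cmod (f z) \<le> D * W" if z: "cmod z < 1" for z
  proof -
    have "(\<Sum>x\<in>F. cmod (w x) * (cmod (bump x z) ^ 2 * ?e x z)) \<le> (\<Sum>x\<in>F. W * ((cmod (bump x z))\<^sup>2 * ?e x z))"
      using W by (intro sum_mono mult_right_mono) auto
    also have "\<dots> = W * (\<Sum>x\<in>F. (cmod (bump x z))\<^sup>2 * ?e x z)"
      by (simp only: sum_distrib_left)
    also have "\<dots> \<le> W * 1"
      using sum_exp_tail_le[OF fin, of "\<lambda>x. (cmod (bump x z))\<^sup>2" cmod]
      by (intro mult_left_mono W(2)) (rule order_trans, auto)
    finally have "D * (\<Sum>x\<in>F. cmod (w x) * (cmod (bump x z) ^ 2 * ?e x z)) \<le> D * W"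
      by (intro mult_left_mono) (auto simp: D_def)
    with fb[OF z] show ?thesis
      by (rule order_trans)
  qed
  then show ?thesis
    using f unfolding D_def by blast
qed

section \<open>Passage from finite subsets to the whole sequence\<close>

lemma interpolation_subsequence:
  fixes f :: "nat \<Rightarrow> complex \<Rightarrow> complex"
  assumes hol: "\<And>n. f n holomorphic_on ball 0 1"
    and bound: "\<And>n z. cmod z < 1 \<Longrightarrow> cmod (f n z) \<le> A * (1 - cmod z) powr q"
    and eq: "\<And>x. x \<in> S \<Longrightarrow> \<forall>\<^sub>F n in sequentially. f n x = w x"
    and S: "S \<subseteq> ball 0 1"
  obtains g r where "g holomorphic_on ball 0 1" "strict_mono (r :: nat \<Rightarrow> nat)"
    "\<And>z. cmod z < 1 \<Longrightarrow> (\<lambda>n. f (r n) z) \<longlonglongrightarrow> g z" "\<And>x. x \<in> S \<Longrightarrow> g x = w x"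
proof -
  \<comment> \<open>The bound may blow up at the unit circle but is bounded on compact subsets of
    the disk, as Montel's theorem requires.\<close>
  define H where "H = {h. h holomorphic_on ball 0 1 \<and> (\<forall>z. cmod z < 1 \<longrightarrow> cmod (h z) \<le> A * (1 - cmod z) powr q)}"
  have bd: "\<exists>B. \<forall>h\<in>H. \<forall>z\<in>K. cmod (h z) \<le> B" if K: "compact K" "K \<subseteq> ball 0 1" for K
  proof -
    have "continuous_on K (\<lambda>z. A * (1 - cmod z) powr q)"
      using K(2) by (intro continuous_intros) auto
    then have "bounded ((\<lambda>z. A * (1 - cmod z) powr q) ` K)"
      using K(1) compact_continuous_image compact_imp_bounded by blast
    then obtain B where B: "\<And>z. z \<in> K \<Longrightarrow> \<bar>A * (1 - cmod z) powr q\<bar> \<le> B"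
      by (auto simp: bounded_iff)
    have "cmod (h z) \<le> B" if h: "h \<in> H" and z: "z \<in> K" for h z
    proof -
      have "cmod z < 1"
        using K(2) z by auto
      then have "cmod (h z) \<le> A * (1 - cmod z) powr q"
        using h by (simp add: H_def)
      also have "\<dots> \<le> B"
        using B[OF z] by linarith
      finally show ?thesis .
    qed
    then show ?thesis by blast
  qed
  have rng: "range f \<subseteq> H"
    using hol bound by (auto simp: H_def)
  have holH: "h holomorphic_on ball 0 1" if "h \<in> H" for h
    using that by (simp add: H_def)
  obtain g r where g: "g holomorphic_on ball 0 1" "strict_mono (r :: nat \<Rightarrow> nat)"
    "\<And>z. z \<in> ball 0 1 \<Longrightarrow> (\<lambda>n. f (r n) z) \<longlonglongrightarrow> g z"
    using Montel[OF open_ball holH bd rng] by metis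
  show ?thesis
  proof (rule that[OF g(1,2)])
    fix x assume x: "x \<in> S"
    have "\<forall>\<^sub>F n in sequentially. f (r n) x = w x"
      using eq[OF x] filterlim_subseq[OF g(2)] by (auto simp: filterlim_iff)
    then have "(\<lambda>n. f (r n) x) \<longlonglongrightarrow> w x"
      by (rule tendsto_eventually)
    moreover have "(\<lambda>n. f (r n) x) \<longlonglongrightarrow> g x"
      using x S by (intro g(3)) auto
    ultimately show "g x = w x"
      using LIMSEQ_unique by blast
  qed (use g(3) in auto)
qed

text \<open>Here \<open>w\<close> stands for the p-th powers of the moduli of the data. On a fixed
  circle the approximants are dominated by a constant, so their means converge; the bound common to
  all circles comes from integrating the squared bumps.\<close>

lemma limit_in_hardy:
  fixes g :: "complex \<Rightarrow> complex" and f :: "nat \<Rightarrow> complex \<Rightarrow> complex"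
  assumes p: "0 < p" and g: "g holomorphic_on ball 0 1" and f: "\<And>n. f n holomorphic_on ball 0 1"
    and lim: "\<And>z. cmod z < 1 \<Longrightarrow> (\<lambda>n. f n z) \<longlonglongrightarrow> g z"
    and F: "\<And>n. finite (F n)" "\<And>n. F n \<subseteq> ball 0 1" and w: "\<And>x. 0 \<le> w x" and A: "0 \<le> A"
    and fF: "\<And>n z. cmod z < 1 \<Longrightarrow> cmod (f n z) powr p \<le> A * (\<Sum>x\<in>F n. w x * (cmod (bump x z))\<^sup>2)"
    and W: "\<And>n. (\<Sum>x\<in>F n. w x * (1 - (cmod x)\<^sup>2)) \<le> W"
  shows "g \<in> hardy p"
proof -
  have means: "integral {0..2 * pi} (\<lambda>t. cmod (g (of_real r * cis t)) powr p) \<le> 2 * pi * (A * W)"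
    if r: "0 \<le> r" "r < 1" for r
  proof -
    have z1: "cmod (of_real r * cis t) < 1" for t
      using r by (simp add: norm_mult)
    have cont: "continuous_on {0..2 * pi} (\<lambda>t. cmod (f n (of_real r * cis t)) powr p)" for n
      using p z1 by (intro continuous_on_powr' continuous_intros
          continuous_on_compose2[OF holomorphic_on_imp_continuous_on[OF f]]) auto
    have int: "integral {0..2 * pi} (\<lambda>t. cmod (f n (of_real r * cis t)) powr p) \<le> 2 * pi * (A * W)" for n
    proof -
      have bint: "((\<lambda>t. (cmod (bump x (of_real r * cis t)))\<^sup>2) has_integral
          (1 - (cmod x)\<^sup>2)\<^sup>2 * (2 * pi / (1 - (cmod (cnj x * of_real r))\<^sup>2))) {0..2 * pi}" if "x \<in> F n" for x
      proof -
        have "cmod (cnj x * of_real r) < 1"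
          using that F(2)[of n] r by (intro norm_cnj_mult_less_1) auto
        from has_integral_mult_right[OF poisson_kernel_integral[OF this]] show ?thesis
          unfolding norm_bump_square by (simp only: mult.assoc)
      qed
      have "integral {0..2 * pi} (\<lambda>t. cmod (f n (of_real r * cis t)) powr p) \<le>
          A * (\<Sum>x\<in>F n. w x * ((1 - (cmod x)\<^sup>2)\<^sup>2 * (2 * pi / (1 - (cmod (cnj x * of_real r))\<^sup>2))))"
        by (rule has_integral_le[OF integrable_integral[OF integrable_continuous_interval[OF cont]]
            has_integral_mult_right[OF has_integral_sum[OF F(1) has_integral_mult_right[OF bint]]]])
          (use fF z1 in auto)
      also have "\<dots> \<le> A * (\<Sum>x\<in>F n. 2 * pi * (w x * (1 - (cmod x)\<^sup>2)))"
      proof (intro mult_left_mono A sum_mono)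
        fix x assume "x \<in> F n"
        then have x: "cmod x < 1"
          using F(2)[of n] by auto
        have pos: "0 < 1 - (cmod x)\<^sup>2"
          by (rule one_minus_norm_square_pos[OF x])
        have "(cmod x)\<^sup>2 * r\<^sup>2 \<le> (cmod x)\<^sup>2 * 1"
          using r by (intro mult_left_mono) (auto simp: abs_square_le_1)
        then have le: "1 - (cmod x)\<^sup>2 \<le> 1 - (cmod (cnj x * of_real r))\<^sup>2"
          by (simp add: norm_mult power_mult_distrib)
        have "(1 - (cmod x)\<^sup>2)\<^sup>2 * (2 * pi / (1 - (cmod (cnj x * of_real r))\<^sup>2)) \<le>
            (1 - (cmod x)\<^sup>2)\<^sup>2 * (2 * pi / (1 - (cmod x)\<^sup>2))"
          using less_le_trans[OF pos le] by (intro mult_left_mono divide_left_mono mult_pos_pos le pos) auto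
        also have "\<dots> = 2 * pi * (1 - (cmod x)\<^sup>2)"
          using pos by (simp add: power2_eq_square)
        finally show "w x * ((1 - (cmod x)\<^sup>2)\<^sup>2 * (2 * pi / (1 - (cmod (cnj x * of_real r))\<^sup>2))) \<le>
            2 * pi * (w x * (1 - (cmod x)\<^sup>2))"
          using w[of x] by (metis mult_left_mono mult.left_commute)
      qed
      also have "\<dots> = 2 * pi * (A * (\<Sum>x\<in>F n. w x * (1 - (cmod x)\<^sup>2)))"
        by (simp only: sum_distrib_left mult_ac)
      also have "\<dots> \<le> 2 * pi * (A * W)"
        by (intro mult_left_mono W A) auto
      finally show ?thesis .
    qed
    define b where "b = A * (W * (1 - r) powr (- 2))"
    have fb: "cmod (f n (of_real r * cis t)) powr p \<le> b" for n t
    proof -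
      have "(\<Sum>x\<in>F n. w x * (cmod (bump x (of_real r * cis t)))\<^sup>2) \<le>
          (\<Sum>x\<in>F n. w x * ((1 - (cmod x)\<^sup>2) * (1 - cmod (of_real r * cis t)) powr (- 2)))"
        using F(2)[of n] w by (intro sum_mono mult_left_mono norm_bump_square_le z1) auto
      also have "\<dots> = (\<Sum>x\<in>F n. w x * (1 - (cmod x)\<^sup>2)) * (1 - r) powr (- 2)"
        using r by (simp add: norm_mult sum_distrib_right mult.assoc)
      also have "\<dots> \<le> W * (1 - r) powr (- 2)"
        by (intro mult_right_mono W) auto
      finally have "A * (\<Sum>x\<in>F n. w x * (cmod (bump x (of_real r * cis t)))\<^sup>2) \<le> b"
        unfolding b_def by (intro mult_left_mono A)
      with fF[OF z1] show ?thesis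
        by (rule order_trans)
    qed
    have "(\<lambda>n. integral {0..2 * pi} (\<lambda>t. cmod (f n (of_real r * cis t)) powr p)) \<longlonglongrightarrow>
        integral {0..2 * pi} (\<lambda>t. cmod (g (of_real r * cis t)) powr p)"
    proof (rule dominated_convergence(2)[where h = "\<lambda>_. b"])
      show "(\<lambda>t. cmod (f n (of_real r * cis t)) powr p) integrable_on {0..2 * pi}" for n
        by (rule integrable_continuous_interval[OF cont])
      show "(\<lambda>n. cmod (f n (of_real r * cis t)) powr p) \<longlonglongrightarrow> cmod (g (of_real r * cis t)) powr p" for t
        using p by (intro tendsto_powr' tendsto_norm lim z1 tendsto_const) auto
    qed (use fb in auto)
    then show ?thesis
      by (rule LIMSEQ_le_const2) (use int in auto)
  qed
  have "bdd_above ((\<lambda>r. (integral {0..2 * pi}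
        (\<lambda>t. cmod (g (of_real r * cis t)) powr p / (2 * pi))) powr (1 / p)) ` {0..<1})"
  proof (rule bdd_aboveI2)
    fix r :: real assume "r \<in> {0..<1}"
    then have "integral {0..2 * pi} (\<lambda>t. cmod (g (of_real r * cis t)) powr p) \<le> 2 * pi * (A * W)"
      by (intro means) auto
    then show "(integral {0..2 * pi} (\<lambda>t. cmod (g (of_real r * cis t)) powr p / (2 * pi))) powr (1 / p)
        \<le> (A * W) powr (1 / p)"
      using p by (intro powr_mono2) (auto simp: field_simps intro!: integral_nonneg_gen)
  qed
  with g show ?thesis
    by (simp add: hardy_def)
qed

text \<open>The bound over all pairs contains both ingredients of Jones' formula: a row sum is a
  single term of it, and only finitely many pairs have overlap above 1/2, so a minimum over these
  keeps all overlaps away from 1.\<close>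

theorem szego_overlap_sum_imp_interpolating:
  assumes p: "0 < p" and S: "S \<subseteq> ball 0 1" "countable S"
    and sum: "\<And>F. finite F \<Longrightarrow> F \<subseteq> S \<Longrightarrow> (\<Sum>x\<in>F. \<Sum>y\<in>F - {x}. szego_overlap y x) \<le> C"
  shows "interpolating p S"
proof -
  have S1: "cmod x < 1" if "x \<in> S" for x
    using S that by auto
  have C0: "0 \<le> C"
    using sum[of "{}"] by simp
  have row: "(\<Sum>y\<in>F - {x}. szego_overlap y x) \<le> C" if "finite F" "F \<subseteq> S" "x \<in> F" for F x
  proof -
    have "(\<Sum>y\<in>F - {x}. szego_overlap y x) \<le> (\<Sum>x\<in>F. \<Sum>y\<in>F - {x}. szego_overlap y x)"
      by (rule member_le_sum[of x F "\<lambda>x. \<Sum>y\<in>F - {x}. szego_overlap y x"])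
        (use that S1 in \<open>auto intro!: sum_nonneg szego_overlap_nonneg\<close>)
    also have "\<dots> \<le> C"
      using that by (intro sum)
    finally show ?thesis .
  qed
  obtain d where d: "0 < d" "\<And>x y. x \<in> S \<Longrightarrow> y \<in> S \<Longrightarrow> x \<noteq> y \<Longrightarrow> szego_overlap y x \<le> 1 - d"
  proof -
    define P where "P = {(x, y). x \<in> S \<and> y \<in> S \<and> x \<noteq> y \<and> szego_overlap y x > 1 / 2}"
    have "finite P \<and> card P \<le> nat \<lceil>2 * C\<rceil>"
    proof (rule finite_if_finite_subsets_card_bdd)
      fix G assume G: "G \<subseteq> P" "finite G"
      define F where "F = fst ` G \<union> snd ` G"
      have F: "finite F" "F \<subseteq> S"
        using G by (auto simp: F_def P_def)
      have "real (card G) * (1 / 2) = (\<Sum>(x, y)\<in>G. 1 / 2)"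
        by (simp add: case_prod_unfold)
      also have "\<dots> \<le> (\<Sum>(x, y)\<in>G. szego_overlap y x)"
        using G by (intro sum_mono) (auto simp: P_def)
      also have "\<dots> \<le> (\<Sum>(x, y)\<in>(SIGMA x:F. F - {x}). szego_overlap y x)"
      proof (rule sum_mono2)
        show "finite (SIGMA x:F. F - {x})"
          using F by auto
        show "G \<subseteq> (SIGMA x:F. F - {x})"
        proof
          fix q assume "q \<in> G"
          then have "fst q \<in> F" "snd q \<in> F" "fst q \<noteq> snd q"
            using G by (auto simp: F_def P_def)
          then show "q \<in> (SIGMA x:F. F - {x})"
            by (cases q) auto
        qed
        show "0 \<le> (case q of (x, y) \<Rightarrow> szego_overlap y x)"
          if "q \<in> (SIGMA x:F. F - {x}) - G" for q
          using that F S1 by (auto intro!: szego_overlap_nonneg)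
      qed
      also have "\<dots> = (\<Sum>x\<in>F. \<Sum>y\<in>F - {x}. szego_overlap y x)"
        using F by (subst sum.Sigma) auto
      also have "\<dots> \<le> C"
        using F by (rule sum)
      finally show "card G \<le> nat \<lceil>2 * C\<rceil>"
        by linarith
    qed
    then have P: "finite P" ..
    define d where "d = Min (insert (1 / 2) ((\<lambda>(x, y). 1 - szego_overlap y x) ` P))"
    have "0 < d"
      unfolding d_def using P S1 by (subst Min_gr_iff) (auto simp: P_def intro!: szego_overlap_less_1)
    moreover have "szego_overlap y x \<le> 1 - d" if xy: "x \<in> S" "y \<in> S" "x \<noteq> y" for x y
    proof (cases "(x, y) \<in> P")
      case True
      then have "d \<le> 1 - szego_overlap y x"
        unfolding d_def using P by (intro Min_le) force+
      then show ?thesis by simp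
    next
      case False
      moreover have "d \<le> 1 / 2"
        unfolding d_def using P by (intro Min_le) auto
      ultimately show ?thesis
        using xy by (simp add: P_def)
    qed
    ultimately show ?thesis
      by (rule that)
  qed
  define F where "F n = {x \<in> S. to_nat_on S x < n}" for n
  have F: "finite (F n)" "F n \<subseteq> S" "F n \<subseteq> ball 0 1" for n
  proof -
    have "inj_on (to_nat_on S) (F n)"
      using inj_on_to_nat_on[OF S(2)] by (rule inj_on_subset) (auto simp: F_def)
    moreover have "to_nat_on S ` F n \<subseteq> {..<n}"
      by (auto simp: F_def)
    ultimately show "finite (F n)"
      by (meson finite_imageD finite_lessThan finite_subset)
  qed (use S in \<open>auto simp: F_def\<close>)
  have FS: "x \<in> S" if "x \<in> F n" for x n
    using that by (simp add: F_def)
  have rowF: "(\<Sum>y\<in>F n - {x}. szego_overlap y x) \<le> C" if "x \<in> F n" for x n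
    using F that by (intro row)
  have dF: "szego_overlap y x \<le> 1 - d" if "x \<in> F n" "y \<in> F n" "x \<noteq> y" for x y n
    using d(2) FS that by blast
  have evF: "\<forall>\<^sub>F n in sequentially. x \<in> F n" if "x \<in> S" for x
    using eventually_gt_at_top[of "to_nat_on S x"] by eventually_elim (use that in \<open>auto simp: F_def\<close>)
  define D where "D = exp (C / d + 2 * (1 + C))"
  show ?thesis
  proof (cases "p = \<infinity>")
    case True
    have *: "\<exists>f\<in>hardy_infinity. \<forall>z\<in>S. f z = w z" if w: "bounded (w ` S)" for w
    proof -
      obtain W where W: "0 < W" "\<And>x. x \<in> S \<Longrightarrow> cmod (w x) \<le> W"
        using w by (auto simp: bounded_pos)
      have "\<exists>f. f holomorphic_on ball 0 1 \<and> (\<forall>x\<in>F n. f x = w x) \<and>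
          (\<forall>z. cmod z < 1 \<longrightarrow> cmod (f z) \<le> D * W)" for n
        unfolding D_def
        by (rule finite_bounded_interpolation[OF F(1,3) C0 rowF d(1) dF]) (use FS W in auto)
      then obtain f where f: "\<And>n. f n holomorphic_on ball 0 1" "\<And>n x. x \<in> F n \<Longrightarrow> f n x = w x"
        "\<And>n z. cmod z < 1 \<Longrightarrow> cmod (f n z) \<le> D * W"
        by metis
      obtain g r where g: "g holomorphic_on ball 0 1" "\<And>z. cmod z < 1 \<Longrightarrow> (\<lambda>n. f (r n) z) \<longlonglongrightarrow> g z"
        "\<And>x. x \<in> S \<Longrightarrow> g x = w x"
      proof (rule interpolation_subsequence[of f "D * W" 0 S w])
        show "\<forall>\<^sub>F n in sequentially. f n x = w x" if "x \<in> S" for x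
          using evF[OF that] by eventually_elim (use f(2) in auto)
      qed (use f S in auto)
      have "cmod (g z) \<le> D * W" if "cmod z < 1" for z
        by (rule LIMSEQ_le_const2[OF tendsto_norm[OF g(2)[OF that]]]) (use f(3) that in auto)
      then have "\<forall>y\<in>g ` unit_disk. norm y \<le> D * W"
        by auto
      then have "g \<in> hardy_infinity"
        using g(1) unfolding hardy_infinity_def bounded_iff by blast
      with g(3) show ?thesis by blast
    qed
    show ?thesis
      unfolding interpolating_def if_P[OF True] by (intro conjI S(1) allI impI *)
  next
    case False
    define p' where "p' = enn2real p"
    have p': "0 < p'"
      using p False by (simp add: p'_def enn2real_positive_iff less_top)
    have *: "\<exists>f\<in>hardy p'. \<forall>z\<in>S. f z = w z"
      if w: "(\<lambda>z. (1 - (cmod z)\<^sup>2) * cmod (w z) powr p') summable_on S" for w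
    proof -
      define v where "v x = cmod (w x) powr p'" for x
      define W where "W = infsum (\<lambda>z. (1 - (cmod z)\<^sup>2) * cmod (w z) powr p') S"
      define A where "A = D powr p' * 2 powr (2 + 2 * p')"
      have A0: "0 \<le> A"
        by (simp add: A_def)
      have nonneg: "0 \<le> (1 - (cmod x)\<^sup>2) * cmod (w x) powr p'" if "x \<in> S" for x
        using one_minus_norm_square_pos[OF S1[OF that]] by simp
      have W: "(\<Sum>x\<in>F n. v x * (1 - (cmod x)\<^sup>2)) \<le> W" for n
      proof -
        have "(\<Sum>x\<in>F n. (1 - (cmod x)\<^sup>2) * cmod (w x) powr p') \<le> W"
          unfolding W_def using F nonneg by (intro finite_sum_le_infsum[OF w]) auto
        then show ?thesis
          by (simp only: v_def mult.commute)
      qed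
      have W0: "0 \<le> W"
        unfolding W_def by (intro infsum_nonneg nonneg)
      define Q where "Q n f \<longleftrightarrow> f holomorphic_on ball 0 1 \<and> (\<forall>x\<in>F n. f x = w x) \<and>
          (\<forall>z. cmod z < 1 \<longrightarrow> cmod (f z) powr p' \<le> A * (\<Sum>x\<in>F n. v x * (cmod (bump x z))\<^sup>2))" for n f
      have "\<exists>f. Q n f" for n
        unfolding Q_def A_def D_def v_def
        by (rule finite_hardy_interpolation[OF F(1,3) C0 rowF d(1) dF p'])
      then obtain f where "\<And>n. Q n (f n)"
        by metis
      then have f: "f n holomorphic_on ball 0 1" "\<And>x. x \<in> F n \<Longrightarrow> f n x = w x"
        "\<And>z. cmod z < 1 \<Longrightarrow> cmod (f n z) powr p' \<le> A * (\<Sum>x\<in>F n. v x * (cmod (bump x z))\<^sup>2)" for n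
        unfolding Q_def by blast+
      \<comment> \<open>The pointwise bound of the bumps gives the exponent - 2 / p. This is cruder
        than the true growth rate - 1 / p but yields local boundedness.\<close>
      have fb: "cmod (f n z) \<le> (A * W) powr (1 / p') * (1 - cmod z) powr (- 2 * (1 / p'))"
        if z: "cmod z < 1" for n z
      proof -
        have "(\<Sum>x\<in>F n. v x * (cmod (bump x z))\<^sup>2) \<le>
            (\<Sum>x\<in>F n. v x * ((1 - (cmod x)\<^sup>2) * (1 - cmod z) powr (- 2)))"
          using F(3)[of n] z by (intro sum_mono mult_left_mono norm_bump_square_le) (auto simp: v_def)
        also have "\<dots> = (\<Sum>x\<in>F n. v x * (1 - (cmod x)\<^sup>2)) * (1 - cmod z) powr (- 2)"
          by (simp only: sum_distrib_right mult.assoc)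
        also have "\<dots> \<le> W * (1 - cmod z) powr (- 2)"
          by (intro mult_right_mono W) auto
        finally have "A * (\<Sum>x\<in>F n. v x * (cmod (bump x z))\<^sup>2) \<le> A * (W * (1 - cmod z) powr (- 2))"
          by (intro mult_left_mono A0)
        from order_trans[OF f(3)[OF z] this]
        have "cmod (f n z) powr p' \<le> A * W * (1 - cmod z) powr (- 2)"
          by (simp only: mult.assoc)
        then have "(cmod (f n z) powr p') powr (1 / p') \<le> (A * W * (1 - cmod z) powr (- 2)) powr (1 / p')"
          using p' by (intro powr_mono2) auto
        also have "\<dots> = (A * W) powr (1 / p') * (1 - cmod z) powr (- 2 * (1 / p'))"
          by (simp only: powr_mult powr_powr)
        finally show ?thesis
          using p' by (simp add: powr_powr)
      qed
      have ev: "\<forall>\<^sub>F n in sequentially. f n x = w x" if "x \<in> S" for x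
        using evF[OF that] by eventually_elim (rule f(2))
      obtain g r where g: "g holomorphic_on ball 0 1" "\<And>z. cmod z < 1 \<Longrightarrow> (\<lambda>n. f (r n) z) \<longlonglongrightarrow> g z"
        "\<And>x. x \<in> S \<Longrightarrow> g x = w x"
        using interpolation_subsequence[OF f(1) fb ev S(1)] by metis
      have v0: "0 \<le> v x" for x
        by (simp add: v_def)
      have "g \<in> hardy p'"
        by (rule limit_in_hardy[where f = "\<lambda>n. f (r n)" and F = "\<lambda>n. F (r n)",
              OF p' g(1) f(1) g(2) F(1) F(3) v0 A0 f(3) W])
      then show ?thesis
        by (intro bexI[of _ g] ballI g(3))
    qed
    show ?thesis
      unfolding interpolating_def if_not_P[OF False] p'_def[symmetric] by (intro conjI S(1) allI impI *)
  qed
qed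

section \<open>Geometry of the dyadic boxes and Schur's test\<close>

lemma norm_cis_diff_le: "cmod (cis a - cis b) \<le> \<bar>a - b\<bar>"
proof -
  have "cis a - cis b = cis b * (exp (\<i> * of_real (a - b)) - 1)"
    by (simp add: cis_conv_exp algebra_simps exp_diff)
  then have "cmod (cis a - cis b) = 2 * \<bar>sin ((a - b) / 2)\<bar>"
    by (simp only: norm_mult norm_cis dist_exp_i_1 mult_1)
  also have "\<dots> \<le> \<bar>a - b\<bar>"
    using abs_sin_le_one[of "(a - b) / 2"] abs_sin_x_le_abs_x[of "(a - b) / 2"] by simp
  finally show ?thesis .
qed

text \<open>In the definition of a box, 1 - r \<le> 1 forces \<open>r\<close> to be nonnegative and
  k < 2 ^ n forces 0 \<le> t < 2 * pi, so \<open>r\<close> and \<open>t\<close> are the modulus and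
  the argument. The exception is the origin, where \<open>t\<close> is not determined; there n = 0
  and k = 0, and \<open>Arg2pi 0 = 0\<close> meets the conditions.\<close>

lemma dyadic_box_iff:
  assumes k: "k < 2 ^ n"
  shows "z \<in> dyadic_box n k \<longleftrightarrow> cmod z < 1 \<and> 1 / 2 ^ (n + 1) < 1 - cmod z \<and> 1 - cmod z \<le> 1 / 2 ^ n \<and>
    real k / 2 ^ n \<le> Arg2pi z / (2 * pi) \<and> Arg2pi z / (2 * pi) < (real k + 1) / 2 ^ n"
    (is "_ \<longleftrightarrow> ?R z")
proof
  assume "?R z"
  moreover have "z = of_real (cmod z) * cis (Arg2pi z)"
    using Arg2pi_eq[of z] by (simp add: cis_conv_exp)
  ultimately show "z \<in> dyadic_box n k"
    unfolding dyadic_box_def by (simp only: mem_Collect_eq mem_ball_0) blast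
next
  assume "z \<in> dyadic_box n k"
  then obtain r t where z: "cmod z < 1" "z = of_real r * cis t" and r: "1 / 2 ^ (n + 1) < 1 - r" "1 - r \<le> 1 / 2 ^ n"
    and t: "real k / 2 ^ n \<le> t / (2 * pi)" "t / (2 * pi) < (real k + 1) / 2 ^ n"
    unfolding dyadic_box_def by auto
  have p1: "(1::real) / 2 ^ n \<le> 1"
    by simp
  then have r0: "0 \<le> r"
    using r by linarith
  have norm: "cmod z = r"
    using r0 by (simp add: z norm_mult)
  have t0: "0 \<le> t"
  proof -
    have "0 \<le> t / (2 * pi)"
      using t(1) by (rule order_trans[rotated]) simp
    then show ?thesis
      using pi_gt_zero by (auto simp: zero_le_divide_iff)
  qed
  have t1: "t < 2 * pi"
  proof -
    have "real k + 1 \<le> 2 ^ n"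
      using k by (metis Suc_eq_plus1 Suc_leI of_nat_1 of_nat_add of_nat_le_iff of_nat_numeral of_nat_power)
    then have "(real k + 1) / 2 ^ n \<le> 1"
      by simp
    then have "t / (2 * pi) < 1"
      using t(2) by linarith
    then show ?thesis
      by simp
  qed
  show "?R z"
  proof (cases "r = 0")
    case True
    have "n = 0"
    proof (rule ccontr)
      assume "n \<noteq> 0"
      then have "(2::real) ^ 1 \<le> 2 ^ n"
        by (intro power_increasing) auto
      moreover have "(2::real) ^ n \<le> 1"
        using r(2) True by (simp add: field_simps)
      ultimately show False
        by simp
    qed
    then show ?thesis
      using True k z by simp
  next
    case False
    then have "Arg2pi z = t"
      using r0 t0 t1 by (intro Arg2pi_unique[of r]) (auto simp: z cis_conv_exp)
    then show ?thesis
      using norm r t z(1) by simp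
  qed
qed

text \<open>\<open>Arg2pi\<close> jumps across the positive real axis, hence the two pieces: the
  closed upper half-plane without 0, and the open lower half-plane. Both indicators vanish at 0, in
  accordance with \<open>Arg2pi 0 = 0\<close>.\<close>

lemma borel_measurable_Arg2pi: "Arg2pi \<in> borel_measurable borel"
proof -
  let ?U = "{z. 0 \<le> Im z} - {0::complex}" and ?L = "{z. Im z < 0}"
  have U: "?U \<in> sets borel" and L: "?L \<in> sets borel"
    by (auto intro!: sets.Diff borel_closed borel_open closed_halfspace_Im_ge open_halfspace_Im_lt)
  have "continuous_on ?L Arg2pi"
    by (intro continuous_at_imp_continuous_on ballI continuous_at_Arg2pi) (auto simp: nonneg_Reals_def)
  then have "(\<lambda>z. indicator ?U z *\<^sub>R Arg2pi z + indicator ?L z *\<^sub>R Arg2pi z) \<in> borel_measurable borel"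
    using continuous_on_upperhalf_Arg2pi U L
    by (intro borel_measurable_add borel_measurable_continuous_on_indicator)
  also have "(\<lambda>z. indicator ?U z *\<^sub>R Arg2pi z + indicator ?L z *\<^sub>R Arg2pi z) = Arg2pi"
    by (auto simp: indicator_def fun_eq_iff)
  finally show ?thesis .
qed

lemma dyadic_box_borel:
  assumes "k < 2 ^ n"
  shows "dyadic_box n k \<in> sets borel"
proof -
  note borel_measurable_Arg2pi[measurable]
  have "dyadic_box n k = {z \<in> space borel. cmod z < 1 \<and> 1 / 2 ^ (n + 1) < 1 - cmod z \<and> 1 - cmod z \<le> 1 / 2 ^ n \<and>
    real k / 2 ^ n \<le> Arg2pi z / (2 * pi) \<and> Arg2pi z / (2 * pi) < (real k + 1) / 2 ^ n}"
    using dyadic_box_iff[OF assms] by auto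
  also have "\<dots> \<in> sets borel"
    by measurable
  finally show ?thesis .
qed

lemma dyadic_box_subset: "dyadic_box n k \<subseteq> ball 0 1"
  by (auto simp: dyadic_box_def)

lemma power_half_interval_unique:
  fixes x :: real
  assumes "1 / 2 ^ (n + 1) < x" "x \<le> 1 / 2 ^ n" "1 / 2 ^ (m + 1) < x" "x \<le> 1 / 2 ^ m"
  shows "n = m"
proof (rule ccontr)
  have *: False if "a < b" "1 / 2 ^ (a + 1) < x" "x \<le> 1 / 2 ^ b" for a b
  proof -
    have "(2::real) ^ (a + 1) \<le> 2 ^ b"
      using that(1) by (intro power_increasing) auto
    then have "(1::real) / 2 ^ b \<le> 1 / 2 ^ (a + 1)"
      by (intro divide_left_mono) auto
    then show False
      using that by linarith
  qed
  assume "n \<noteq> m"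
  then show False
    using *[of n m] *[of m n] assms by (cases "n < m") auto
qed

lemma dyadic_box_disjoint:
  assumes "k < 2 ^ n" "j < 2 ^ m" "(n, k) \<noteq> (m, j)"
  shows "dyadic_box n k \<inter> dyadic_box m j = {}"
proof (rule ccontr)
  assume "dyadic_box n k \<inter> dyadic_box m j \<noteq> {}"
  then obtain z where z: "z \<in> dyadic_box n k" "z \<in> dyadic_box m j"
    by blast
  have "n = m"
    using z[unfolded dyadic_box_iff[OF assms(1)] dyadic_box_iff[OF assms(2)]]
    by (intro power_half_interval_unique[of n "1 - cmod z" m]) auto
  moreover have "real k < real j + 1" "real j < real k + 1"
  proof -
    have "real k / 2 ^ n < (real j + 1) / 2 ^ n" "real j / 2 ^ n < (real k + 1) / 2 ^ n"
      using z[unfolded dyadic_box_iff[OF assms(1)] dyadic_box_iff[OF assms(2)]] \<open>n = m\<close>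
      by (auto intro: le_less_trans)
    then show "real k < real j + 1" "real j < real k + 1"
      by (simp_all add: divide_less_cancel)
  qed
  ultimately show False
    using assms(3) by auto
qed

lemma dyadic_box_cover:
  assumes "cmod z < 1"
  shows "\<exists>n k. k < 2 ^ n \<and> z \<in> dyadic_box n k"
proof -
  obtain N where N: "(1 / 2) ^ N < 1 - cmod z"
    using real_arch_pow_inv[of "1 - cmod z" "1 / 2"] assms by auto
  define P where "P n \<longleftrightarrow> 1 / 2 ^ (n + 1) < 1 - cmod z" for n
  have "(1 / 2 :: real) ^ (N + 1) \<le> (1 / 2) ^ N"
    by (intro power_decreasing) auto
  then have "P N"
    using N unfolding P_def by (simp add: power_one_over)
  \<comment> \<open>Minimality yields the upper bound for 1 - |z|, which is trivial when n =
    0.\<close>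
  define n where "n = (LEAST n. P n)"
  have Pn: "P n"
    unfolding n_def using \<open>P N\<close> by (rule LeastI)
  have up: "1 - cmod z \<le> 1 / 2 ^ n"
  proof (cases n)
    case (Suc m)
    then have "\<not> P m"
      using not_less_Least[of m P] by (simp add: n_def)
    then show ?thesis
      using Suc by (simp add: P_def)
  qed simp
  define x where "x = Arg2pi z / (2 * pi) * 2 ^ n"
  have "Arg2pi z / (2 * pi) < 1"
    using Arg2pi_lt_2pi[of z] by simp
  then have x: "0 \<le> x" "x < 2 ^ n"
    using Arg2pi_ge_0[of z] mult_strict_right_mono[of "Arg2pi z / (2 * pi)" 1 "2 ^ n"]
    unfolding x_def by auto
  define k where "k = nat \<lfloor>x\<rfloor>"
  have k: "real k \<le> x" "x < real k + 1"
    using x(1) unfolding k_def by linarith+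
  have kn: "k < 2 ^ n"
  proof -
    have "real k < 2 ^ n"
      using k x by linarith
    then show ?thesis
      by (metis of_nat_less_iff of_nat_numeral of_nat_power)
  qed
  have "z \<in> dyadic_box n k"
    unfolding dyadic_box_iff[OF kn] using assms Pn up k
    by (auto simp: P_def x_def divide_le_eq less_divide_eq)
  with kn show ?thesis
    by blast
qed

section \<open>Moving box points to box centres\<close>

lemma dyadic_box_subset_cball: "dyadic_box n k \<subseteq> cball 0 (1 - 1 / 2 ^ (n + 1))"
proof
  fix z assume "z \<in> dyadic_box n k"
  then obtain r t where z: "z = of_real r * cis t" "1 / 2 ^ (n + 1) < 1 - r" "1 - r \<le> 1 / 2 ^ n"
    unfolding dyadic_box_def by auto
  have "(1::real) / 2 ^ n \<le> 1"
    by simp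
  then have "0 \<le> r"
    using z by linarith
  then show "z \<in> cball 0 (1 - 1 / 2 ^ (n + 1))"
    using z by (simp add: norm_mult)
qed

text \<open>A corner rather than the midpoint: outer radius and smallest angle of the box. Only its
  modulus and its distance to the points of the box matter.\<close>

definition box_centre :: "nat \<times> nat \<Rightarrow> complex"
  where "box_centre i = of_real (1 - 1 / 2 ^ (fst i + 1)) * cis (2 * pi * real (snd i) / 2 ^ fst i)"

lemma inverse_two_power_le_1: "(1::real) / 2 ^ (n + 1) \<le> 1"
  using power_le_one[of "1 / 2 :: real" "n + 1"] by (simp add: power_one_over)

lemma norm_box_centre: "cmod (box_centre i) = 1 - 1 / 2 ^ (fst i + 1)"
  using inverse_two_power_le_1[of "fst i"]
  by (simp only: box_centre_def norm_mult norm_cis norm_of_real) simp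

lemma norm_box_centre_less_1: "cmod (box_centre i) < 1"
  unfolding norm_box_centre by simp

text \<open>In units of 1 / 2 ^ n the radial part contributes at most 1 and the angular part at most
  2 * pi < 7. The closed conditions also admit the outer arc of the box, over which an integral is
  taken later.\<close>

lemma polar_dist_box_centre_le:
  assumes "1 / 2 ^ (n + 1) \<le> 1 - r" "1 - r \<le> 1 / 2 ^ n"
    and "2 * pi * real k / 2 ^ n \<le> t" "t \<le> 2 * pi * (real k + 1) / 2 ^ n"
  shows "cmod (of_real r * cis t - box_centre (n, k)) \<le> 8 / 2 ^ n"
proof -
  define s where "s = 2 * pi * real k / 2 ^ n"
  define \<rho> :: real where "\<rho> = 1 - 1 / 2 ^ (n + 1)"
  have \<rho>: "0 \<le> \<rho>" "\<rho> \<le> 1"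
    using inverse_two_power_le_1[of n] by (simp_all add: \<rho>_def)
  have "of_real r * cis t - box_centre (n, k) = of_real (r - \<rho>) * cis t + of_real \<rho> * (cis t - cis s)"
    by (simp add: box_centre_def s_def \<rho>_def algebra_simps)
  then have "cmod (of_real r * cis t - box_centre (n, k)) \<le> \<bar>r - \<rho>\<bar> + \<rho> * cmod (cis t - cis s)"
    using \<rho> by (metis abs_of_nonneg norm_cis norm_mult norm_of_real norm_triangle_ineq mult.right_neutral)
  also have "\<dots> \<le> 1 / 2 ^ n + 1 * \<bar>t - s\<bar>"
  proof (intro add_mono mult_mono norm_cis_diff_le)
    show "\<bar>r - \<rho>\<bar> \<le> 1 / 2 ^ n"
    proof -
      define h :: real where "h = 1 / 2 ^ (n + 1)"
      have "h \<le> 1 - r" "1 - r \<le> 2 * h" "0 \<le> h"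
        using assms(1,2) by (simp_all add: h_def)
      then have "\<bar>r - (1 - h)\<bar> \<le> 2 * h"
        by linarith
      then show ?thesis
        by (simp add: \<rho>_def h_def)
    qed
  qed (use \<rho> in auto)
  also have "\<bar>t - s\<bar> \<le> 2 * pi / 2 ^ n"
  proof -
    have "2 * pi * (real k + 1) / 2 ^ n = s + 2 * pi / 2 ^ n"
      by (simp add: s_def algebra_simps add_divide_distrib)
    then show ?thesis
      using assms(3,4) by (simp add: s_def)
  qed
  also have "2 * pi / 2 ^ n \<le> 7 / 2 ^ n"
    using pi_less_4 pi_approx by (intro divide_right_mono) auto
  finally show ?thesis
    by (simp add: add_divide_distrib[symmetric])
qed

lemma dyadic_box_dist_centre_le:
  assumes "z \<in> dyadic_box n k"
  shows "cmod (z - box_centre (n, k)) \<le> 8 / 2 ^ n"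
proof -
  obtain r t where z: "z = of_real r * cis t" and r: "1 / 2 ^ (n + 1) < 1 - r" "1 - r \<le> 1 / 2 ^ n"
    and t: "real k / 2 ^ n \<le> t / (2 * pi)" "t / (2 * pi) < (real k + 1) / 2 ^ n"
    using assms unfolding dyadic_box_def by auto
  show ?thesis
    unfolding z
  proof (rule polar_dist_box_centre_le)
    show "2 * pi * real k / 2 ^ n \<le> t" "t \<le> 2 * pi * (real k + 1) / 2 ^ n"
      using t by (simp_all add: field_simps)
  qed (use r in auto)
qed

text \<open>The displacement 8 / 2 ^ n is 16 times 1 / 2 ^ (n + 1), which is at most 1 - |z| and
  hence at most |1 - cnj z * w|; so 17 = 1 + 16.\<close>

lemma norm_one_minus_cnj_compare:
  assumes "cmod z \<le> 1 - 1 / 2 ^ (n + 1)" "cmod w < 1" "cmod (z - c) \<le> 8 / 2 ^ n"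
  shows "cmod (1 - cnj c * w) \<le> 17 * cmod (1 - cnj z * w)"
proof -
  have pos: "(0::real) < 1 / 2 ^ (n + 1)"
    by simp
  have z: "cmod z < 1"
    using assms(1) pos by linarith
  have "cmod (1 - cnj c * w) = cmod ((1 - cnj z * w) + cnj (z - c) * w)"
    by (simp add: algebra_simps)
  also have "\<dots> \<le> cmod (1 - cnj z * w) + cmod (cnj (z - c) * w)"
    by (rule norm_triangle_ineq)
  also have "cmod (cnj (z - c) * w) = cmod (z - c) * cmod w"
    by (simp only: norm_mult complex_mod_cnj)
  also have "\<dots> \<le> 8 / 2 ^ n * 1"
    using assms by (intro mult_mono) auto
  also have "8 / 2 ^ n * 1 = 16 * (1 / 2 ^ (n + 1) :: real)"
    by simp
  also have "1 / 2 ^ (n + 1) \<le> cmod (1 - cnj z * w)"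
    using norm_one_minus_cnj_mult_ge(1)[OF z assms(2)] assms(1) by linarith
  finally show ?thesis
    by simp
qed

text \<open>A bound for the overlap of any two points of the two boxes. The 4 comes from 1 - |z|^2
  \<le> 2 / 2 ^ n in each variable, and 289 = 17^2 from moving both points to the centres.\<close>

definition box_overlap :: "nat \<times> nat \<Rightarrow> nat \<times> nat \<Rightarrow> real"
  where "box_overlap i j = 4 * (289\<^sup>2 / (2 ^ fst i * 2 ^ fst j * (cmod (1 - cnj (box_centre i) * box_centre j))\<^sup>2))"

lemma norm_one_minus_cnj_commute: "cmod (1 - cnj z * w) = cmod (1 - cnj w * z)"
proof -
  have "cnj (1 - cnj z * w) = 1 - cnj w * z"
    by simp
  then show ?thesis
    by (metis complex_mod_cnj)
qed

lemma box_overlap_commute: "box_overlap i j = box_overlap j i"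
  unfolding box_overlap_def by (subst norm_one_minus_cnj_commute) (simp only: mult_ac)

lemma box_overlap_nonneg: "0 \<le> box_overlap i j"
  by (simp add: box_overlap_def)

lemma szego_overlap_le_box_overlap:
  assumes z: "z \<in> dyadic_box n k" and w: "w \<in> dyadic_box m j"
  shows "szego_overlap z w \<le> box_overlap (n, k) (m, j)"
proof -
  define c d where "c = box_centre (n, k)" and "d = box_centre (m, j)"
  have zn: "cmod z \<le> 1 - 1 / 2 ^ (n + 1)" "cmod w \<le> 1 - 1 / 2 ^ (m + 1)"
    using z w dyadic_box_subset_cball by fastforce+
  have z1: "cmod z < 1" "cmod w < 1" "cmod c < 1" "cmod d < 1"
    using z w dyadic_box_subset norm_box_centre_less_1 by (fastforce simp: c_def d_def)+
  have sq: "1 - (cmod u)\<^sup>2 \<le> 2 / 2 ^ l" if "u \<in> dyadic_box l i" for u l i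
  proof -
    obtain r t where u: "u = of_real r * cis t" "1 - r \<le> 1 / 2 ^ l" "1 / 2 ^ (l + 1) < 1 - r"
      using \<open>u \<in> dyadic_box l i\<close> unfolding dyadic_box_def by auto
    have "(1::real) / 2 ^ l \<le> 1" "(0::real) < 1 / 2 ^ (l + 1)"
      by simp_all
    then have r: "0 \<le> r" "r \<le> 1"
      using u by linarith+
    have "1 - (cmod u)\<^sup>2 = (1 - r) * (1 + r)"
      using r by (simp add: u norm_mult power2_eq_square algebra_simps)
    also have "\<dots> \<le> 1 / 2 ^ l * 2"
      using u r by (intro mult_mono) auto
    finally show ?thesis
      by simp
  qed
  have "cmod (1 - cnj c * d) \<le> 17 * cmod (1 - cnj d * z)"
    using norm_one_minus_cnj_compare[OF zn(1) z1(4), of c] dyadic_box_dist_centre_le[OF z]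
    by (simp only: c_def norm_one_minus_cnj_commute[of z d])
  also have "\<dots> \<le> 17 * (17 * cmod (1 - cnj w * z))"
    using norm_one_minus_cnj_compare[OF zn(2) z1(1), of d] dyadic_box_dist_centre_le[OF w]
    by (intro mult_left_mono) (auto simp: d_def)
  also have "cmod (1 - cnj w * z) = cmod (1 - cnj z * w)"
    by (rule norm_one_minus_cnj_commute)
  finally have le: "cmod (1 - cnj c * d) \<le> 289 * cmod (1 - cnj z * w)"
    by simp
  have p1: "0 < cmod (1 - cnj z * w)" "0 < cmod (1 - cnj c * d)"
    using one_minus_cnj_mult_nonzero z1 by simp_all
  have "1 / (cmod (1 - cnj z * w))\<^sup>2 \<le> 289\<^sup>2 / (cmod (1 - cnj c * d))\<^sup>2"
  proof -
    have "(cmod (1 - cnj c * d))\<^sup>2 \<le> 289\<^sup>2 * (cmod (1 - cnj z * w))\<^sup>2"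
      using power_mono[OF le, of 2] by (simp add: power_mult_distrib)
    then show ?thesis
      using p1 by (simp add: divide_simps mult.commute)
  qed
  then have "szego_overlap z w \<le> (2 / 2 ^ n) * (2 / 2 ^ m) * (289\<^sup>2 / (cmod (1 - cnj c * d))\<^sup>2)"
    unfolding szego_overlap_def divide_inverse[of "(1 - (cmod z)\<^sup>2) * (1 - (cmod w)\<^sup>2)"]
    using sq[OF z] sq[OF w] one_minus_norm_square_pos[OF z1(1)] one_minus_norm_square_pos[OF z1(2)]
    by (intro mult_mono) (auto simp: divide_inverse)
  also have "\<dots> = box_overlap (n, k) (m, j)"
    unfolding box_overlap_def c_def d_def by simp
  finally show ?thesis .
qed

section \<open>Sums over one generation of boxes\<close>

lemma sum_integral_arcs:
  fixes f :: "real \<Rightarrow> real"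
  assumes "continuous_on {0..real N * h} f" "0 \<le> h"
  shows "(\<Sum>k<N. integral {real k * h..real (Suc k) * h} f) = integral {0..real N * h} f"
  using assms
proof (induction N)
  case (Suc N)
  have "real N * h \<le> real (Suc N) * h"
    using Suc by (intro mult_right_mono) auto
  moreover have "0 \<le> real N * h"
    using Suc by simp
  moreover have "continuous_on {0..real N * h} f"
    using Suc.prems(1) by (rule continuous_on_subset) (use \<open>real N * h \<le> real (Suc N) * h\<close> in auto)
  ultimately show ?case
    using Suc integrable_continuous_interval[OF Suc.prems(1)]
    by (simp add: Henstock_Kurzweil_Integration.integral_combine del: of_nat_Suc)
qed simp

text \<open>Each summand is comparable to the mean over the arc below the box, and the integral over the
  whole circle is an instance of Poisson's formula.\<close>

lemma sum_inverse_square_centres_le: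
  assumes x: "cmod x < 1"
  shows "(\<Sum>k<2 ^ n. 1 / (cmod (1 - cnj (box_centre (n, k)) * x))\<^sup>2) \<le>
    289 * 2 ^ n / (1 - (cmod ((1 - 1 / 2 ^ (n + 1)) * x))\<^sup>2)"
proof -
  define \<rho> :: real where "\<rho> = 1 - 1 / 2 ^ (n + 1)"
  define h where "h = 2 * pi / 2 ^ n"
  define f where "f t = 1 / (cmod (1 - (of_real \<rho> * cnj x) * cis t))\<^sup>2" for t
  have \<rho>: "0 \<le> \<rho>" "\<rho> < 1"
    using inverse_two_power_le_1[of n] by (simp_all add: \<rho>_def)
  have h: "0 < h" "real (2 ^ n) * h = 2 * pi"
    by (simp_all add: h_def)
  have \<rho>x: "cmod (of_real \<rho> * cnj x) < 1"
  proof -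
    have "\<rho> * cmod x \<le> 1 * cmod x"
      using \<rho> by (intro mult_right_mono) auto
    then show ?thesis
      using \<rho> x by (simp add: norm_mult)
  qed
  have fx: "f t = 1 / (cmod (1 - cnj (of_real \<rho> * cis t) * x))\<^sup>2" for t
  proof -
    have "1 - (of_real \<rho> * cnj x) * cis t = 1 - cnj x * (of_real \<rho> * cis t)"
      by simp
    then show ?thesis
      unfolding f_def by (simp only: norm_one_minus_cnj_commute[of x])
  qed
  have int: "(f has_integral 2 * pi / (1 - (cmod (of_real \<rho> * cnj x))\<^sup>2)) {0..2 * pi}"
    unfolding f_def by (rule poisson_kernel_integral[OF \<rho>x])
  have cont: "continuous_on S f" for S
  proof -
    have "1 - (of_real \<rho> * cnj x) * cis t \<noteq> 0" for t
    proof
      assume "1 - (of_real \<rho> * cnj x) * cis t = 0"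
      then have "cmod ((of_real \<rho> * cnj x) * cis t) = 1"
        by (metis eq_iff_diff_eq_0 norm_one)
      then show False
        using \<rho>x by (simp only: norm_mult norm_cis mult_1_right)
    qed
    then show ?thesis
      unfolding f_def by (intro continuous_intros) auto
  qed
  \<comment> \<open>Here 289 arises as the square of a single factor 17: one point moves between the
    centre and the arc, and the modulus is squared.\<close>
  have arc: "h * (1 / (cmod (1 - cnj (box_centre (n, k)) * x))\<^sup>2) \<le> 289 * integral {real k * h..real (Suc k) * h} f" for k
  proof -
    define c where "c = box_centre (n, k)"
    have kh: "real k * h \<le> real (Suc k) * h"
      using h by (intro mult_right_mono) auto
    have "((\<lambda>_. 1 / (289 * (cmod (1 - cnj c * x))\<^sup>2)) has_integral
        (real (Suc k) * h - real k * h) *\<^sub>R (1 / (289 * (cmod (1 - cnj c * x))\<^sup>2))) {real k * h..real (Suc k) * h}"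
      using has_integral_const_real[of "1 / (289 * (cmod (1 - cnj c * x))\<^sup>2)" "real k * h" "real (Suc k) * h"] kh
      by simp
    then have "(real (Suc k) * h - real k * h) *\<^sub>R (1 / (289 * (cmod (1 - cnj c * x))\<^sup>2)) \<le>
        integral {real k * h..real (Suc k) * h} f"
    proof (rule has_integral_le[OF _ integrable_integral[OF integrable_continuous_interval[OF cont]]])
      fix t assume t: "t \<in> {real k * h..real (Suc k) * h}"
      define u where "u = of_real \<rho> * cis t"
      have "cmod (u - c) \<le> 8 / 2 ^ n"
        unfolding u_def c_def
      proof (rule polar_dist_box_centre_le)
        show "2 * pi * real k / 2 ^ n \<le> t" "t \<le> 2 * pi * (real k + 1) / 2 ^ n"
          using t by (simp_all add: h_def field_simps)
      qed (simp_all add: \<rho>_def field_simps)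
      then have "cmod (1 - cnj u * x) \<le> 17 * cmod (1 - cnj c * x)"
        using x norm_box_centre[of "(n, k)"]
        by (intro norm_one_minus_cnj_compare[of c n x u]) (auto simp: c_def norm_minus_commute)
      then have "(cmod (1 - cnj u * x))\<^sup>2 \<le> (17 * cmod (1 - cnj c * x))\<^sup>2"
        by (intro power_mono) auto
      moreover have "cmod u < 1"
        using \<rho> by (simp add: u_def norm_mult)
      ultimately show "1 / (289 * (cmod (1 - cnj c * x))\<^sup>2) \<le> f t"
        unfolding fx u_def[symmetric]
        using one_minus_cnj_mult_nonzero[of u x] one_minus_cnj_mult_nonzero[of c x] norm_box_centre_less_1[of "(n, k)"] x
        by (intro divide_left_mono mult_pos_pos) (auto simp: power_mult_distrib c_def)
    qed
    then show ?thesis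
      unfolding c_def by (simp add: algebra_simps)
  qed
  have "h * (\<Sum>k<2 ^ n. 1 / (cmod (1 - cnj (box_centre (n, k)) * x))\<^sup>2) \<le>
      (\<Sum>k<2 ^ n. 289 * integral {real k * h..real (Suc k) * h} f)"
    unfolding sum_distrib_left by (intro sum_mono arc)
  also have "\<dots> = 289 * integral {0..real (2 ^ n) * h} f"
    unfolding sum_distrib_left[symmetric] using h by (subst sum_integral_arcs[OF cont]) auto
  also have "\<dots> = 289 * (2 * pi / (1 - (cmod (of_real \<rho> * cnj x))\<^sup>2))"
    unfolding h(2) by (simp only: integral_unique[OF int])
  also have "\<dots> = h * (289 * 2 ^ n / (1 - (cmod (of_real \<rho> * cnj x))\<^sup>2))"
    by (simp add: h_def)
  finally have "(\<Sum>k<2 ^ n. 1 / (cmod (1 - cnj (box_centre (n, k)) * x))\<^sup>2) \<le>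
      289 * 2 ^ n / (1 - (cmod (of_real \<rho> * cnj x))\<^sup>2)"
    using h(1) by (simp only: mult_le_cancel_left_pos)
  moreover have "cmod (of_real \<rho> * cnj x) = cmod ((1 - 1 / 2 ^ (n + 1)) * x)"
    by (simp add: \<rho>_def norm_mult)
  ultimately show ?thesis
    by simp
qed

text \<open>The denominator left by the circle integral is at least 1 / 2 ^ (n + 1) and at least 1 /
  2 ^ (fst j + 1), one for each entry of the minimum. The decay for generations \<open>n\<close>
  coarser than that of \<open>j\<close> is the gain on which Schur's test rests.\<close>

lemma sum_box_overlap_le:
  "(\<Sum>k<2 ^ n. box_overlap (n, k) j) \<le> 8 * 289 ^ 3 * min 1 (2 ^ n / 2 ^ fst j)"
proof -
  define x where "x = box_centre j"
  define m where "m = fst j"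
  define \<rho> :: real where "\<rho> = 1 - 1 / 2 ^ (n + 1)"
  have x: "cmod x = 1 - 1 / 2 ^ (m + 1)" "cmod x < 1"
    using norm_box_centre norm_box_centre_less_1 by (simp_all add: x_def m_def)
  have \<rho>: "0 \<le> \<rho>" "\<rho> < 1"
    using inverse_two_power_le_1[of n] by (simp_all add: \<rho>_def)
  have norm: "cmod ((1 - 1 / 2 ^ (n + 1)) * x) = \<rho> * cmod x"
  proof -
    have "(1 - 1 / 2 ^ (n + 1)) * x = of_real \<rho> * x"
      by (simp add: \<rho>_def)
    then show ?thesis
      using \<rho> by (simp only: norm_mult norm_of_real abs_of_nonneg)
  qed
  define D where "D = 1 - (\<rho> * cmod x)\<^sup>2"
  have D: "1 / 2 ^ (n + 1) \<le> D" "1 / 2 ^ (m + 1) \<le> D"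
  proof -
    have y: "0 \<le> \<rho> * cmod x" "\<rho> * cmod x \<le> \<rho>" "\<rho> * cmod x \<le> cmod x"
      using \<rho> x(2) by (auto intro: mult_left_le mult_left_le_one_le)
    then have "\<rho> * cmod x \<le> 1"
      using \<rho> by linarith
    then have "(\<rho> * cmod x)\<^sup>2 \<le> \<rho> * cmod x"
      using y(1) by (simp add: power2_eq_square mult_left_le)
    then show "1 / 2 ^ (n + 1) \<le> D" "1 / 2 ^ (m + 1) \<le> D"
      using y x(1) unfolding D_def \<rho>_def by linarith+
  qed
  have D0: "0 < D"
    using D(1) by (rule less_le_trans[rotated]) simp
  have "(\<Sum>k<2 ^ n. box_overlap (n, k) j) =
      4 * (289\<^sup>2 / (2 ^ n * 2 ^ m)) * (\<Sum>k<2 ^ n. 1 / (cmod (1 - cnj (box_centre (n, k)) * x))\<^sup>2)"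
    unfolding box_overlap_def sum_distrib_left x_def m_def by (intro sum.cong) auto
  also have "\<dots> \<le> 4 * (289\<^sup>2 / (2 ^ n * 2 ^ m)) * (289 * 2 ^ n / D)"
    using sum_inverse_square_centres_le[OF x(2), of n] unfolding norm D_def
    by (intro mult_left_mono) auto
  also have "\<dots> = 4 * 289 ^ 3 * (1 / 2 ^ m / D)"
    by (simp add: power3_eq_cube power2_eq_square)
  also have "1 / 2 ^ m / D \<le> 2 * min 1 (2 ^ n / 2 ^ m)"
  proof -
    have "1 / 2 ^ m / D \<le> 1 / 2 ^ m / (1 / 2 ^ (m + 1))" "1 / 2 ^ m / D \<le> 1 / 2 ^ m / (1 / 2 ^ (n + 1))"
      using D D0 by (intro divide_left_mono mult_pos_pos; simp)+
    then show ?thesis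
      by (simp add: min_def)
  qed
  finally show ?thesis
    by (simp add: m_def)
qed

section \<open>Schur's test\<close>

definition box_indices :: "nat \<Rightarrow> (nat \<times> nat) set"
  where "box_indices N = (SIGMA n:{..<N}. {..<2 ^ n})"

lemma sum_box_indices:
  fixes g :: "nat \<times> nat \<Rightarrow> real"
  shows "(\<Sum>i\<in>box_indices N. g i) = (\<Sum>n<N. \<Sum>k<2 ^ n. g (n, k))"
  unfolding box_indices_def by (subst sum.Sigma) auto

text \<open>The summand is q ^ |m - n|: by truncated subtraction one of its two factors is
  1.\<close>

lemma sum_geometric_distance_le:
  fixes q :: real
  assumes q: "0 \<le> q" "q < 1"
  shows "(\<Sum>m<N. q ^ (m - n) * q ^ (n - m)) \<le> 2 / (1 - q)"
proof -
  have geo: "(\<Sum>i\<in>A. q ^ i) \<le> 1 / (1 - q)" if "finite A" for A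
    using sum_le_suminf[OF summable_geometric[of q] that] suminf_geometric[of q] q by simp
  have "(\<Sum>m<N. q ^ (m - n) * q ^ (n - m)) =
      (\<Sum>m\<in>{m. m < N \<and> m \<le> n}. q ^ (n - m)) + (\<Sum>m\<in>{m. m < N \<and> n < m}. q ^ (m - n))"
    (is "?L = _")
  proof -
    have split: "{..<N} = {m. m < N \<and> m \<le> n} \<union> {m. m < N \<and> n < m}"
      by auto
    have "?L = (\<Sum>m\<in>{m. m < N \<and> m \<le> n}. q ^ (m - n) * q ^ (n - m)) +
        (\<Sum>m\<in>{m. m < N \<and> n < m}. q ^ (m - n) * q ^ (n - m))"
      unfolding split by (rule sum.union_disjoint) auto
    then show ?thesis
      by simp
  qed
  also have "(\<Sum>m\<in>{m. m < N \<and> m \<le> n}. q ^ (n - m)) = (\<Sum>i\<in>(\<lambda>m. n - m) ` {m. m < N \<and> m \<le> n}. q ^ i)"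
    by (subst sum.reindex) (auto intro!: inj_onI)
  also have "(\<Sum>m\<in>{m. m < N \<and> n < m}. q ^ (m - n)) = (\<Sum>i\<in>(\<lambda>m. m - n) ` {m. m < N \<and> n < m}. q ^ i)"
    by (subst sum.reindex) (auto intro!: inj_onI)
  finally show ?thesis
    using geo[of "(\<lambda>m. n - m) ` {m. m < N \<and> m \<le> n}"] geo[of "(\<lambda>m. m - n) ` {m. m < N \<and> n < m}"]
    by simp
qed

text \<open>Between generations n \<le> m the row and column sums are unbalanced, of order 1 and 2 ^
  n / 2 ^ m. The weight \<open>h\<close> = 2 powr (- (m - n) / 2) in 2xy \<le> h x^2 + y^2 / h
  equalises the two contributions and survives as a decaying factor.\<close>

lemma schur_levels:
  fixes a :: "nat \<times> nat \<Rightarrow> real"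
  assumes a: "\<And>i. 0 \<le> a i" and nm: "n \<le> m"
  defines "b \<equiv> \<lambda>n. \<Sum>k<2 ^ n. (a (n, k))\<^sup>2"
  shows "(\<Sum>k<2 ^ n. \<Sum>j<2 ^ m. box_overlap (n, k) (m, j) * (a (n, k) * a (m, j))) \<le>
    4 * 289 ^ 3 * sqrt (1 / 2) ^ (m - n) * (b n + b m)"
proof -
  define K :: real where "K = 8 * 289 ^ 3"
  define h where "h = sqrt (1 / 2) ^ (m - n)"
  have h: "0 < h" "h\<^sup>2 = 2 ^ n / 2 ^ m"
  proof -
    show "0 < h"
      by (simp add: h_def)
    have "h\<^sup>2 = (1 / 2) ^ (m - n)"
      unfolding h_def by (simp add: power_mult[symmetric] mult.commute[of _ 2] power_mult real_sqrt_pow2 del: real_sqrt_divide)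
    then show "h\<^sup>2 = 2 ^ n / 2 ^ m"
      using nm by (simp add: power_one_over power_diff)
  qed
  have "(\<Sum>k<2 ^ n. \<Sum>j<2 ^ m. box_overlap (n, k) (m, j) * (a (n, k) * a (m, j))) \<le>
      (\<Sum>k<2 ^ n. \<Sum>j<2 ^ m. box_overlap (n, k) (m, j) * (1 / 2 * (h * (a (n, k))\<^sup>2 + 1 / h * (a (m, j))\<^sup>2)))"
  proof (intro sum_mono mult_left_mono box_overlap_nonneg)
    fix k j
    have "0 \<le> (h * a (n, k) - a (m, j))\<^sup>2 / h"
      using h by simp
    also have "\<dots> = h * (a (n, k))\<^sup>2 + 1 / h * (a (m, j))\<^sup>2 - 2 * (a (n, k) * a (m, j))"
      using h(1) by (simp add: power2_diff field_simps power2_eq_square)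
    finally show "a (n, k) * a (m, j) \<le> 1 / 2 * (h * (a (n, k))\<^sup>2 + 1 / h * (a (m, j))\<^sup>2)"
      by simp
  qed
  also have "\<dots> = 1 / 2 * h * (\<Sum>k<2 ^ n. (a (n, k))\<^sup>2 * (\<Sum>j<2 ^ m. box_overlap (n, k) (m, j))) +
      1 / 2 * (1 / h) * (\<Sum>k<2 ^ n. \<Sum>j<2 ^ m. (a (m, j))\<^sup>2 * box_overlap (n, k) (m, j))"
    by (simp add: sum_distrib_left algebra_simps sum.distrib add_divide_distrib)
  also have "(\<Sum>k<2 ^ n. \<Sum>j<2 ^ m. (a (m, j))\<^sup>2 * box_overlap (n, k) (m, j)) =
      (\<Sum>j<2 ^ m. (a (m, j))\<^sup>2 * (\<Sum>k<2 ^ n. box_overlap (n, k) (m, j)))"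
    by (subst sum.swap) (simp only: sum_distrib_left)
  also have "1 / 2 * h * (\<Sum>k<2 ^ n. (a (n, k))\<^sup>2 * (\<Sum>j<2 ^ m. box_overlap (n, k) (m, j))) +
      1 / 2 * (1 / h) * (\<Sum>j<2 ^ m. (a (m, j))\<^sup>2 * (\<Sum>k<2 ^ n. box_overlap (n, k) (m, j))) \<le>
      1 / 2 * h * (\<Sum>k<2 ^ n. (a (n, k))\<^sup>2 * K) + 1 / 2 * (1 / h) * (\<Sum>j<2 ^ m. (a (m, j))\<^sup>2 * (K * h\<^sup>2))"
  proof (intro add_mono mult_left_mono sum_mono)
    fix k
    have "(\<Sum>j<2 ^ m. box_overlap (m, j) (n, k)) \<le> K * min 1 (2 ^ m / 2 ^ n)"
      using sum_box_overlap_le[of m "(n, k)"] by (simp add: K_def)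
    also have "\<dots> \<le> K * 1"
      by (intro mult_left_mono) (auto simp: K_def)
    finally show "(\<Sum>j<2 ^ m. box_overlap (n, k) (m, j)) \<le> K"
      by (simp add: box_overlap_commute[of "(n, k)"])
  next
    fix j
    have "(\<Sum>k<2 ^ n. box_overlap (n, k) (m, j)) \<le> K * min 1 (2 ^ n / 2 ^ m)"
      using sum_box_overlap_le[of n "(m, j)"] by (simp add: K_def)
    also have "\<dots> \<le> K * h\<^sup>2"
      unfolding h by (intro mult_left_mono) (auto simp: K_def)
    finally show "(\<Sum>k<2 ^ n. box_overlap (n, k) (m, j)) \<le> K * h\<^sup>2" .
  qed (use h in auto)
  also have "\<dots> = 1 / 2 * K * h * (b n + b m)"
    using h(1) by (simp add: b_def sum_distrib_left[symmetric] sum_distrib_right[symmetric] power2_eq_square algebra_simps)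
  finally show ?thesis
    by (simp add: K_def h_def)
qed

text \<open>Schur's test with the weights \<open>2 powr (- n / 2)\<close> on the boxes of generation \<open>n\<close>.\<close>

lemma schur_test_boxes:
  fixes a :: "nat \<times> nat \<Rightarrow> real"
  assumes a: "\<And>i. 0 \<le> a i" and B: "\<And>N. (\<Sum>n<N. \<Sum>k<2 ^ n. (a (n, k))\<^sup>2) \<le> B"
  shows "(\<Sum>i\<in>box_indices N. \<Sum>j\<in>box_indices N. box_overlap i j * (a i * a j)) \<le>
    8 * 289 ^ 3 * (2 / (1 - sqrt (1 / 2))) * B"
proof -
  define b where "b n = (\<Sum>k<2 ^ n. (a (n, k))\<^sup>2)" for n
  define q where "q = sqrt (1 / 2)"
  define s where "s n m = q ^ (m - n) * q ^ (n - m)" for n m :: nat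
  have q: "0 \<le> q" "q < 1"
    by (simp_all add: q_def)
  have s_sym: "s n m = s m n" for n m
    by (simp add: s_def mult.commute)
  have b0: "0 \<le> b n" for n
    by (simp add: b_def sum_nonneg)
  have lev: "(\<Sum>k<2 ^ n. \<Sum>j<2 ^ m. box_overlap (n, k) (m, j) * (a (n, k) * a (m, j))) \<le>
      4 * 289 ^ 3 * s n m * (b n + b m)" (is "?L n m \<le> _") for n m
  proof (cases "n \<le> m")
    case True
    then show ?thesis
      using schur_levels[of a, OF a True] by (simp add: s_def b_def q_def)
  next
    case False
    then have "m \<le> n" by simp
    have "?L n m = ?L m n"
      by (subst sum.swap) (simp add: box_overlap_commute mult.commute)
    also have "\<dots> \<le> 4 * 289 ^ 3 * s m n * (b m + b n)"
      using schur_levels[of a, OF a \<open>m \<le> n\<close>] \<open>m \<le> n\<close> by (simp add: s_def b_def q_def)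
    finally show ?thesis
      by (simp only: s_sym add.commute)
  qed
  have "(\<Sum>i\<in>box_indices N. \<Sum>j\<in>box_indices N. box_overlap i j * (a i * a j)) =
      (\<Sum>n<N. \<Sum>k<2 ^ n. \<Sum>m<N. \<Sum>j<2 ^ m. box_overlap (n, k) (m, j) * (a (n, k) * a (m, j)))"
    by (simp only: sum_box_indices)
  also have "\<dots> = (\<Sum>n<N. \<Sum>m<N. ?L n m)"
    by (intro sum.cong refl sum.swap)
  also have "\<dots> \<le> (\<Sum>n<N. \<Sum>m<N. 4 * 289 ^ 3 * s n m * (b n + b m))"
    by (intro sum_mono lev)
  also have "\<dots> = 4 * 289 ^ 3 * ((\<Sum>n<N. \<Sum>m<N. s n m * b n) + (\<Sum>n<N. \<Sum>m<N. s n m * b m))"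
    by (simp only: distrib_left sum.distrib sum_distrib_left mult.assoc)
  also have "(\<Sum>n<N. \<Sum>m<N. s n m * b m) = (\<Sum>n<N. \<Sum>m<N. s n m * b n)"
    by (subst sum.swap) (simp only: s_sym)
  also have "(\<Sum>n<N. \<Sum>m<N. s n m * b n) = (\<Sum>n<N. (\<Sum>m<N. s n m) * b n)"
    by (simp only: sum_distrib_right)
  also have "\<dots> \<le> (\<Sum>n<N. 2 / (1 - q) * b n)"
    unfolding s_def by (intro sum_mono mult_right_mono b0 sum_geometric_distance_le q)
  also have "\<dots> = 2 / (1 - q) * (\<Sum>n<N. b n)"
    by (simp only: sum_distrib_left)
  also have "\<dots> \<le> 2 / (1 - q) * B"
    using q B[of N] by (intro mult_left_mono) (auto simp: b_def)
  finally show ?thesis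
    by (simp add: q_def)
qed

section \<open>Poisson variables and pairwise independent events\<close>

context prob_space
begin

section \<open>Moments of Poisson counts\<close>

lemma poisson_variable_measurable:
  "poisson_variable M X m \<Longrightarrow> X \<in> measurable M (count_space UNIV)"
  by (simp add: poisson_variable_def)

lemma poisson_variable_prob:
  assumes "poisson_variable M X (ennreal m)" "0 \<le> m"
  shows "prob {\<omega> \<in> space M. X \<omega> = enat k} = exp (- m) * m ^ k / fact k"
  using assms by (simp add: poisson_variable_def)

lemma poisson_weights_sums: "(\<lambda>k. exp (- m) * m ^ k / fact k) sums (1::real)"
proof -
  have "(\<lambda>k. exp (- m) * (m ^ k /\<^sub>R fact k)) sums (exp (- m) * exp m)"
    by (intro sums_mult exp_converges)
  then show ?thesis
    by (simp add: exp_minus field_simps)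
qed

lemma poisson_variable_AE_finite:
  assumes "poisson_variable M X (ennreal m)" "0 \<le> m"
  shows "AE \<omega> in M. X \<omega> \<noteq> \<infinity>"
proof -
  note [measurable] = poisson_variable_measurable[OF assms(1)]
  let ?E = "\<lambda>k. {\<omega> \<in> space M. X \<omega> = enat k}"
  have ev: "?E k \<in> events" for k
    by measurable
  have "(\<lambda>k. prob (?E k)) sums prob (\<Union>k. ?E k)"
    by (intro finite_measure_UNION) (use ev in \<open>auto simp: disjoint_family_on_def\<close>)
  moreover have "(\<lambda>k. prob (?E k)) sums 1"
    using poisson_weights_sums[of m] by (simp add: poisson_variable_prob[OF assms])
  ultimately have "prob (\<Union>k. ?E k) = 1"
    by (rule sums_unique2)
  then have "AE \<omega> in M. \<omega> \<in> (\<Union>k. ?E k)"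
    using ev by (intro AE_prob_1) auto
  then show ?thesis
    by eventually_elim auto
qed

lemma poisson_count_AE_finite:
  assumes "poisson_variable M (\<lambda>\<omega>. count_points (S \<omega>)) (ennreal m)" "0 \<le> m"
  shows "AE \<omega> in M. finite (S \<omega>)"
  using poisson_variable_AE_finite[OF assms]
  by eventually_elim (auto simp: count_points_def split: if_splits)

lemma measurable_card_count_points:
  assumes "(\<lambda>\<omega>. count_points (S \<omega>)) \<in> measurable M (count_space UNIV)"
  shows "(\<lambda>\<omega>. card (S \<omega>)) \<in> measurable M (count_space UNIV)"
proof -
  have "(\<lambda>\<omega>. case count_points (S \<omega>) of enat n \<Rightarrow> n | \<infinity> \<Rightarrow> 0) \<in> measurable M (count_space UNIV)"
    by (rule measurable_compose[OF assms]) simp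
  also have "(\<lambda>\<omega>. case count_points (S \<omega>) of enat n \<Rightarrow> n | \<infinity> \<Rightarrow> 0) = (\<lambda>\<omega>. card (S \<omega>))"
    by (auto simp: count_points_def fun_eq_iff)
  finally show ?thesis .
qed

text \<open>An infinite set has \<open>card\<close> 0, so g 0 = 0 makes the expansion over the
  finite values of the count an identity at every sample point, without an exceptional null
  set.\<close>

lemma poisson_count_nn_integral:
  fixes g :: "nat \<Rightarrow> real"
  assumes P: "poisson_variable M (\<lambda>\<omega>. count_points (S \<omega>)) (ennreal m)" "0 \<le> m"
    and g: "\<And>k. 0 \<le> g k" "g 0 = 0"
    and s: "(\<lambda>k. g k * (exp (- m) * m ^ k / fact k)) sums s"
  shows "(\<integral>\<^sup>+\<omega>. ennreal (g (card (S \<omega>))) \<partial>M) = ennreal s"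
proof -
  note [measurable] = poisson_variable_measurable[OF P(1)]
  let ?E = "\<lambda>k. {\<omega> \<in> space M. count_points (S \<omega>) = enat k}"
  have "(\<integral>\<^sup>+\<omega>. ennreal (g (card (S \<omega>))) \<partial>M) = (\<integral>\<^sup>+\<omega>. (\<Sum>k. ennreal (g k) * indicator (?E k) \<omega>) \<partial>M)"
  proof (rule nn_integral_cong)
    fix \<omega> assume \<omega>: "\<omega> \<in> space M"
    have "(\<Sum>k. ennreal (g k) * indicator (?E k) \<omega>) =
        (\<Sum>k\<in>{card (S \<omega>)}. ennreal (g k) * indicator (?E k) \<omega>)"
      by (rule suminf_finite) (auto simp: count_points_def indicator_def)
    also have "\<dots> = ennreal (g (card (S \<omega>)))"
      using \<omega> g(2) by (auto simp: count_points_def indicator_def)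
    finally show "ennreal (g (card (S \<omega>))) = (\<Sum>k. ennreal (g k) * indicator (?E k) \<omega>)" ..
  qed
  also have "\<dots> = (\<Sum>k. \<integral>\<^sup>+\<omega>. ennreal (g k) * indicator (?E k) \<omega> \<partial>M)"
    by (rule nn_integral_suminf) measurable
  also have "\<dots> = (\<Sum>k. ennreal (g k * (exp (- m) * m ^ k / fact k)))"
  proof (rule suminf_cong)
    fix k
    have "?E k \<in> events"
      by measurable
    then have "(\<integral>\<^sup>+\<omega>. ennreal (g k) * indicator (?E k) \<omega> \<partial>M) = ennreal (g k) * emeasure M (?E k)"
      by (rule nn_integral_cmult_indicator)
    also have "\<dots> = ennreal (g k * (exp (- m) * m ^ k / fact k))"
      unfolding emeasure_eq_measure poisson_variable_prob[OF P] using g(1)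
      by (simp only: ennreal_mult')
    finally show "(\<integral>\<^sup>+\<omega>. ennreal (g k) * indicator (?E k) \<omega> \<partial>M) = ennreal (g k * (exp (- m) * m ^ k / fact k))" .
  qed
  also have "\<dots> = ennreal s"
    using g(1) assms(2) s by (intro suminf_ennreal_eq) auto
  finally show ?thesis .
qed

lemma poisson_count_mean:
  assumes "poisson_variable M (\<lambda>\<omega>. count_points (S \<omega>)) (ennreal m)" "0 \<le> m"
  shows "(\<integral>\<^sup>+\<omega>. ennreal (real (card (S \<omega>))) \<partial>M) = ennreal m"
proof (rule poisson_count_nn_integral[OF assms])
  have "(\<lambda>k. real (Suc k) * (exp (- m) * m ^ Suc k / fact (Suc k))) = (\<lambda>k. m * (exp (- m) * m ^ k / fact k))"
    by (simp add: fun_eq_iff del: of_nat_Suc)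
  then have "(\<lambda>k. real (Suc k) * (exp (- m) * m ^ Suc k / fact (Suc k))) sums (m * 1)"
    by (simp only:) (intro sums_mult poisson_weights_sums)
  from sums_Suc[OF this] show "(\<lambda>k. real k * (exp (- m) * m ^ k / fact k)) sums m"
    by simp
qed auto

text \<open>Being exactly m * m, this has the form of the mean of a product of two independent
  counts, so pairs within one box and pairs from different boxes are treated alike.\<close>

lemma poisson_count_second_factorial_moment:
  assumes "poisson_variable M (\<lambda>\<omega>. count_points (S \<omega>)) (ennreal m)" "0 \<le> m"
  shows "(\<integral>\<^sup>+\<omega>. ennreal (real (card (S \<omega>)) * (real (card (S \<omega>)) - 1)) \<partial>M) = ennreal (m * m)"
proof (rule poisson_count_nn_integral[OF assms, where g = "\<lambda>k. real k * (real k - 1)"])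
  show "0 \<le> real k * (real k - 1)" for k
    by (cases k) auto
  let ?h = "\<lambda>k. real k * (real k - 1) * (exp (- m) * m ^ k / fact k)"
  have "?h (Suc (Suc k)) = (m * m) * (exp (- m) * m ^ k / fact k)" for k
  proof -
    have f: "fact (Suc (Suc k)) = real (Suc (Suc k)) * (real (Suc k) * fact k)"
      by (simp only: fact_Suc of_nat_mult of_nat_fact)
    have d: "real (Suc (Suc k)) - 1 = real (Suc k)"
      by simp
    show ?thesis
      unfolding f d by (simp del: of_nat_Suc fact_Suc)
  qed
  then have "(\<lambda>k. ?h (Suc (Suc k))) sums ((m * m) * 1)"
    by (simp only:) (intro sums_mult poisson_weights_sums)
  from sums_Suc[OF sums_Suc[OF this]] show "?h sums (m * m)"
    by simp
qed auto

lemma indep_count_product_mean: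
  assumes PX: "poisson_variable M (\<lambda>\<omega>. count_points (S \<omega>)) (ennreal a)" "0 \<le> a"
    and PY: "poisson_variable M (\<lambda>\<omega>. count_points (T \<omega>)) (ennreal b)" "0 \<le> b"
    and ind: "indep_var (count_space UNIV) (\<lambda>\<omega>. count_points (S \<omega>)) (count_space UNIV) (\<lambda>\<omega>. count_points (T \<omega>))"
  shows "(\<integral>\<^sup>+\<omega>. ennreal (real (card (S \<omega>)) * real (card (T \<omega>))) \<partial>M) = ennreal (a * b)"
proof -
  define g :: "enat \<Rightarrow> ennreal" where "g e = (case e of enat n \<Rightarrow> ennreal (real n) | \<infinity> \<Rightarrow> 0)" for e
  have g: "g (count_points A) = ennreal (real (card A))" for A :: "'b set"
    by (auto simp: g_def count_points_def)
  have g': "g (count_points A) = ennreal (real (card A))" for A :: "'c set"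
    by (auto simp: g_def count_points_def)
  have "indep_var borel (g \<circ> (\<lambda>\<omega>. count_points (S \<omega>))) borel (g \<circ> (\<lambda>\<omega>. count_points (T \<omega>)))"
    by (rule indep_var_compose[OF ind]) auto
  \<comment> \<open>The family \<open>case_bool borel borel\<close> of target spaces is rewritten as
    a constant family, the form in \<open>indep_vars_nn_integral\<close>.\<close>
  then have "indep_vars (\<lambda>_::bool. borel) (case_bool (g \<circ> (\<lambda>\<omega>. count_points (S \<omega>))) (g \<circ> (\<lambda>\<omega>. count_points (T \<omega>)))) UNIV"
    unfolding indep_var_def by (rule back_subst[where P = "\<lambda>F. indep_vars F _ _"]) (auto split: bool.split)
  then have "(\<integral>\<^sup>+\<omega>. (\<Prod>i\<in>UNIV. case_bool (g \<circ> (\<lambda>\<omega>. count_points (S \<omega>))) (g \<circ> (\<lambda>\<omega>. count_points (T \<omega>))) i \<omega>) \<partial>M) =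
      (\<Prod>i\<in>UNIV. \<integral>\<^sup>+\<omega>. case_bool (g \<circ> (\<lambda>\<omega>. count_points (S \<omega>))) (g \<circ> (\<lambda>\<omega>. count_points (T \<omega>))) i \<omega> \<partial>M)"
    by (intro indep_vars_nn_integral) auto
  then have "(\<integral>\<^sup>+\<omega>. ennreal (real (card (S \<omega>))) * ennreal (real (card (T \<omega>))) \<partial>M) = ennreal a * ennreal b"
    unfolding UNIV_bool by (simp add: o_def g g' poisson_count_mean[OF PX] poisson_count_mean[OF PY] mult.commute)
  then show ?thesis
    using PX(2) by (simp add: ennreal_mult')
qed

section \<open>Second moment method for pairwise independent events\<close>

lemma poisson_prob_ge_2:
  assumes P: "poisson_variable M X (ennreal m)" "0 \<le> m"
  shows "min 1 (m\<^sup>2) / 5 \<le> prob {\<omega> \<in> space M. 2 \<le> X \<omega>}"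
proof -
  note [measurable] = poisson_variable_measurable[OF P(1)]
  let ?E = "\<lambda>k. {\<omega> \<in> space M. X \<omega> = enat k}"
  have eq: "{\<omega> \<in> space M. 2 \<le> X \<omega>} = space M - (?E 0 \<union> ?E 1)"
  proof -
    have "2 \<le> e \<longleftrightarrow> e \<noteq> enat 0 \<and> e \<noteq> enat 1" for e :: enat
      by (cases e) (auto simp: numeral_eq_enat)
    then show ?thesis
      by auto
  qed
  have "prob {\<omega> \<in> space M. 2 \<le> X \<omega>} = 1 - prob (?E 0 \<union> ?E 1)"
    unfolding eq by (intro prob_compl) measurable
  also have "prob (?E 0 \<union> ?E 1) = prob (?E 0) + prob (?E 1)"
    by (intro finite_measure_Union) auto
  also have "\<dots> = (1 + m) / exp m"
    unfolding poisson_variable_prob[OF P] by (simp add: exp_minus field_simps)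
  \<comment> \<open>By exp m \<ge> 1 + m + m^2 / 2 the left side is at least m^2 / (2 + 2 m + m^2),
    whose denominator is at most 5 for m \<le> 1 and at most 5 m^2 for m > 1.\<close>
  also have "1 - (1 + m) / exp m \<ge> min 1 (m\<^sup>2) / 5"
  proof -
    have q: "0 < 1 + m + m\<^sup>2 / 2"
      using P(2) by (simp add: add_pos_nonneg)
    have "(1 + m) / exp m \<le> (1 + m) / (1 + m + m\<^sup>2 / 2)"
      using P(2) exp_lower_Taylor_quadratic[OF P(2)] q by (intro divide_left_mono mult_pos_pos) auto
    also have "\<dots> = 1 - m\<^sup>2 / (2 + 2 * m + m\<^sup>2)"
      using q by (simp add: field_simps)
    also have "min 1 (m\<^sup>2) / 5 \<le> m\<^sup>2 / (2 + 2 * m + m\<^sup>2)"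
    proof (cases "m \<le> 1")
      case True
      have "m\<^sup>2 \<le> 1"
        using True P(2) by (simp add: power_le_one)
      then have "m\<^sup>2 / 5 \<le> m\<^sup>2 / (2 + 2 * m + m\<^sup>2)"
        using True P(2) by (intro divide_left_mono) (auto intro!: add_pos_nonneg mult_pos_pos)
      then show ?thesis
        using \<open>m\<^sup>2 \<le> 1\<close> by (simp add: min_def)
    next
      case False
      then have "m * 1 \<le> m * m" "1 * 1 \<le> m * m"
        by (intro mult_left_mono mult_mono; simp)+
      then have "2 + 2 * m + m\<^sup>2 \<le> 5 * m\<^sup>2"
        unfolding power2_eq_square by linarith
      then have "1 / 5 \<le> m\<^sup>2 / (2 + 2 * m + m\<^sup>2)"
        using P(2) by (simp add: divide_simps add_pos_nonneg)
      then show ?thesis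
        by (auto intro: order_trans[rotated])
    qed
    ultimately show ?thesis
      by linarith
  qed
  finally show ?thesis .
qed

text \<open>Chebyshev's inequality for the number of events that occur; pairwise independence is enough
  to compute its variance.\<close>

lemma prob_none_le_inverse_sum:
  assumes fin: "finite F" and ev: "\<And>i. i \<in> F \<Longrightarrow> E i \<in> events"
    and ind: "\<And>i j. i \<in> F \<Longrightarrow> j \<in> F \<Longrightarrow> i \<noteq> j \<Longrightarrow> prob (E i \<inter> E j) = prob (E i) * prob (E j)"
    and s: "0 < (\<Sum>i\<in>F. prob (E i))"
  shows "prob (space M - (\<Union>i\<in>F. E i)) \<le> 1 / (\<Sum>i\<in>F. prob (E i))"
proof -
  define s where "s = (\<Sum>i\<in>F. prob (E i))"
  define G where "G = space M - (\<Union>i\<in>F. E i)"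
  have G: "G \<in> events"
    unfolding G_def using fin ev by auto
  have ev2: "E i \<inter> E j \<in> events" if "i \<in> F" "j \<in> F" for i j
    using ev that by auto
  let ?Z = "\<lambda>\<omega>. \<Sum>i\<in>F. indicator (E i) \<omega> :: real"
  \<comment> \<open>This is (Z - s)^2 expanded, so that its mean follows term by term from the
    probabilities of intersections. On \<open>G\<close> it equals s^2.\<close>
  let ?W = "\<lambda>\<omega>. (\<Sum>i\<in>F. \<Sum>j\<in>F. indicator (E i \<inter> E j) \<omega>) - 2 * s * ?Z \<omega> + s\<^sup>2"
  have W: "?W \<omega> = (?Z \<omega> - s)\<^sup>2" for \<omega>
  proof -
    have sq: "(\<Sum>i\<in>F. \<Sum>j\<in>F. indicator (E i \<inter> E j) \<omega>) = ?Z \<omega> * ?Z \<omega>"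
      by (simp only: sum_product indicator_inter_arith)
    show ?thesis
      unfolding sq by algebra
  qed
  have int1: "integrable M (indicator (E i) :: _ \<Rightarrow> real)" if "i \<in> F" for i
    using ev[OF that] by (simp add: integrable_indicator_iff emeasure_eq_measure)
  have int2: "integrable M (indicator (E i \<inter> E j) :: _ \<Rightarrow> real)" if "i \<in> F" "j \<in> F" for i j
    using ev2[OF that] by (simp add: integrable_indicator_iff emeasure_eq_measure)
  have "s\<^sup>2 * prob G = (\<integral>\<omega>. s\<^sup>2 * indicator G \<omega> \<partial>M)"
    using G by simp
  also have "\<dots> \<le> (\<integral>\<omega>. ?W \<omega> \<partial>M)"
  proof (rule integral_mono)
    show "integrable M (\<lambda>\<omega>. s\<^sup>2 * indicator G \<omega>)"
      using G by (intro integrable_mult_right) (simp add: integrable_indicator_iff emeasure_eq_measure)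
    show "integrable M ?W"
      using int1 int2 by (intro Bochner_Integration.integrable_add Bochner_Integration.integrable_diff
          Bochner_Integration.integrable_sum integrable_mult_right) auto
    show "s\<^sup>2 * indicator G \<omega> \<le> ?W \<omega>" for \<omega>
    proof (cases "\<omega> \<in> G")
      case True
      then have "?Z \<omega> = 0"
        by (intro sum.neutral) (auto simp: G_def)
      then show ?thesis
        unfolding W using True by simp
    qed (unfold W, simp)
  qed
  also have "\<dots> = (\<Sum>i\<in>F. \<Sum>j\<in>F. prob (E i \<inter> E j)) - 2 * s * s + s\<^sup>2"
    using int1 int2 ev ev2 by (simp add: Bochner_Integration.integral_sum s_def prob_space
        Bochner_Integration.integrable_sum Bochner_Integration.integrable_diff)
  also have "(\<Sum>i\<in>F. \<Sum>j\<in>F. prob (E i \<inter> E j)) \<le> (\<Sum>i\<in>F. prob (E i) + (\<Sum>j\<in>F. prob (E i) * prob (E j)))"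
  proof (rule sum_mono)
    fix i assume i: "i \<in> F"
    have "(\<Sum>j\<in>F. prob (E i \<inter> E j)) = prob (E i) + (\<Sum>j\<in>F - {i}. prob (E i) * prob (E j))"
    proof -
      have "(\<Sum>j\<in>F - {i}. prob (E i \<inter> E j)) = (\<Sum>j\<in>F - {i}. prob (E i) * prob (E j))"
        using i by (intro sum.cong refl ind) auto
      then show ?thesis
        using fin i by (simp add: sum.remove[of F i])
    qed
    also have "\<dots> \<le> prob (E i) + (\<Sum>j\<in>F. prob (E i) * prob (E j))"
      using fin by (intro add_left_mono sum_mono2) auto
    finally show "(\<Sum>j\<in>F. prob (E i \<inter> E j)) \<le> prob (E i) + (\<Sum>j\<in>F. prob (E i) * prob (E j))" .
  qed
  also have "\<dots> = s + s * s"
    by (simp add: sum.distrib s_def sum_product)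
  finally have "s * (s * prob G) \<le> s * 1"
    by (simp add: power2_eq_square mult.assoc)
  moreover have "0 < s"
    using s by (simp add: s_def)
  ultimately have "s * prob G \<le> 1"
    by (simp only: mult_le_cancel_left_pos)
  then show ?thesis
    using \<open>0 < s\<close> unfolding G_def[symmetric] s_def[symmetric] by (simp add: field_simps)
qed

text \<open>The divergent half of the Borel-Cantelli lemma under pairwise independence, stated for
  one occurrence; applied to index sets that omit the first generations, it produces events
  arbitrarily far out.\<close>

lemma pairwise_indep_AE_occurs:
  assumes I: "countable I" and ev: "\<And>i. i \<in> I \<Longrightarrow> E i \<in> events"
    and ind: "\<And>i j. i \<in> I \<Longrightarrow> j \<in> I \<Longrightarrow> i \<noteq> j \<Longrightarrow> prob (E i \<inter> E j) = prob (E i) * prob (E j)"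
    and s: "\<And>s. \<exists>F. finite F \<and> F \<subseteq> I \<and> s \<le> (\<Sum>i\<in>F. prob (E i))"
  shows "AE \<omega> in M. \<exists>i\<in>I. \<omega> \<in> E i"
proof -
  define G where "G = space M - (\<Union>i\<in>I. E i)"
  have G: "G \<in> events"
    unfolding G_def using I ev by (intro sets.Diff sets.countable_UN') auto
  have le: "prob G \<le> 1 / s" if "0 < s" for s
  proof -
    obtain F where F: "finite F" "F \<subseteq> I" "s \<le> (\<Sum>i\<in>F. prob (E i))"
      using s by blast
    have "prob G \<le> prob (space M - (\<Union>i\<in>F. E i))"
      using F ev by (intro finite_measure_mono) (auto simp: G_def)
    also have "\<dots> \<le> 1 / (\<Sum>i\<in>F. prob (E i))"
    proof (rule prob_none_le_inverse_sum)
      show "prob (E i \<inter> E j) = prob (E i) * prob (E j)" if "i \<in> F" "j \<in> F" "i \<noteq> j" for i j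
        using F(2) that by (intro ind) auto
    qed (use F that ev in auto)
    also have "\<dots> \<le> 1 / s"
      using F that by (intro divide_left_mono) auto
    finally show ?thesis .
  qed
  have "prob G = 0"
  proof (rule ccontr)
    assume "prob G \<noteq> 0"
    then have "0 < prob G"
      by (simp add: zero_less_measure_iff)
    then show False
      using le[of "2 / prob G"] by simp
  qed
  then have "G \<in> null_sets M"
    using G by (simp add: emeasure_eq_measure null_sets_def)
  then show ?thesis
    by (rule AE_I') (auto simp: G_def)
qed

end

text \<open>The probability of two points is bounded below only by a truncated square. If the
  truncated sums were bounded, only finitely many terms could exceed 1, and their total is
  finite.\<close>

lemma unbounded_sum_min_1:
  fixes x :: "'a \<Rightarrow> real"
  assumes x: "\<And>i. i \<in> I \<Longrightarrow> 0 \<le> x i"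
    and unb: "\<And>s. \<exists>F. finite F \<and> F \<subseteq> I \<and> s \<le> sum x F"
  shows "\<exists>F. finite F \<and> F \<subseteq> I \<and> s \<le> (\<Sum>i\<in>F. min 1 (x i))"
proof (rule ccontr)
  assume "\<not> ?thesis"
  then have bound: "(\<Sum>i\<in>F. min 1 (x i)) < s" if "finite F" "F \<subseteq> I" for F
    using that by (meson not_le)
  define H where "H = {i \<in> I. 1 < x i}"
  have "finite H \<and> card H \<le> nat \<lceil>s\<rceil>"
  proof (rule finite_if_finite_subsets_card_bdd)
    fix G assume G: "G \<subseteq> H" "finite G"
    have "real (card G) = (\<Sum>i\<in>G. 1)"
      by simp
    also have "\<dots> = (\<Sum>i\<in>G. min 1 (x i))"
      using G by (intro sum.cong) (auto simp: H_def)
    also have "\<dots> < s"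
      using G by (intro bound) (auto simp: H_def)
    finally show "card G \<le> nat \<lceil>s\<rceil>"
      by linarith
  qed
  then have H: "finite H" ..
  obtain F where F: "finite F" "F \<subseteq> I" "s + sum x H \<le> sum x F"
    using unb by blast
  have "sum x F = sum x (F \<inter> H) + sum x (F - H)"
    using F by (simp add: sum.Int_Diff)
  also have "sum x (F \<inter> H) \<le> sum x H"
    using H x by (intro sum_mono2) (auto simp: H_def)
  also have "sum x (F - H) = (\<Sum>i\<in>F - H. min 1 (x i))"
    using F by (intro sum.cong) (auto simp: H_def)
  also have "\<dots> < s"
    using F by (intro bound) auto
  finally show False
    using F(3) by simp
qed

lemma count_points_ge_2_iff: "2 \<le> count_points S \<longleftrightarrow> (\<exists>x\<in>S. \<exists>y\<in>S. x \<noteq> y)"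
proof (cases "finite S")
  case True
  then have "2 \<le> count_points S \<longleftrightarrow> \<not> card S \<le> Suc 0"
    by (auto simp: count_points_def numeral_eq_enat)
  also have "\<dots> \<longleftrightarrow> (\<exists>x\<in>S. \<exists>y\<in>S. x \<noteq> y)"
    using card_le_Suc0_iff_eq[OF True] by blast
  finally show ?thesis .
next
  case False
  then obtain x where x: "x \<in> S"
    by (metis ex_in_conv finite.emptyI)
  have "infinite (S - {x})"
    using False by simp
  then obtain y where "y \<in> S - {x}"
    by (metis ex_in_conv finite.emptyI)
  then show ?thesis
    using x False by (auto simp: count_points_def)
qed

text \<open>Interpolation quantifies over uncountably many data, so its measurability in
  \<open>M\<close> is not evident; an almost sure property always defines a measurable set of the
  completion.\<close>

lemma AE_imp_completion_prob_1:
  assumes "prob_space M" "AE \<omega> in M. P \<omega>"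
  shows "{\<omega> \<in> space M. P \<omega>} \<in> sets (completion M) \<and> measure (completion M) {\<omega> \<in> space M. P \<omega>} = 1"
proof -
  interpret prob_space M by fact
  define D where "D = {\<omega> \<in> space M. \<not> P \<omega>}"
  have D: "D \<in> null_sets (completion M)"
    using assms(2) unfolding D_def eventually_ae_filter null_sets_completion_iff2 by auto
  have eq: "{\<omega> \<in> space M. P \<omega>} = space M - D"
    by (auto simp: D_def)
  have sp: "space M \<in> sets (completion M)"
    using sets.top[of "completion M"] by simp
  have "emeasure (completion M) (space M - D) = 1"
    using emeasure_Diff_null_set[OF D sp] by (simp add: emeasure_space_1)
  then show ?thesis
    unfolding eq using D sp by (auto simp: measure_def)
qed

lemma AE_not_imp_completion_prob_0:
  assumes "AE \<omega> in M. \<not> P \<omega>"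
  shows "{\<omega> \<in> space M. P \<omega>} \<in> sets (completion M) \<and> measure (completion M) {\<omega> \<in> space M. P \<omega>} = 0"
proof -
  have "{\<omega> \<in> space M. P \<omega>} \<in> null_sets (completion M)"
    using assms unfolding eventually_ae_filter null_sets_completion_iff2 by auto
  then show ?thesis
    by (auto simp: measure_def)
qed

section \<open>The Poisson process\<close>

text \<open>The number of ordered pairs of distinct points of \<open>L\<close>, the first in box
  \<open>i\<close> and the second in box \<open>j\<close>, when both boxes contain finitely many
  points; the correction for i = j removes the pairs (x, x).\<close>

definition pair_count :: "complex set \<Rightarrow> nat \<times> nat \<Rightarrow> nat \<times> nat \<Rightarrow> real"
  where "pair_count L i j = real (card (dyadic_box (fst i) (snd i) \<inter> L)) *
    (real (card (dyadic_box (fst j) (snd j) \<inter> L)) - (if i = j then 1 else 0))"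

lemma pair_count_nonneg: "0 \<le> pair_count L i j"
proof (cases "card (dyadic_box (fst j) (snd j) \<inter> L)")
  case 0
  then show ?thesis
    by (cases "i = j") (auto simp: pair_count_def)
qed (auto simp: pair_count_def)

lemma box_indices_iff: "i \<in> box_indices N \<longleftrightarrow> fst i < N \<and> snd i < 2 ^ fst i"
  by (cases i) (auto simp: box_indices_def)

lemma finite_box_indices: "finite (box_indices N)"
  by (simp add: box_indices_def)

lemma sum_over_boxes:
  fixes f :: "complex \<Rightarrow> real"
  assumes "finite F" and cover: "\<And>x. x \<in> F \<Longrightarrow> \<exists>i\<in>box_indices N. x \<in> dyadic_box (fst i) (snd i)"
  shows "sum f F = (\<Sum>i\<in>box_indices N. \<Sum>x\<in>F \<inter> dyadic_box (fst i) (snd i). f x)"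
proof -
  have "F = (\<Union>i\<in>box_indices N. F \<inter> dyadic_box (fst i) (snd i))"
    using cover by blast
  then have "sum f F = sum f (\<Union>i\<in>box_indices N. F \<inter> dyadic_box (fst i) (snd i))"
    by (rule arg_cong)
  also have "\<dots> = (\<Sum>i\<in>box_indices N. \<Sum>x\<in>F \<inter> dyadic_box (fst i) (snd i). f x)"
  proof (rule sum.UNION_disjoint[OF finite_box_indices])
    show "\<forall>i\<in>box_indices N. \<forall>j\<in>box_indices N. i \<noteq> j \<longrightarrow>
        (F \<inter> dyadic_box (fst i) (snd i)) \<inter> (F \<inter> dyadic_box (fst j) (snd j)) = {}"
    proof (intro ballI impI)
      fix i j assume ij: "i \<in> box_indices N" "j \<in> box_indices N" "i \<noteq> j"
      then have "dyadic_box (fst i) (snd i) \<inter> dyadic_box (fst j) (snd j) = {}"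
        by (intro dyadic_box_disjoint) (auto simp: box_indices_iff)
      then show "(F \<inter> dyadic_box (fst i) (snd i)) \<inter> (F \<inter> dyadic_box (fst j) (snd j)) = {}"
        by blast
    qed
  qed (use assms(1) in auto)
  finally show ?thesis .
qed

text \<open>Finiteness in the boxes matters because \<open>card\<close> of an infinite set is 0, so
  its points would be lost on the right. \<open>N\<close> only has to exceed the generations of the
  boxes that meet \<open>F\<close>.\<close>

lemma szego_overlap_sum_le_box_sum:
  assumes L: "L \<subseteq> ball 0 1" and fin: "\<And>n k. k < 2 ^ n \<Longrightarrow> finite (dyadic_box n k \<inter> L)"
    and F: "finite F" "F \<subseteq> L"
  shows "\<exists>N. (\<Sum>x\<in>F. \<Sum>y\<in>F - {x}. szego_overlap y x) \<le>
    (\<Sum>i\<in>box_indices N. \<Sum>j\<in>box_indices N. box_overlap i j * pair_count L i j)"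
proof -
  let ?T = "\<lambda>i. dyadic_box (fst i) (snd i)"
  have F1: "cmod x < 1" if "x \<in> F" for x
    using that F L by auto
  have "\<forall>x\<in>F. \<exists>i. snd i < 2 ^ fst i \<and> x \<in> ?T i"
    using dyadic_box_cover[OF F1] by fastforce
  then obtain idx where idx: "\<And>x. x \<in> F \<Longrightarrow> snd (idx x) < 2 ^ fst (idx x) \<and> x \<in> ?T (idx x)"
    by metis
  obtain N where N: "\<And>x. x \<in> F \<Longrightarrow> fst (idx x) < N"
  proof -
    have "finite ((\<lambda>x. fst (idx x)) ` F)"
      using F by simp
    then obtain N where "\<forall>n\<in>(\<lambda>x. fst (idx x)) ` F. n < N"
      using finite_nat_set_iff_bounded by blast
    then show ?thesis
      by (intro that) auto
  qed
  have cover: "\<exists>i\<in>box_indices N. x \<in> ?T i" if "x \<in> F" for x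
    using idx[OF that] N[OF that] by (intro bexI[of _ "idx x"]) (auto simp: box_indices_iff)
  have "(\<Sum>x\<in>F. \<Sum>y\<in>F - {x}. szego_overlap y x) =
      (\<Sum>i\<in>box_indices N. \<Sum>x\<in>F \<inter> ?T i. \<Sum>j\<in>box_indices N. \<Sum>y\<in>(F - {x}) \<inter> ?T j. szego_overlap y x)"
  proof -
    have "(\<Sum>y\<in>F - {x}. szego_overlap y x) =
        (\<Sum>j\<in>box_indices N. \<Sum>y\<in>(F - {x}) \<inter> ?T j. szego_overlap y x)" for x
      using F cover by (intro sum_over_boxes) auto
    then show ?thesis
      using F cover by (simp only:) (intro sum_over_boxes, auto)
  qed
  also have "\<dots> = (\<Sum>i\<in>box_indices N. \<Sum>j\<in>box_indices N. \<Sum>x\<in>F \<inter> ?T i. \<Sum>y\<in>(F - {x}) \<inter> ?T j. szego_overlap y x)"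
    by (intro sum.cong refl sum.swap)
  also have "\<dots> \<le> (\<Sum>i\<in>box_indices N. \<Sum>j\<in>box_indices N. box_overlap i j * pair_count L i j)"
  proof (intro sum_mono)
    fix i j assume i: "i \<in> box_indices N" and j: "j \<in> box_indices N"
    define e :: real where "e = (if i = j then 1 else 0)"
    have finT: "finite (?T i \<inter> L)" "finite (?T j \<inter> L)"
      using fin i j by (auto simp: box_indices_iff)
    have "(\<Sum>y\<in>(F - {x}) \<inter> ?T j. szego_overlap y x) \<le> box_overlap i j * (real (card (?T j \<inter> L)) - e)"
      if x: "x \<in> F \<inter> ?T i" for x
    proof -
      have "(\<Sum>y\<in>(F - {x}) \<inter> ?T j. szego_overlap y x) \<le> (\<Sum>y\<in>(F - {x}) \<inter> ?T j. box_overlap i j)"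
      proof (rule sum_mono)
        fix y assume "y \<in> (F - {x}) \<inter> ?T j"
        then have "szego_overlap y x \<le> box_overlap j i"
          using szego_overlap_le_box_overlap[of y "fst j" "snd j" x "fst i" "snd i"] x by simp
        then show "szego_overlap y x \<le> box_overlap i j"
          by (simp add: box_overlap_commute)
      qed
      also have "\<dots> = box_overlap i j * real (card ((F - {x}) \<inter> ?T j))"
        by simp
      also have "\<dots> \<le> box_overlap i j * (real (card (?T j \<inter> L)) - e)"
      proof (intro mult_left_mono box_overlap_nonneg)
        show "real (card ((F - {x}) \<inter> ?T j)) \<le> real (card (?T j \<inter> L)) - e"
        proof (cases "i = j")
          case True
          have "card ((F - {x}) \<inter> ?T j) \<le> card (?T j \<inter> L - {x})"
            using finT F by (intro card_mono) auto
          also have "\<dots> = card (?T j \<inter> L) - 1"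
            using x F True by (intro card_Diff_singleton) auto
          finally have "card ((F - {x}) \<inter> ?T j) \<le> card (?T j \<inter> L) - 1" .
          moreover have "0 < card (?T j \<inter> L)"
            using x F True finT by (auto simp: card_gt_0_iff)
          ultimately show ?thesis
            using True by (simp add: e_def)
        next
          case False
          have "card ((F - {x}) \<inter> ?T j) \<le> card (?T j \<inter> L)"
            using finT F by (intro card_mono) auto
          then show ?thesis
            using False by (simp add: e_def)
        qed
      qed
      finally show ?thesis .
    qed
    then have "(\<Sum>x\<in>F \<inter> ?T i. \<Sum>y\<in>(F - {x}) \<inter> ?T j. szego_overlap y x) \<le>
        (\<Sum>x\<in>F \<inter> ?T i. box_overlap i j * (real (card (?T j \<inter> L)) - e))"
      by (rule sum_mono)
    also have "\<dots> = box_overlap i j * (real (card (F \<inter> ?T i)) * (real (card (?T j \<inter> L)) - e))"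
      by simp
    also have "\<dots> \<le> box_overlap i j * (real (card (?T i \<inter> L)) * (real (card (?T j \<inter> L)) - e))"
    proof (intro mult_left_mono box_overlap_nonneg)
      show "real (card (F \<inter> ?T i)) * (real (card (?T j \<inter> L)) - e) \<le>
          real (card (?T i \<inter> L)) * (real (card (?T j \<inter> L)) - e)"
      \<comment> \<open>The factor is negative only for an empty diagonal box, where both sides
        vanish.\<close>
      proof (cases "real (card (?T j \<inter> L)) - e < 0")
        case True
        then have "i = j" "card (?T j \<inter> L) = 0"
          by (auto simp: e_def split: if_splits)
        then have "F \<inter> ?T i = {}"
          using finT F by auto
        then show ?thesis
          using \<open>i = j\<close> \<open>card (?T j \<inter> L) = 0\<close> by simp
      next
        case False
        have "card (F \<inter> ?T i) \<le> card (?T i \<inter> L)"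
          using finT F by (intro card_mono) auto
        then show ?thesis
          using False by (intro mult_right_mono) auto
      qed
    qed
    finally show "(\<Sum>x\<in>F \<inter> ?T i. \<Sum>y\<in>(F - {x}) \<inter> ?T j. szego_overlap y x) \<le> box_overlap i j * pair_count L i j"
      by (simp add: pair_count_def e_def)
  qed
  finally show ?thesis
    by blast
qed

text \<open>Translated by its centre and scaled by 2 ^ n, every box lies in the disk of radius 8.
  One finite cover of that disk serves all boxes, so the number of pieces is the same for
  each.\<close>

lemma dyadic_box_covered_by_small_balls:
  fixes e :: real
  assumes "0 < e"
  obtains P :: "complex set" where "finite P" "P \<noteq> {}"
    "\<And>n k. dyadic_box n k \<subseteq> (\<Union>x\<in>P. ball (box_centre (n, k) + x / 2 ^ n) (e / 2 ^ n))"
proof -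
  have "compact (cball (0::complex) 8)"
    by simp
  then obtain P where P: "finite P" "cball (0::complex) 8 \<subseteq> (\<Union>x\<in>P. ball x e)"
    using assms unfolding compact_eq_totally_bounded by blast
  show ?thesis
  proof (rule that[OF P(1)])
    show "P \<noteq> {}"
    proof
      assume "P = {}"
      then have "(0::complex) \<in> {}"
        using P(2) by auto
      then show False
        by simp
    qed
    fix n k
    show "dyadic_box n k \<subseteq> (\<Union>x\<in>P. ball (box_centre (n, k) + x / 2 ^ n) (e / 2 ^ n))"
    proof
      fix z assume "z \<in> dyadic_box n k"
      then have "cmod (z - box_centre (n, k)) \<le> 8 / 2 ^ n"
        by (rule dyadic_box_dist_centre_le)
      define c where "c = box_centre (n, k)"
      have "cmod (2 ^ n * (z - c)) = 2 ^ n * cmod (z - c)"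
        by (simp only: norm_mult norm_power norm_numeral)
      also have "\<dots> \<le> 8"
        using \<open>cmod (z - box_centre (n, k)) \<le> 8 / 2 ^ n\<close> by (simp add: c_def pos_le_divide_eq mult.commute)
      finally have "cmod (2 ^ n * (z - c)) \<le> 8" .
      then have "2 ^ n * (z - c) \<in> cball 0 8"
        by simp
      then obtain x where x: "x \<in> P" "dist x (2 ^ n * (z - c)) < e"
        using P(2) by (auto simp: subset_iff)
      have "c + x / 2 ^ n - z = (x - 2 ^ n * (z - c)) / 2 ^ n"
        by (simp add: field_simps)
      then have "cmod (c + x / 2 ^ n - z) < e / 2 ^ n"
        using x(2) by (simp only: norm_divide norm_power norm_numeral dist_norm) (simp add: divide_strict_right_mono)
      then show "z \<in> (\<Union>x\<in>P. ball (box_centre (n, k) + x / 2 ^ n) (e / 2 ^ n))"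
        using x(1) by (auto simp: c_def dist_norm)
    qed
  qed
qed

locale poisson_process_disk =
  fixes M :: "'w measure" and \<mu> :: "complex measure" and \<Lambda> :: "'w \<Rightarrow> complex set"
  assumes sets_eq: "sets \<mu> = sets (restrict_space borel unit_disk)"
    and finite_compact: "\<And>K. compact K \<Longrightarrow> K \<subseteq> unit_disk \<Longrightarrow> emeasure \<mu> K < \<infinity>"
    and ppp: "poisson_point_process M \<mu> \<Lambda>"
begin

sublocale prob_space M
  using ppp by (simp add: poisson_point_process_def)

lemma space_eq: "space \<mu> = ball 0 1"
  using sets_eq_imp_space_eq[OF sets_eq] by simp

lemma points_subset: "\<omega> \<in> space M \<Longrightarrow> \<Lambda> \<omega> \<subseteq> ball 0 1"
  and points_countable: "\<omega> \<in> space M \<Longrightarrow> countable (\<Lambda> \<omega>)"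
  using ppp by (auto simp: poisson_point_process_def space_eq)

lemma borel_in_sets: "A \<in> sets borel \<Longrightarrow> A \<subseteq> ball 0 1 \<Longrightarrow> A \<in> sets \<mu>"
  unfolding sets_eq by (subst sets_restrict_space_iff) auto

lemma box_in_sets: "k < 2 ^ n \<Longrightarrow> dyadic_box n k \<in> sets \<mu>"
  by (intro borel_in_sets dyadic_box_borel dyadic_box_subset)

text \<open>Local finiteness enters here: a box lies in a compact disk, so its mass can be handled
  as a real number.\<close>

lemma emeasure_box_finite:
  assumes "A \<in> sets \<mu>" "A \<subseteq> dyadic_box n k"
  shows "emeasure \<mu> A = ennreal (measure \<mu> A)"
proof -
  define K :: "complex set" where "K = cball 0 (1 - 1 / 2 ^ (n + 1))"
  have K: "K \<subseteq> ball 0 1"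
  proof
    fix z assume "z \<in> K"
    then have "cmod z \<le> 1 - 1 / 2 ^ (n + 1)"
      unfolding K_def by (simp only: mem_cball_0)
    also have "\<dots> < 1"
      by simp
    finally show "z \<in> ball 0 1"
      by simp
  qed
  have "emeasure \<mu> A \<le> emeasure \<mu> K"
    using assms(2) dyadic_box_subset_cball K
    by (intro emeasure_mono borel_in_sets) (auto simp: K_def)
  also have "\<dots> < \<infinity>"
    using K by (intro finite_compact) (auto simp: K_def)
  finally show ?thesis
    by (intro emeasure_eq_ennreal_measure) auto
qed

lemma count_poisson:
  assumes "A \<in> sets \<mu>" "A \<subseteq> dyadic_box n k"
  shows "poisson_variable M (\<lambda>\<omega>. count_points (A \<inter> \<Lambda> \<omega>)) (ennreal (measure \<mu> A))"
  using ppp assms(1) unfolding poisson_point_process_def emeasure_box_finite[OF assms, symmetric] by blast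

lemma count_indep:
  assumes "A \<in> sets \<mu>" "B \<in> sets \<mu>" "A \<inter> B = {}"
  shows "indep_var (count_space UNIV) (\<lambda>\<omega>. count_points (A \<inter> \<Lambda> \<omega>))
    (count_space UNIV) (\<lambda>\<omega>. count_points (B \<inter> \<Lambda> \<omega>))"
  using ppp assms unfolding poisson_point_process_def by blast

lemma AE_finite_boxes: "AE \<omega> in M. \<forall>n k. k < 2 ^ n \<longrightarrow> finite (dyadic_box n k \<inter> \<Lambda> \<omega>)"
proof -
  have "AE \<omega> in M. k < 2 ^ n \<longrightarrow> finite (dyadic_box n k \<inter> \<Lambda> \<omega>)" for n k
  proof (cases "k < 2 ^ n")
    case True
    then have "AE \<omega> in M. finite (dyadic_box n k \<inter> \<Lambda> \<omega>)"
      by (intro poisson_count_AE_finite[OF count_poisson[OF box_in_sets subset_refl]]) auto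
    then show ?thesis
      by eventually_elim simp
  qed simp
  then show ?thesis
    by (simp add: AE_all_countable)
qed

section \<open>Expected pair counts and the convergent case\<close>

abbreviation box_mass :: "nat \<times> nat \<Rightarrow> real"
  where "box_mass i \<equiv> measure \<mu> (dyadic_box (fst i) (snd i))"

lemma pair_count_mean:
  assumes i: "snd i < 2 ^ fst i" and j: "snd j < 2 ^ fst j"
  shows "(\<integral>\<^sup>+\<omega>. ennreal (pair_count (\<Lambda> \<omega>) i j) \<partial>M) = ennreal (box_mass i * box_mass j)"
proof (cases "i = j")
  case True
  have eq: "pair_count L i j = real (card (dyadic_box (fst i) (snd i) \<inter> L)) *
      (real (card (dyadic_box (fst i) (snd i) \<inter> L)) - 1)" for L
    by (simp add: pair_count_def True)
  show ?thesis
    unfolding eq unfolding True[symmetric]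
    by (rule poisson_count_second_factorial_moment[OF count_poisson[OF box_in_sets[OF i] subset_refl]]) simp
next
  case False
  have "dyadic_box (fst i) (snd i) \<inter> dyadic_box (fst j) (snd j) = {}"
    using i j False by (intro dyadic_box_disjoint) (auto simp: prod_eq_iff)
  then show ?thesis
    unfolding pair_count_def if_not_P[OF False] diff_0_right
    by (intro indep_count_product_mean count_poisson[OF box_in_sets subset_refl] count_indep box_in_sets i j) auto
qed

lemma pair_count_measurable:
  assumes i: "snd i < 2 ^ fst i" and j: "snd j < 2 ^ fst j"
  shows "(\<lambda>\<omega>. pair_count (\<Lambda> \<omega>) i j) \<in> borel_measurable M"
proof -
  have m: "(\<lambda>\<omega>. real (card (dyadic_box n k \<inter> \<Lambda> \<omega>))) \<in> borel_measurable M" if "k < 2 ^ n" for n k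
  proof -
    have "(\<lambda>\<omega>. card (dyadic_box n k \<inter> \<Lambda> \<omega>)) \<in> measurable M (count_space UNIV)"
      by (rule measurable_card_count_points[OF poisson_variable_measurable[OF count_poisson[OF box_in_sets[OF that] subset_refl]]])
    then show ?thesis
      by (rule measurable_compose) simp
  qed
  show ?thesis
    unfolding pair_count_def using m[OF i] m[OF j] by measurable
qed

theorem AE_interpolating:
  assumes p: "0 < p" and B: "\<And>N. (\<Sum>n<N. \<Sum>k<2 ^ n. (box_mass (n, k))\<^sup>2) \<le> B"
  shows "AE \<omega> in M. interpolating p (\<Lambda> \<omega>)"
proof -
  define T where "T N \<omega> = (\<Sum>i\<in>box_indices N. \<Sum>j\<in>box_indices N. box_overlap i j * pair_count (\<Lambda> \<omega>) i j)" for N \<omega>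
  define C where "C = 8 * 289 ^ 3 * (2 / (1 - sqrt (1 / 2))) * B"
  have term_nonneg: "0 \<le> box_overlap i j * pair_count (\<Lambda> \<omega>) i j" for i j \<omega>
    by (intro mult_nonneg_nonneg box_overlap_nonneg pair_count_nonneg)
  have meas: "(\<lambda>\<omega>. pair_count (\<Lambda> \<omega>) i j) \<in> borel_measurable M"
    if "i \<in> box_indices N" "j \<in> box_indices N" for i j N
    using that by (intro pair_count_measurable) (auto simp: box_indices_iff)
  have Tmeas: "(\<lambda>\<omega>. ennreal (T N \<omega>)) \<in> borel_measurable M" for N
    unfolding T_def using meas by (intro measurable_compose[OF _ measurable_ennreal] borel_measurable_sum borel_measurable_times) auto
  \<comment> \<open>Schur's bound does not depend on \<open>N\<close>; monotone convergence
    therefore applies to the increasing sums \<open>T N\<close> and makes their supremum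
    integrable.\<close>
  have mean: "(\<integral>\<^sup>+\<omega>. ennreal (T N \<omega>) \<partial>M) \<le> ennreal C" for N
  proof -
    have "(\<integral>\<^sup>+\<omega>. ennreal (T N \<omega>) \<partial>M) =
        (\<integral>\<^sup>+\<omega>. (\<Sum>i\<in>box_indices N. \<Sum>j\<in>box_indices N. ennreal (box_overlap i j) * ennreal (pair_count (\<Lambda> \<omega>) i j)) \<partial>M)"
      unfolding T_def
      by (simp add: sum_nonneg term_nonneg box_overlap_nonneg flip: sum_ennreal ennreal_mult')
    also have "\<dots> = (\<Sum>i\<in>box_indices N. \<Sum>j\<in>box_indices N.
        \<integral>\<^sup>+\<omega>. ennreal (box_overlap i j) * ennreal (pair_count (\<Lambda> \<omega>) i j) \<partial>M)"
      using meas by (subst nn_integral_sum; (intro sum.cong refl nn_integral_sum)?) auto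
    also have "\<dots> = (\<Sum>i\<in>box_indices N. \<Sum>j\<in>box_indices N. ennreal (box_overlap i j * (box_mass i * box_mass j)))"
    proof (intro sum.cong refl)
      fix i j assume ij: "i \<in> box_indices N" "j \<in> box_indices N"
      then have "(\<integral>\<^sup>+\<omega>. ennreal (box_overlap i j) * ennreal (pair_count (\<Lambda> \<omega>) i j) \<partial>M) =
          ennreal (box_overlap i j) * (\<integral>\<^sup>+\<omega>. ennreal (pair_count (\<Lambda> \<omega>) i j) \<partial>M)"
        using meas[OF ij] by (intro nn_integral_cmult) auto
      also have "\<dots> = ennreal (box_overlap i j * (box_mass i * box_mass j))"
        using ij by (subst pair_count_mean) (auto simp: box_indices_iff ennreal_mult' box_overlap_nonneg)
      finally show "(\<integral>\<^sup>+\<omega>. ennreal (box_overlap i j) * ennreal (pair_count (\<Lambda> \<omega>) i j) \<partial>M) =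
          ennreal (box_overlap i j * (box_mass i * box_mass j))" .
    qed
    also have "\<dots> = ennreal (\<Sum>i\<in>box_indices N. \<Sum>j\<in>box_indices N. box_overlap i j * (box_mass i * box_mass j))"
      by (simp add: sum_nonneg box_overlap_nonneg)
    also have "\<dots> \<le> ennreal C"
      unfolding C_def using B by (intro ennreal_leI schur_test_boxes) auto
    finally show ?thesis .
  qed
  have inc: "incseq (\<lambda>N \<omega>. ennreal (T N \<omega>))"
  proof (intro incseq_SucI le_funI ennreal_leI)
    fix N \<omega>
    have sub: "box_indices N \<subseteq> box_indices (Suc N)"
      by (auto simp: box_indices_iff)
    have "T N \<omega> \<le> (\<Sum>i\<in>box_indices N. \<Sum>j\<in>box_indices (Suc N). box_overlap i j * pair_count (\<Lambda> \<omega>) i j)"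
      unfolding T_def by (intro sum_mono sum_mono2 finite_box_indices sub term_nonneg)
    also have "\<dots> \<le> T (Suc N) \<omega>"
      unfolding T_def by (intro sum_mono2 finite_box_indices sub sum_nonneg term_nonneg)
    finally show "T N \<omega> \<le> T (Suc N) \<omega>" .
  qed
  have "(\<integral>\<^sup>+\<omega>. (SUP N. ennreal (T N \<omega>)) \<partial>M) = (SUP N. \<integral>\<^sup>+\<omega>. ennreal (T N \<omega>) \<partial>M)"
    by (rule nn_integral_monotone_convergence_SUP[OF inc Tmeas])
  also have "\<dots> \<le> ennreal C"
    by (intro SUP_least mean)
  also have "\<dots> < \<infinity>"
    by simp
  finally have "AE \<omega> in M. (SUP N. ennreal (T N \<omega>)) \<noteq> \<infinity>"
    using Tmeas by (intro nn_integral_noteq_infinite) auto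
  then show ?thesis
    using AE_finite_boxes AE_space
  proof eventually_elim
    case (elim \<omega>)
    define D where "D = enn2real (SUP N. ennreal (T N \<omega>))"
    have TD: "T N \<omega> \<le> D" for N
    proof -
      have "ennreal (T N \<omega>) \<le> (SUP N. ennreal (T N \<omega>))"
        by (rule SUP_upper) simp
      also have "\<dots> = ennreal D"
        using elim(1) unfolding D_def by (metis ennreal_enn2real_if infinity_ennreal_def)
      finally show ?thesis
        by (simp add: D_def ennreal_le_iff)
    qed
    show ?case
    proof (rule szego_overlap_sum_imp_interpolating[OF p points_subset points_countable])
      fix F assume F: "finite F" "F \<subseteq> \<Lambda> \<omega>"
      obtain N where "(\<Sum>x\<in>F. \<Sum>y\<in>F - {x}. szego_overlap y x) \<le> T N \<omega>"
        unfolding T_def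
        using szego_overlap_sum_le_box_sum[OF points_subset[OF elim(3)] _ F] elim(2) by blast
      then show "(\<Sum>x\<in>F. \<Sum>y\<in>F - {x}. szego_overlap y x) \<le> D"
        using TD[of N] by linarith
    qed (use elim in auto)
  qed
qed

section \<open>Close pairs and the divergent case\<close>

lemma exists_heavy_small_piece:
  assumes P: "finite P" "P \<noteq> {}"
    "\<And>n k. dyadic_box n k \<subseteq> (\<Union>x\<in>P. ball (box_centre (n, k) + x / 2 ^ n) (e / 2 ^ n))"
    and k: "k < 2 ^ n"
  shows "\<exists>A\<in>sets \<mu>. A \<subseteq> dyadic_box n k \<and> measure \<mu> (dyadic_box n k) \<le> real (card P) * measure \<mu> A \<and>
    (\<forall>x\<in>A. \<forall>y\<in>A. cmod (x - y) \<le> 2 * e / 2 ^ n)"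
proof -
  \<comment> \<open>The pieces may overlap; by subadditivity one of them still carries at least the
    fraction 1 / card P of the mass.\<close>
  define A where "A x = dyadic_box n k \<inter> ball (box_centre (n, k) + x / 2 ^ n) (e / 2 ^ n)" for x
  have A: "A x \<in> sets \<mu>" "A x \<subseteq> dyadic_box n k" for x
    using dyadic_box_borel[OF k] dyadic_box_subset unfolding A_def by (auto intro!: borel_in_sets)
  have "dyadic_box n k = (\<Union>x\<in>P. A x)"
    using P(3)[of n k] by (auto simp: A_def)
  then have "emeasure \<mu> (dyadic_box n k) \<le> (\<Sum>x\<in>P. emeasure \<mu> (A x))"
    using P(1) A by (simp only:) (intro emeasure_subadditive_finite, auto)
  also have "\<dots> = ennreal (\<Sum>x\<in>P. measure \<mu> (A x))"
    by (simp add: emeasure_box_finite[OF A])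
  finally have sum: "measure \<mu> (dyadic_box n k) \<le> (\<Sum>x\<in>P. measure \<mu> (A x))"
    unfolding emeasure_box_finite[OF box_in_sets[OF k] subset_refl]
    by (subst (asm) ennreal_le_iff) (auto intro: sum_nonneg)
  have "\<exists>x\<in>P. measure \<mu> (dyadic_box n k) \<le> real (card P) * measure \<mu> (A x)"
  proof (rule ccontr)
    assume "\<not> ?thesis"
    then have *: "real (card P) * measure \<mu> (A x) < measure \<mu> (dyadic_box n k)" if "x \<in> P" for x
      using that by auto
    have "real (card P) * (\<Sum>x\<in>P. measure \<mu> (A x)) < (\<Sum>x\<in>P. measure \<mu> (dyadic_box n k))"
      unfolding sum_distrib_left using P * by (intro sum_strict_mono) auto
    also have "\<dots> = real (card P) * measure \<mu> (dyadic_box n k)"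
      by simp
    also have "\<dots> \<le> real (card P) * (\<Sum>x\<in>P. measure \<mu> (A x))"
      by (intro mult_left_mono sum) auto
    finally show False
      by simp
  qed
  then obtain x where x: "x \<in> P" "measure \<mu> (dyadic_box n k) \<le> real (card P) * measure \<mu> (A x)"
    by blast
  have "cmod (u - v) \<le> 2 * e / 2 ^ n" if "u \<in> A x" "v \<in> A x" for u v
  proof -
    have "dist u v \<le> dist (box_centre (n, k) + x / 2 ^ n) u + dist (box_centre (n, k) + x / 2 ^ n) v"
      by (rule dist_triangle3)
    also have "\<dots> \<le> e / 2 ^ n + e / 2 ^ n"
      using that by (intro add_mono) (auto simp: A_def)
    finally show ?thesis
      by (simp add: dist_norm)
  qed
  then show ?thesis
    using A x by blast
qed

text \<open>Restriction to generations n \<ge> m omits finitely many boxes, each of finite mass, and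
  preserves the divergence. Pieces of different boxes are disjoint, which is the source of pairwise
  independence.\<close>

lemma AE_close_pair:
  assumes unb: "\<And>B. \<exists>N. B < (\<Sum>n<N. \<Sum>k<2 ^ n. (box_mass (n, k))\<^sup>2)" and e: "0 < e"
  shows "AE \<omega> in M. \<exists>n\<ge>m. \<exists>k<2 ^ n. \<exists>x\<in>dyadic_box n k \<inter> \<Lambda> \<omega>. \<exists>y\<in>dyadic_box n k \<inter> \<Lambda> \<omega>.
    x \<noteq> y \<and> cmod (x - y) \<le> 2 * e / 2 ^ n"
proof -
  obtain P :: "complex set" where P: "finite P" "P \<noteq> {}"
    "\<And>n k. dyadic_box n k \<subseteq> (\<Union>x\<in>P. ball (box_centre (n, k) + x / 2 ^ n) (e / 2 ^ n))"
    using dyadic_box_covered_by_small_balls[OF e] by blast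
  define q where "q = real (card P)"
  have q: "0 < q"
    using P by (simp add: q_def card_gt_0_iff)
  define I where "I = {i :: nat \<times> nat. m \<le> fst i \<and> snd i < 2 ^ fst i}"
  have "\<forall>i\<in>I. \<exists>A\<in>sets \<mu>. A \<subseteq> dyadic_box (fst i) (snd i) \<and> box_mass i \<le> q * measure \<mu> A \<and>
    (\<forall>x\<in>A. \<forall>y\<in>A. cmod (x - y) \<le> 2 * e / 2 ^ fst i)"
    using exists_heavy_small_piece[OF P] unfolding q_def I_def by auto
  then obtain A where A: "\<And>i. i \<in> I \<Longrightarrow> A i \<in> sets \<mu>" "\<And>i. i \<in> I \<Longrightarrow> A i \<subseteq> dyadic_box (fst i) (snd i)"
    "\<And>i. i \<in> I \<Longrightarrow> box_mass i \<le> q * measure \<mu> (A i)"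
    "\<And>i x y. i \<in> I \<Longrightarrow> x \<in> A i \<Longrightarrow> y \<in> A i \<Longrightarrow> cmod (x - y) \<le> 2 * e / 2 ^ fst i"
    by metis
  define E where "E i = {\<omega> \<in> space M. 2 \<le> count_points (A i \<inter> \<Lambda> \<omega>)}" for i
  have pv: "poisson_variable M (\<lambda>\<omega>. count_points (A i \<inter> \<Lambda> \<omega>)) (ennreal (measure \<mu> (A i)))" if "i \<in> I" for i
    by (rule count_poisson[OF A(1,2)[OF that]])
  have ev: "E i \<in> events" if "i \<in> I" for i
  proof -
    note [measurable] = poisson_variable_measurable[OF pv[OF that]]
    show ?thesis
      unfolding E_def by measurable
  qed
  have unbI: "\<exists>F. finite F \<and> F \<subseteq> I \<and> s \<le> (\<Sum>i\<in>F. (measure \<mu> (A i))\<^sup>2)" for s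
  proof -
    define b where "b n = (\<Sum>k<2 ^ n. (box_mass (n, k))\<^sup>2)" for n
    \<comment> \<open>The surplus over the first \<open>m\<close> generations has to exceed q^2 * s,
      since passing from a box to its heavy piece loses at most the factor q^2 in the squared
      mass.\<close>
    obtain N where N: "q\<^sup>2 * s + (\<Sum>n<m. b n) < (\<Sum>n<N. b n)"
      using unb unfolding b_def by blast
    define F where "F = {i \<in> box_indices N. m \<le> fst i}"
    have "F \<subseteq> box_indices N"
      by (auto simp: F_def)
    then have F: "finite F" "F \<subseteq> I"
      using finite_subset[OF _ finite_box_indices[of N]] by (auto simp: F_def I_def box_indices_iff)
    have "(\<Sum>n<N. b n) = (\<Sum>i\<in>box_indices N. (box_mass i)\<^sup>2)"
      by (simp add: b_def sum_box_indices)
    also have "\<dots> = (\<Sum>i\<in>F. (box_mass i)\<^sup>2) + (\<Sum>i\<in>box_indices N - F. (box_mass i)\<^sup>2)"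
      using finite_box_indices by (subst add.commute, intro sum.subset_diff) (auto simp: F_def)
    also have "(\<Sum>i\<in>box_indices N - F. (box_mass i)\<^sup>2) \<le> (\<Sum>i\<in>box_indices m. (box_mass i)\<^sup>2)"
      by (intro sum_mono2 finite_box_indices) (auto simp: F_def box_indices_iff)
    also have "\<dots> = (\<Sum>n<m. b n)"
      by (simp add: b_def sum_box_indices)
    also have "(\<Sum>i\<in>F. (box_mass i)\<^sup>2) \<le> (\<Sum>i\<in>F. q\<^sup>2 * (measure \<mu> (A i))\<^sup>2)"
    proof (rule sum_mono)
      fix i assume "i \<in> F"
      then have "box_mass i \<le> q * measure \<mu> (A i)"
        using F A(3) by blast
      then have "(box_mass i)\<^sup>2 \<le> (q * measure \<mu> (A i))\<^sup>2"
        by (intro power_mono) auto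
      then show "(box_mass i)\<^sup>2 \<le> q\<^sup>2 * (measure \<mu> (A i))\<^sup>2"
        by (simp add: power_mult_distrib)
    qed
    also have "\<dots> = q\<^sup>2 * (\<Sum>i\<in>F. (measure \<mu> (A i))\<^sup>2)"
      by (simp only: sum_distrib_left)
    finally have "q\<^sup>2 * s < q\<^sup>2 * (\<Sum>i\<in>F. (measure \<mu> (A i))\<^sup>2)"
      using N by simp
    then have "s < (\<Sum>i\<in>F. (measure \<mu> (A i))\<^sup>2)"
      using q by (simp add: mult_less_cancel_left_pos)
    then show ?thesis
      using F by (intro exI[of _ F]) auto
  qed
  have "AE \<omega> in M. \<exists>i\<in>I. \<omega> \<in> E i"
  proof (rule pairwise_indep_AE_occurs[OF _ ev])
    show "countable I"
      by (rule countableI_type)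
    show "prob (E i \<inter> E j) = prob (E i) * prob (E j)" if ij: "i \<in> I" "j \<in> I" "i \<noteq> j" for i j
    proof -
      have "dyadic_box (fst i) (snd i) \<inter> dyadic_box (fst j) (snd j) = {}"
        using ij by (intro dyadic_box_disjoint) (auto simp: I_def prod_eq_iff)
      then have "A i \<inter> A j = {}"
        using A(2)[OF ij(1)] A(2)[OF ij(2)] by blast
      then have ind: "indep_var (count_space UNIV) (\<lambda>\<omega>. count_points (A i \<inter> \<Lambda> \<omega>))
          (count_space UNIV) (\<lambda>\<omega>. count_points (A j \<inter> \<Lambda> \<omega>))"
        using A(1) ij by (intro count_indep) auto
      have "prob ((\<lambda>\<omega>. (count_points (A i \<inter> \<Lambda> \<omega>), count_points (A j \<inter> \<Lambda> \<omega>))) -` ({2..} \<times> {2..}) \<inter> space M) =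
          prob ((\<lambda>\<omega>. count_points (A i \<inter> \<Lambda> \<omega>)) -` {2..} \<inter> space M) *
          prob ((\<lambda>\<omega>. count_points (A j \<inter> \<Lambda> \<omega>)) -` {2..} \<inter> space M)"
        by (rule indep_varD[OF ind]) auto
      moreover have "(\<lambda>\<omega>. (count_points (A i \<inter> \<Lambda> \<omega>), count_points (A j \<inter> \<Lambda> \<omega>))) -` ({2..} \<times> {2..}) \<inter> space M = E i \<inter> E j"
        by (auto simp: E_def)
      moreover have "(\<lambda>\<omega>. count_points (A l \<inter> \<Lambda> \<omega>)) -` {2..} \<inter> space M = E l" for l
        by (auto simp: E_def)
      ultimately show ?thesis
        by (simp only:)
    qed
    show "\<exists>F. finite F \<and> F \<subseteq> I \<and> s \<le> (\<Sum>i\<in>F. prob (E i))" for s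
    proof -
      obtain F where F: "finite F" "F \<subseteq> I" "5 * s \<le> (\<Sum>i\<in>F. min 1 ((measure \<mu> (A i))\<^sup>2))"
        using unbounded_sum_min_1[of I "\<lambda>i. (measure \<mu> (A i))\<^sup>2" "5 * s"] unbI by auto
      have "s \<le> (\<Sum>i\<in>F. min 1 ((measure \<mu> (A i))\<^sup>2) / 5)"
        using F(3) by (simp add: sum_divide_distrib[symmetric])
      also have "\<dots> \<le> (\<Sum>i\<in>F. prob (E i))"
        unfolding E_def using F(2) by (intro sum_mono poisson_prob_ge_2 pv) auto
      finally show ?thesis
        using F by blast
    qed
  qed
  then show ?thesis
  proof eventually_elim
    case (elim \<omega>)
    then obtain i where i: "i \<in> I" "2 \<le> count_points (A i \<inter> \<Lambda> \<omega>)"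
      by (auto simp: E_def)
    then obtain x y where xy: "x \<in> A i \<inter> \<Lambda> \<omega>" "y \<in> A i \<inter> \<Lambda> \<omega>" "x \<noteq> y"
      unfolding count_points_ge_2_iff by blast
    then have "x \<in> dyadic_box (fst i) (snd i) \<inter> \<Lambda> \<omega>" "y \<in> dyadic_box (fst i) (snd i) \<inter> \<Lambda> \<omega>"
      "cmod (x - y) \<le> 2 * e / 2 ^ fst i"
      using A(2,4)[OF i(1)] by auto
    then show ?case
      using i(1) xy(3) unfolding I_def by blast
  qed
qed

theorem AE_not_interpolating:
  assumes p: "0 < p" and unb: "\<And>B. \<exists>N. B < (\<Sum>n<N. \<Sum>k<2 ^ n. (box_mass (n, k))\<^sup>2)"
  shows "AE \<omega> in M. \<not> interpolating p (\<Lambda> \<omega>)"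
proof -
  \<comment> \<open>One integer controls both generation and closeness, so only countably many null
    sets are combined.\<close>
  have "AE \<omega> in M. \<forall>m. \<exists>n\<ge>m. \<exists>k<2 ^ n. \<exists>x\<in>dyadic_box n k \<inter> \<Lambda> \<omega>. \<exists>y\<in>dyadic_box n k \<inter> \<Lambda> \<omega>.
    x \<noteq> y \<and> cmod (x - y) \<le> 2 * (1 / 2 ^ m) / 2 ^ n"
    unfolding AE_all_countable by (intro allI AE_close_pair unb) auto
  then show ?thesis
    using AE_space
  proof eventually_elim
    case (elim \<omega>)
    show ?case
    proof (rule close_pairs_not_interpolating[OF p points_subset[OF elim(2)]])
      fix e :: real assume e: "0 < e"
      \<comment> \<open>The quarter absorbs the diameter factor 2 and the factor 2 in 1 / 2 ^ n = 2
        * (1 / 2 ^ (n + 1)) \<le> 2 * (1 - |x|).\<close>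
      obtain m where m: "(1 / 2) ^ m < e / 4"
        using real_arch_pow_inv[of "e / 4" "1 / 2"] e by auto
      then have m': "1 / 2 ^ m < e / 4"
        by (simp add: power_one_over)
      obtain n k x y where n: "m \<le> n" "k < 2 ^ n" and xy: "x \<in> dyadic_box n k \<inter> \<Lambda> \<omega>" "y \<in> dyadic_box n k \<inter> \<Lambda> \<omega>"
        "x \<noteq> y" "cmod (x - y) \<le> 2 * (1 / 2 ^ m) / 2 ^ n"
        using elim(1) by blast
      have "(1::real) / 2 ^ n \<le> 1 / 2 ^ m"
        using n(1) by (intro divide_left_mono power_increasing) auto
      then have "1 / 2 ^ n \<le> e"
        using m' e by linarith
      then have near: "1 - e \<le> cmod x" "1 - e \<le> cmod y"
        using xy(1,2) dyadic_box_iff[OF n(2)] by fastforce+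
      have "2 * (1 / 2 ^ m) / 2 ^ n = 4 * (1 / 2 ^ m) * (1 / 2 ^ (n + 1) :: real)"
        by simp
      also have "\<dots> \<le> e * (1 - cmod x)"
        using m' e xy(1) dyadic_box_iff[OF n(2), of x] by (intro mult_mono) auto
      finally have "cmod (x - y) \<le> e * (1 - cmod x)"
        using xy(4) by linarith
      then show "\<exists>x\<in>\<Lambda> \<omega>. \<exists>y\<in>\<Lambda> \<omega>. x \<noteq> y \<and> 1 - e \<le> cmod x \<and> 1 - e \<le> cmod y \<and>
          cmod (x - y) \<le> e * (1 - cmod x)"
        using xy near by blast
    qed
  qed
qed

lemma suminf_box_squares:
  "(\<Sum>n. \<Sum>k<2 ^ n. (emeasure \<mu> (dyadic_box n k))\<^sup>2) = (SUP N. ennreal (\<Sum>n<N. \<Sum>k<2 ^ n. (box_mass (n, k))\<^sup>2))"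
proof -
  have "(\<Sum>k<2 ^ n. (emeasure \<mu> (dyadic_box n k))\<^sup>2) = ennreal (\<Sum>k<2 ^ n. (box_mass (n, k))\<^sup>2)" for n
    by (simp add: emeasure_box_finite[OF box_in_sets subset_refl] ennreal_power sum_ennreal)
  then show ?thesis
    by (simp add: suminf_eq_SUP sum_nonneg)
qed

end

theorem theorem3p1:
  fixes M :: "'w measure" and \<mu> :: "complex measure"
    and \<Lambda> :: "'w \<Rightarrow> complex set" and p :: ennreal
  assumes "sets \<mu> = sets (restrict_space borel unit_disk)"
    and "sigma_finite_measure \<mu>"
    and "\<And>K. compact K \<Longrightarrow> K \<subseteq> unit_disk \<Longrightarrow> emeasure \<mu> K < \<infinity>"
    and "emeasure \<mu> unit_disk = \<infinity>"
    and "poisson_point_process M \<mu> \<Lambda>"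
    and "0 < p"
  shows "{\<omega> \<in> space M. interpolating p (\<Lambda> \<omega>)} \<in> sets (completion M) \<and>
    measure (completion M) {\<omega> \<in> space M. interpolating p (\<Lambda> \<omega>)} =
      (if (\<Sum>n. \<Sum>k<2^n. (emeasure \<mu> (dyadic_box n k))\<^sup>2) < \<infinity> then 1 else 0)"
proof -
  interpret poisson_process_disk M \<mu> \<Lambda>
    using assms by unfold_locales auto
  let ?s = "\<lambda>N. \<Sum>n<N. \<Sum>k<2 ^ n. (box_mass (n, k))\<^sup>2"
  let ?S = "\<Sum>n. \<Sum>k<2^n. (emeasure \<mu> (dyadic_box n k))\<^sup>2"
  have s0: "0 \<le> ?s N" for N
    by (intro sum_nonneg) auto
  show ?thesis
  proof (cases "?S < \<infinity>")
    case True
    have "?s N \<le> enn2real ?S" for N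
    proof -
      have "ennreal (?s N) \<le> ?S"
        unfolding suminf_box_squares by (rule SUP_upper) simp
      also have "\<dots> = ennreal (enn2real ?S)"
        using True by simp
      finally show ?thesis
        by (simp add: ennreal_le_iff)
    qed
    then have "AE \<omega> in M. interpolating p (\<Lambda> \<omega>)"
      by (rule AE_interpolating[OF assms(6)])
    from AE_imp_completion_prob_1[OF prob_space_axioms this] show ?thesis
      using True by simp
  next
    case False
    have "\<exists>N. B < ?s N" for B
    proof (rule ccontr)
      assume "\<not> ?thesis"
      then have "?S \<le> ennreal B"
        unfolding suminf_box_squares by (intro SUP_least ennreal_leI) (simp add: not_less)
      from le_less_trans[OF this ennreal_less_top] have "?S < \<infinity>"
        unfolding infinity_ennreal_def .
      with False show False ..
    qed
    then have "AE \<omega> in M. \<not> interpolating p (\<Lambda> \<omega>)"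
      by (rule AE_not_interpolating[OF assms(6)])
    from AE_not_imp_completion_prob_0[OF this] show ?thesis
      using False by simp
  qed
qed

end
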